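(* Let $\mathcal{M}_1$ be a bipartite regular matroid and let $\mathcal{M}_2$ be a regular matroid, whose ground sets $E_1$, $E_2$ satisfy $E_1\cap E_2=\{p\}$. Let $P(\mathcal{M}_1,\mathcal{M}_2)$ be their parallel connection with basepoint $p$. Then \[ h^*(\Sigma(P(\mathcal{M}_1,\mathcal{M}_2));t) = \frac{h^*(\Sigma(\mathcal{M}_1);t)\,h^*(\Sigma(\mathcal{M}_2);t)}{1 + t}. \]
   Context: A matroid $\mathcal{M}$ is regular if it is representable over every field; equivalently, it is isomorphic to the vector matroid (over $\mathbb{R}$) of a totally unimodular matrix $A$ (every minor is $0$ or $\pm1$). The generalized symmetric edge polytope is $\Sigma(\mathcal{M}) = \operatorname{conv}\{\pm u \mid u \text{ is a column of } A\}$; it is well defined up to unimodular equivalence. If $\mathcal{M}$ has rank $0$, $\Sigma(\mathcal{M})$ is the single point $\{0\}$, with $h^*$-polynomial $1$. A matroid is bipartite if each of its circuits has even size. Write $\mathcal{C}(\mathcal{M})$ for the set of circuits, $\mathcal{M}-e$ for deletion, $\mathcal{M}/e$ for contraction, and $\oplus$ for the direct sum of matroids. For matroids $\mathcal{M}_1,\mathcal{M}_2$ with ground sets satisfying $E_1 \cap E_2 = \{p\}$, the parallel connection $P(\mathcal{M}_1,\mathcal{M}_2)$ is the matroid on $E_1\cup E_2$ defined as follows. If $p$ is a loop of $\mathcal{M}_1$, then $P(\mathcal{M}_1,\mathcal{M}_2)=\mathcal{M}_1\oplus(\mathcal{M}_2/p)$. If $p$ is a coloop of $\mathcal{M}_1$,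 then $P(\mathcal{M}_1,\mathcal{M}_2)=(\mathcal{M}_1-p)\oplus\mathcal{M}_2$. If $p$ is neither a loop nor a coloop of $\mathcal{M}_1$ and $p$ is a loop of $\mathcal{M}_2$, then (symmetrically) $P(\mathcal{M}_1,\mathcal{M}_2)=(\mathcal{M}_1/p)\oplus\mathcal{M}_2$. Otherwise, \[ \mathcal{C}(P(\mathcal{M}_1,\mathcal{M}_2)) = \mathcal{C}(\mathcal{M}_1) \cup \mathcal{C}(\mathcal{M}_2) \cup \{(C_1 \cup C_2) - p \mid p \in C_i \in \mathcal{C}(\mathcal{M}_i) \text{ for each } i\}. \] The parallel connection of regular matroids is known to be regular. For a lattice polytope $P \subset \mathbb{R}^n$, let $L_P(m) = |mP \cap \mathbb{Z}^n|$ for $m\ge1$ and $L_P(0)=1$; the $h^*$-polynomial $h^*(P;t)$ is defined by $\sum_{m \ge 0} L_P(m) t^m = h^*(P;t)/(1-t)^{\dim P + 1}$. *)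

theory Defs
  imports "HOL-Analysis.Analysis" "HOL-Library.Function_Algebras"
begin

text \<open>
  The dimension of the ambient space of a matrix is existentially quantified in the definition of
  regularity, so it cannot be a type here.  A vector of $R^n$ is a function \<open>nat \<Rightarrow> real\<close> that
  vanishes outside \<open>{..<n}\<close>; with the pointwise vector space structure below, the notions
  \<open>independent\<close>, \<open>dim\<close> and \<open>convex hull\<close> of the library apply to such vectors, and they do not
  depend on the choice of \<open>n\<close>.
\<close>

instantiation "fun" :: (type, real_vector) real_vector
begin

definition scaleR_fun :: "real \<Rightarrow> ('a \<Rightarrow> 'b) \<Rightarrow> 'a \<Rightarrow> 'b"
  where "scaleR_fun r f = (\<lambda>x. r *\<^sub>R f x)"

instance
  by standard (auto simp: scaleR_fun_def fun_eq_iff scaleR_add_right scaleR_add_left)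

end


subsection \<open>Matroids\<close>

record 'a matroid =
  ground :: "'a set"
  indeps :: "'a set set"

definition is_matroid :: "'a matroid \<Rightarrow> bool"
  where "is_matroid M \<longleftrightarrow>
    finite (ground M) \<and> indeps M \<subseteq> Pow (ground M) \<and> {} \<in> indeps M \<and>
    (\<forall>I J. J \<in> indeps M \<longrightarrow> I \<subseteq> J \<longrightarrow> I \<in> indeps M) \<and>
    (\<forall>I J. I \<in> indeps M \<longrightarrow> J \<in> indeps M \<longrightarrow> card I < card J \<longrightarrow>
      (\<exists>x\<in>J - I. insert x I \<in> indeps M))"

definition circuits :: "'a matroid \<Rightarrow> 'a set set"
  where "circuits M = {C. C \<subseteq> ground M \<and> C \<notin> indeps M \<and> (\<forall>D. D \<subset> C \<longrightarrow> D \<in> indeps M)}"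

definition bases :: "'a matroid \<Rightarrow> 'a set set"
  where "bases M = {B \<in> indeps M. \<forall>J\<in>indeps M. B \<subseteq> J \<longrightarrow> J = B}"

definition matroid_rank :: "'a matroid \<Rightarrow> nat"
  where "matroid_rank M = Max (card ` indeps M)"

definition loop :: "'a matroid \<Rightarrow> 'a \<Rightarrow> bool"
  where "loop M e \<longleftrightarrow> {e} \<in> circuits M"

definition coloop :: "'a matroid \<Rightarrow> 'a \<Rightarrow> bool"
  where "coloop M e \<longleftrightarrow> e \<in> ground M \<and> (\<forall>B\<in>bases M. e \<in> B)"

definition bipartite_matroid :: "'a matroid \<Rightarrow> bool"
  where "bipartite_matroid M \<longleftrightarrow> (\<forall>C\<in>circuits M. even (card C))"

definition delete :: "'a matroid \<Rightarrow> 'a \<Rightarrow> 'a matroid"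
  where "delete M e = \<lparr>ground = ground M - {e}, indeps = {I \<in> indeps M. e \<notin> I}\<rparr>"

definition contract :: "'a matroid \<Rightarrow> 'a \<Rightarrow> 'a matroid"
  where "contract M e =
    (if loop M e then delete M e
     else \<lparr>ground = ground M - {e},
           indeps = {I. I \<subseteq> ground M - {e} \<and> insert e I \<in> indeps M}\<rparr>)"

text \<open>The direct sum is only used for matroids with disjoint ground sets.\<close>

definition direct_sum :: "'a matroid \<Rightarrow> 'a matroid \<Rightarrow> 'a matroid"
  where "direct_sum M N =
    \<lparr>ground = ground M \<union> ground N,
     indeps = {I \<union> J | I J. I \<in> indeps M \<and> J \<in> indeps N}\<rparr>"

text \<open>A matroid is determined by its circuits: a set is independent iff it contains no circuit.\<close>

definition matroid_of_circuits :: "'a set \<Rightarrow> 'a set set \<Rightarrow> 'a matroid"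
  where "matroid_of_circuits E \<C> = \<lparr>ground = E, indeps = {I. I \<subseteq> E \<and> (\<forall>C\<in>\<C>. \<not> C \<subseteq> I)}\<rparr>"

definition parallel_connection :: "'a matroid \<Rightarrow> 'a matroid \<Rightarrow> 'a \<Rightarrow> 'a matroid"
  where "parallel_connection M\<^sub>1 M\<^sub>2 p =
    (if loop M\<^sub>1 p then direct_sum M\<^sub>1 (contract M\<^sub>2 p)
     else if coloop M\<^sub>1 p then direct_sum (delete M\<^sub>1 p) M\<^sub>2
     else if loop M\<^sub>2 p then direct_sum (contract M\<^sub>1 p) M\<^sub>2
     else matroid_of_circuits (ground M\<^sub>1 \<union> ground M\<^sub>2)
       (circuits M\<^sub>1 \<union> circuits M\<^sub>2 \<union>
        {(C\<^sub>1 \<union> C\<^sub>2) - {p} | C\<^sub>1 C\<^sub>2.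
           C\<^sub>1 \<in> circuits M\<^sub>1 \<and> C\<^sub>2 \<in> circuits M\<^sub>2 \<and> p \<in> C\<^sub>1 \<and> p \<in> C\<^sub>2}))"


subsection \<open>Regular matroids\<close>

text \<open>
  A real matrix with \<open>n\<close> rows whose columns are labelled by the elements of a finite set \<open>E\<close> is
  given by its columns \<open>A e\<close>, for \<open>e \<in> E\<close>.  The columns need not be distinct.
\<close>

definition is_matrix :: "nat \<Rightarrow> 'a set \<Rightarrow> ('a \<Rightarrow> nat \<Rightarrow> real) \<Rightarrow> bool"
  where "is_matrix n E A \<longleftrightarrow> finite E \<and> (\<forall>e\<in>E. \<forall>i\<ge>n. A e i = 0)"

text \<open>
  The determinant, by the Leibniz formula, of the square submatrix with row set \<open>R\<close> and columns
  \<open>c i\<close> for \<open>i \<in> R\<close>.  Different enumerations \<open>c\<close> of the same columns only change its sign.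
\<close>

definition matrix_minor :: "('a \<Rightarrow> nat \<Rightarrow> real) \<Rightarrow> nat set \<Rightarrow> (nat \<Rightarrow> 'a) \<Rightarrow> real"
  where "matrix_minor A R c = (\<Sum>\<pi> | \<pi> permutes R. of_int (sign \<pi>) * (\<Prod>i\<in>R. A (c (\<pi> i)) i))"

definition totally_unimodular :: "nat \<Rightarrow> 'a set \<Rightarrow> ('a \<Rightarrow> nat \<Rightarrow> real) \<Rightarrow> bool"
  where "totally_unimodular n E A \<longleftrightarrow> is_matrix n E A \<and>
    (\<forall>R c. R \<subseteq> {..<n} \<longrightarrow> inj_on c R \<longrightarrow> c ` R \<subseteq> E \<longrightarrow> matrix_minor A R c \<in> {-1, 0, 1})"

definition vector_matroid :: "'a set \<Rightarrow> ('a \<Rightarrow> nat \<Rightarrow> real) \<Rightarrow> 'a matroid"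
  where "vector_matroid E A =
    \<lparr>ground = E, indeps = {I. I \<subseteq> E \<and> inj_on A I \<and> independent (A ` I)}\<rparr>"

text \<open>
  As the columns may be labelled by the elements of the ground set, being isomorphic to the vector
  matroid of a matrix amounts to being equal to the vector matroid of a labelled matrix.
\<close>

definition tu_represents :: "nat \<Rightarrow> ('a \<Rightarrow> nat \<Rightarrow> real) \<Rightarrow> 'a matroid \<Rightarrow> bool"
  where "tu_represents n A M \<longleftrightarrow>
    totally_unimodular n (ground M) A \<and> M = vector_matroid (ground M) A"

definition regular_matroid :: "'a matroid \<Rightarrow> bool"
  where "regular_matroid M \<longleftrightarrow> is_matroid M \<and> (\<exists>n A. tu_represents n A M)"


subsection \<open>Generalized symmetric edge polytopes and their $h^*$-polynomials\<close>

text \<open>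
  The polytope is only well defined up to unimodular equivalence, so a totally unimodular
  representation is chosen.
\<close>

definition symmetric_edge_polytope :: "'a matroid \<Rightarrow> (nat \<Rightarrow> real) set"  (\<open>\<Sigma>\<close>)
  where "symmetric_edge_polytope M =
    (if matroid_rank M = 0 then {0}
     else let A = (SOME A. \<exists>n. tu_represents n A M)
          in convex hull (A ` ground M \<union> (\<lambda>e. - A e) ` ground M))"

text \<open>The dimension of the linear space parallel to the affine hull.\<close>

definition polytope_dim :: "(nat \<Rightarrow> real) set \<Rightarrow> nat"
  where "polytope_dim P = dim {x - y | x y. x \<in> P \<and> y \<in> P}"

definition lattice_count :: "(nat \<Rightarrow> real) set \<Rightarrow> nat \<Rightarrow> nat"
  where "lattice_count P m =
    (if m = 0 then 1 else card {x \<in> (\<lambda>v. real m *\<^sub>R v) ` P. \<forall>i. x i \<in> \<int>})"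

text \<open>
  The defining equation $\sum_m L_P(m) t^m = h^*(P;t) / (1-t)^{\dim P + 1}$ is solved for $h^*(P;t)$
  in the ring of formal power series.  For a lattice polytope, the result is a polynomial by the
  theorems of Ehrhart and Stanley; it is kept as a power series, where division by $1 + t$ is exact.
\<close>

definition hstar :: "(nat \<Rightarrow> real) set \<Rightarrow> rat fps"
  where "hstar P =
    Abs_fps (\<lambda>m. of_nat (lattice_count P m)) * (1 - fps_X) ^ (polytope_dim P + 1)"

end

theory Submission
  imports Defs "Jordan_Normal_Form.Determinant"
begin

text \<open>
  Let $\Lambda \subseteq Z^E$ be the lattice of integral relations among the columns of a totally
  unimodular matrix.  By integral decomposition, the lattice points of the dilation $m\Sigma$ are
  the cosets of $\Lambda$ that contain a vector of $\ell_1$ norm at most $m$, so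
  $h^*(\Sigma; t) = (1-t)^r \sum_X t^{\|X\|}$, where $X$ ranges over the cosets, $\|X\|$ is the
  minimal norm in $X$ and $r$ is the rank.  Since unimodular representations are unique up to the
  signs of the columns, any of them may be used for this.

  The relation space of $P(M_1, M_2)$ is the sum of those of $M_1$ and $M_2$.  If $M_1$ is
  bipartite, the parity of the norm alternates along each line $X + kp$ of cosets; as the norm is
  also convex, it equals $\|X_0\| + |k|$ on the line through its minimum $X_0$.  Hence each coset for
  $P(M_1, M_2)$ is represented by exactly one pair of a minimal coset $X_0$ for $M_1$ and a coset
  $Y$ for $M_2$, and its norm is $\|X_0\| + \|Y\|$.  If $Q(t)$ enumerates the minimal cosets, the
  sum over all cosets is $Q(t) (1+t)/(1-t)$ for $M_1$, and it is $Q(t)$ times the sum of $M_2$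
  for $P(M_1, M_2)$.
\<close>


subsection \<open>Lattices with the $\ell_1$ norm\<close>

text \<open>\<open>hstar\<close> sees a matroid only through a matrix picked by \<open>SOME\<close>,
  so no given or constructed matrix may be taken for the one in use. The argument therefore lives in
  the space \<open>K\<close> of real linear relations among the columns, and expresses unimodularity
  by supports of elements of \<open>K\<close> alone. In this form the sum of two spaces is shown to
  be unimodular by an elementary argument about cancellation at \<open>p\<close>. Matrices enter
  only at the two ends: Cramer's rule passes from a totally unimodular matrix to its relations, and
  a standard matrix is rebuilt from any unimodular space. The latter guarantees that the choice
  inside \<open>\<Sigma>\<close> has something to choose from, for the parallel connection as well.
  Besides parity, bipartiteness supplies that \<open>p\<close> is not a loop of the first matroid,
  since \<open>{p}\<close> would be an odd circuit. Because \<open>p\<close> lies in both ground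
  sets, neither is empty, and the rank 0 convention agrees with the convex hull.\<close>

definition supp :: "('a \<Rightarrow> 'b::zero) \<Rightarrow> 'a set"
  where "supp x = {e. x e \<noteq> 0}"

text \<open>Summing over the support instead of a ground set makes the norms on \<open>E1\<close>,
  \<open>E2\<close> and their union one and the same function. An infinite support would give 0, so
  the norm estimates ask for finite ones.\<close>

definition l1_norm :: "('a \<Rightarrow> int) \<Rightarrow> nat"
  where "l1_norm c = (\<Sum>e\<in>supp c. nat \<bar>c e\<bar>)"

definition lattice_in :: "'a set \<Rightarrow> ('a \<Rightarrow> int) set \<Rightarrow> bool"
  where "lattice_in E \<Lambda> \<longleftrightarrow> finite E \<and> 0 \<in> \<Lambda> \<and> (\<forall>a\<in>\<Lambda>. supp a \<subseteq> E) \<and> (\<forall>a\<in>\<Lambda>. \<forall>b\<in>\<Lambda>. a - b \<in> \<Lambda>)"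

definition coset :: "('a \<Rightarrow> int) set \<Rightarrow> ('a \<Rightarrow> int) \<Rightarrow> ('a \<Rightarrow> int) set"
  where "coset \<Lambda> c = {d. d - c \<in> \<Lambda>}"

definition wt :: "('a \<Rightarrow> int) set \<Rightarrow> ('a \<Rightarrow> int) \<Rightarrow> nat"
  where "wt \<Lambda> c = (LEAST n. \<exists>d\<in>coset \<Lambda> c. l1_norm d = n)"

text \<open>For the lattice of relations of a totally unimodular matrix, this will be the number of
  lattice points in the dilation of the polytope by \<open>m\<close>.\<close>

definition coset_count :: "'a set \<Rightarrow> ('a \<Rightarrow> int) set \<Rightarrow> nat \<Rightarrow> nat"
  where "coset_count E \<Lambda> m = card (coset \<Lambda> ` {c. supp c \<subseteq> E \<and> l1_norm c \<le> m})"

definition shell :: "'a set \<Rightarrow> ('a \<Rightarrow> int) set \<Rightarrow> nat \<Rightarrow> ('a \<Rightarrow> int) set set"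
  where "shell E \<Lambda> m = coset \<Lambda> ` {c. supp c \<subseteq> E \<and> wt \<Lambda> c = m}"

text \<open>The value type is left open: the same function gives integer multiples of the basepoint
  and real standard basis vectors.\<close>

definition unit_at :: "'a \<Rightarrow> 'b \<Rightarrow> 'a \<Rightarrow> 'b::zero"
  where "unit_at p k = (\<lambda>e. if e = p then k else 0)"

lemma l1_norm_eq:
  assumes "finite E" "supp c \<subseteq> E"
  shows "l1_norm c = (\<Sum>e\<in>E. nat \<bar>c e\<bar>)"
  unfolding l1_norm_def using assms by (intro sum.mono_neutral_left) (auto simp: supp_def)

lemma l1_norm_add:
  assumes "finite (supp c)" "finite (supp d)"
  shows "l1_norm (c + d) \<le> l1_norm c + l1_norm d"
proof -
  let ?E = "supp c \<union> supp d"
  have s: "supp (c + d) \<subseteq> ?E" by (auto simp: supp_def)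
  have "l1_norm (c + d) = (\<Sum>e\<in>?E. nat \<bar>c e + d e\<bar>)"
    using l1_norm_eq[OF _ s] assms by simp
  also have "\<dots> \<le> (\<Sum>e\<in>?E. nat \<bar>c e\<bar> + nat \<bar>d e\<bar>)"
    by (intro sum_mono) linarith
  also have "\<dots> = l1_norm c + l1_norm d"
    using assms by (simp add: sum.distrib l1_norm_eq[of ?E])
  finally show ?thesis .
qed

lemma l1_norm_add_disjoint:
  assumes "finite (supp c)" "finite (supp d)" "supp c \<inter> supp d = {}"
  shows "l1_norm (c + d) = l1_norm c + l1_norm d"
proof -
  let ?E = "supp c \<union> supp d"
  have s: "supp (c + d) \<subseteq> ?E" by (auto simp: supp_def)
  have "l1_norm (c + d) = (\<Sum>e\<in>?E. nat \<bar>c e + d e\<bar>)"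
    using l1_norm_eq[OF _ s] assms by simp
  also have "\<dots> = (\<Sum>e\<in>?E. nat \<bar>c e\<bar> + nat \<bar>d e\<bar>)"
    using assms(3) by (intro sum.cong refl) (force simp: supp_def)
  also have "\<dots> = l1_norm c + l1_norm d"
    using assms by (simp add: sum.distrib l1_norm_eq[of ?E])
  finally show ?thesis .
qed

lemma supp_unit_at: "supp (unit_at p k) \<subseteq> {p}"
  by (auto simp: supp_def unit_at_def)

lemma l1_norm_unit_at [simp]: "l1_norm (unit_at p k) = nat \<bar>k\<bar>"
  using l1_norm_eq[OF _ supp_unit_at[of p k]] by (simp add: unit_at_def)

lemma unit_at_add: "unit_at p (j + k) = unit_at p j + (unit_at p k :: 'a \<Rightarrow> 'b::monoid_add)"
  by (auto simp: unit_at_def fun_eq_iff)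

lemma unit_at_diff: "unit_at p (j - k) = unit_at p j - (unit_at p k :: 'a \<Rightarrow> 'b::group_add)"
  by (auto simp: unit_at_def fun_eq_iff)

lemma unit_at_0 [simp]: "unit_at p 0 = 0"
  by (auto simp: unit_at_def fun_eq_iff)

lemma supp_add: "supp (x + y) \<subseteq> supp x \<union> supp (y :: 'a \<Rightarrow> 'b::monoid_add)"
  by (auto simp: supp_def)

lemma supp_diff: "supp (x - y) \<subseteq> supp x \<union> supp (y :: 'a \<Rightarrow> 'b::group_add)"
  by (auto simp: supp_def)

lemma finite_l1_ball:
  assumes "finite E"
  shows "finite {c. supp c \<subseteq> E \<and> l1_norm c \<le> m}"
proof (rule finite_subset)
  show "{c. supp c \<subseteq> E \<and> l1_norm c \<le> m}
      \<subseteq> {f. \<forall>x. (x \<in> E \<longrightarrow> f x \<in> {- int m..int m}) \<and> (x \<notin> E \<longrightarrow> f x = 0)}"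
  proof (intro subsetI CollectI allI conjI impI; elim CollectE conjE)
    fix c :: "'a \<Rightarrow> int" and x assume c: "supp c \<subseteq> E" "l1_norm c \<le> m"
    { assume "x \<in> E"
      have "nat \<bar>c x\<bar> \<le> l1_norm c"
        unfolding l1_norm_eq[OF assms c(1)] using \<open>x \<in> E\<close> assms
        by (intro member_le_sum) auto
      with c(2) show "c x \<in> {- int m..int m}" by auto }
    { assume "x \<notin> E" then show "c x = 0" using c by (auto simp: supp_def) }
  qed
qed (intro finite_set_of_finite_funs assms finite_atLeastAtMost_int)

section \<open>Minimal norms in the cosets of one lattice\<close>

locale int_lattice =
  fixes E :: "'a set" and \<Lambda> :: "('a \<Rightarrow> int) set"
  assumes lat: "lattice_in E \<Lambda>"
begin

lemma finite_E: "finite E" and zero_mem: "0 \<in> \<Lambda>" and supp_mem: "a \<in> \<Lambda> \<Longrightarrow> supp a \<subseteq> E"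
  and diff_mem: "a \<in> \<Lambda> \<Longrightarrow> b \<in> \<Lambda> \<Longrightarrow> a - b \<in> \<Lambda>"
  using lat by (auto simp: lattice_in_def)

lemma minus_mem: "a \<in> \<Lambda> \<Longrightarrow> - a \<in> \<Lambda>"
  using diff_mem[OF zero_mem, of a] by simp

lemma add_mem: "a \<in> \<Lambda> \<Longrightarrow> b \<in> \<Lambda> \<Longrightarrow> a + b \<in> \<Lambda>"
  using diff_mem[OF _ minus_mem, of a b] by simp

lemma finite_supp: "supp c \<subseteq> E \<Longrightarrow> finite (supp c)"
  using finite_E by (rule rev_finite_subset)

lemma coset_eq_iff: "coset \<Lambda> c = coset \<Lambda> d \<longleftrightarrow> c - d \<in> \<Lambda>"
proof
  assume "coset \<Lambda> c = coset \<Lambda> d"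
  moreover have "c \<in> coset \<Lambda> c" by (simp add: coset_def zero_mem)
  ultimately show "c - d \<in> \<Lambda>" by (auto simp: coset_def)
next
  assume *: "c - d \<in> \<Lambda>"
  have "x - c \<in> \<Lambda> \<longleftrightarrow> x - d \<in> \<Lambda>" for x
    using add_mem[OF _ *, of "x - c"] diff_mem[OF _ *, of "x - d"] by auto
  then show "coset \<Lambda> c = coset \<Lambda> d" by (auto simp: coset_def)
qed

lemma wt_cong: "c - d \<in> \<Lambda> \<Longrightarrow> wt \<Lambda> c = wt \<Lambda> d"
  unfolding wt_def using coset_eq_iff by metis

lemma wt_le: "d - c \<in> \<Lambda> \<Longrightarrow> wt \<Lambda> c \<le> l1_norm d"
  unfolding wt_def by (rule Least_le) (auto simp: coset_def)

lemma wt_attained: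
  obtains d where "d - c \<in> \<Lambda>" "l1_norm d = wt \<Lambda> c"
proof -
  have "\<exists>d\<in>coset \<Lambda> c. l1_norm d = wt \<Lambda> c"
    unfolding wt_def by (rule LeastI_ex) (auto simp: coset_def intro!: exI[of _ c] zero_mem)
  with that show ?thesis by (auto simp: coset_def)
qed

lemma supp_coset:
  assumes "d - c \<in> \<Lambda>" "supp c \<subseteq> E"
  shows "supp d \<subseteq> E"
  using supp_add[of "d - c" c] supp_mem[OF assms(1)] assms(2) by auto

text \<open>The minimal norm is 1-Lipschitz in each coordinate direction. This bounds the slopes
  from above in the V-shape, and the gain on the second side in a gluing.\<close>

lemma wt_add_unit:
  assumes "supp c \<subseteq> E"
  shows "wt \<Lambda> (c + unit_at p k) \<le> wt \<Lambda> c + nat \<bar>k\<bar>"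
proof -
  obtain d where d: "d - c \<in> \<Lambda>" "l1_norm d = wt \<Lambda> c" by (rule wt_attained)
  have "wt \<Lambda> (c + unit_at p k) \<le> l1_norm (d + unit_at p k)"
    by (rule wt_le) (use d in \<open>simp add: algebra_simps\<close>)
  also have "\<dots> \<le> wt \<Lambda> c + nat \<bar>k\<bar>"
    using l1_norm_add[of d "unit_at p k"] supp_coset[OF d(1) assms] finite_supp
      finite_subset[OF supp_unit_at] d(2) by fastforce
  finally show ?thesis .
qed

lemma finite_shell: "finite (shell E \<Lambda> m)"
proof (rule finite_subset)
  show "shell E \<Lambda> m \<subseteq> coset \<Lambda> ` {c. supp c \<subseteq> E \<and> l1_norm c \<le> m}"
  proof
    fix X assume "X \<in> shell E \<Lambda> m"
    then obtain c where c: "X = coset \<Lambda> c" "supp c \<subseteq> E" "wt \<Lambda> c = m" by (auto simp: shell_def)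
    obtain d where d: "d - c \<in> \<Lambda>" "l1_norm d = wt \<Lambda> c" by (rule wt_attained)
    show "X \<in> coset \<Lambda> ` {c. supp c \<subseteq> E \<and> l1_norm c \<le> m}"
      using c d supp_coset[OF d(1) c(2)] coset_eq_iff[of d c]
      by (intro image_eqI[of _ _ d]) auto
  qed
qed (intro finite_imageI finite_l1_ball finite_E)

text \<open>A coset meets the ball of radius \<open>m\<close> exactly when its minimal norm is at
  most \<open>m\<close>, and the minimal norm is an invariant of the coset.\<close>

lemma coset_count_eq: "coset_count E \<Lambda> m = (\<Sum>i\<le>m. card (shell E \<Lambda> i))"
proof -
  have "coset \<Lambda> ` {c. supp c \<subseteq> E \<and> l1_norm c \<le> m} = (\<Union>i\<le>m. shell E \<Lambda> i)"
  proof (intro equalityI subsetI)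
    fix X assume "X \<in> coset \<Lambda> ` {c. supp c \<subseteq> E \<and> l1_norm c \<le> m}"
    then obtain c where c: "X = coset \<Lambda> c" "supp c \<subseteq> E" "l1_norm c \<le> m" by auto
    have "wt \<Lambda> c \<le> m" using wt_le[of c c] c(3) zero_mem by simp
    then show "X \<in> (\<Union>i\<le>m. shell E \<Lambda> i)" using c by (auto simp: shell_def)
  next
    fix X assume "X \<in> (\<Union>i\<le>m. shell E \<Lambda> i)"
    then obtain c where c: "X = coset \<Lambda> c" "supp c \<subseteq> E" "wt \<Lambda> c \<le> m" by (auto simp: shell_def)
    obtain d where d: "d - c \<in> \<Lambda>" "l1_norm d = wt \<Lambda> c" by (rule wt_attained)
    then show "X \<in> coset \<Lambda> ` {c. supp c \<subseteq> E \<and> l1_norm c \<le> m}"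
      using c supp_coset[OF d(1) c(2)] coset_eq_iff[of d c]
      by (intro image_eqI[of _ _ d]) auto
  qed
  moreover have "shell E \<Lambda> i \<inter> shell E \<Lambda> j = {}" if "i \<noteq> j" for i j
    using that by (auto simp: shell_def coset_eq_iff dest: wt_cong)
  ultimately show ?thesis
    unfolding coset_count_def by (simp add: card_UN_disjoint finite_shell)
qed

text \<open>One factor \<open>1 - fps_X\<close> turns cumulative counts into increments. It absorbs
  the \<open>+ 1\<close> in the exponent of \<open>hstar\<close>.\<close>

lemma coset_count_fps:
  "Abs_fps (\<lambda>m. of_nat (coset_count E \<Lambda> m)) * (1 - fps_X)
    = (Abs_fps (\<lambda>m. of_nat (card (shell E \<Lambda> m))) :: rat fps)"
proof (rule fps_ext)
  fix n
  show "fps_nth (Abs_fps (\<lambda>m. of_nat (coset_count E \<Lambda> m)) * (1 - fps_X)) n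
    = fps_nth (Abs_fps (\<lambda>m. of_nat (card (shell E \<Lambda> m))) :: rat fps) n"
    by (cases n) (simp_all add: algebra_simps coset_count_eq)
qed

end

text \<open>
  Gluing along \<open>p\<close>.  If the norm of the first lattice is V-shaped along every line in direction
  \<open>p\<close>, each coset of the glued lattice has a unique representative whose first component is the
  minimum of its line, and the norm of this representative is the sum of the two norms.
\<close>

locale glued_lattices =
  l1: int_lattice E1 \<Lambda>1 + l2: int_lattice E2 \<Lambda>2
  for E1 E2 :: "'a set" and \<Lambda>1 \<Lambda>2 +
  fixes p :: 'a
  assumes inter: "E1 \<inter> E2 = {p}"
    and V_shaped: "\<And>c k. supp c \<subseteq> E1 \<Longrightarrow> (\<And>j. wt \<Lambda>1 c \<le> wt \<Lambda>1 (c + unit_at p j))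
      \<Longrightarrow> wt \<Lambda>1 (c + unit_at p k) = wt \<Lambda>1 c + nat \<bar>k\<bar>"
begin

definition line_min :: "('a \<Rightarrow> int) \<Rightarrow> bool"
  where "line_min c \<longleftrightarrow> supp c \<subseteq> E1 \<and> (\<forall>j. wt \<Lambda>1 c \<le> wt \<Lambda>1 (c + unit_at p j))"

definition min_shell :: "nat \<Rightarrow> ('a \<Rightarrow> int) set set"
  where "min_shell m = coset \<Lambda>1 ` {c. line_min c \<and> wt \<Lambda>1 c = m}"

abbreviation glued :: "('a \<Rightarrow> int) set"
  where "glued \<equiv> {a + b | a b. a \<in> \<Lambda>1 \<and> b \<in> \<Lambda>2}"

lemma gluedI: "a \<in> \<Lambda>1 \<Longrightarrow> b \<in> \<Lambda>2 \<Longrightarrow> c = a + b \<Longrightarrow> c \<in> glued"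
  by blast

sublocale glued: int_lattice "E1 \<union> E2" glued
proof (standard, unfold lattice_in_def, intro conjI ballI)
  show "0 \<in> glued" using gluedI[OF l1.zero_mem l2.zero_mem] by simp
  show "supp a \<subseteq> E1 \<union> E2" if "a \<in> glued" for a
    using that supp_add l1.supp_mem l2.supp_mem by fast
  show "a - b \<in> glued" if "a \<in> glued" "b \<in> glued" for a b
  proof -
    obtain u v where 1: "a = u + v" "u \<in> \<Lambda>1" "v \<in> \<Lambda>2" using \<open>a \<in> glued\<close> by blast
    obtain u' v' where 2: "b = u' + v'" "u' \<in> \<Lambda>1" "v' \<in> \<Lambda>2" using \<open>b \<in> glued\<close> by blast
    note * = 1 2
    show ?thesis
      by (rule gluedI[of "u - u'" "v - v'"]) (use * l1.diff_mem l2.diff_mem in \<open>auto simp: algebra_simps\<close>)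
  qed
qed (simp_all add: l1.finite_E l2.finite_E)

text \<open>Two vectors on \<open>E1\<close> and \<open>E2\<close> that cancel live on the
  intersection. A multiple of \<open>p\<close> is thus the only ambiguity in splitting a vector on
  the union.\<close>

lemma eq_unit_at:
  assumes "a + b = 0" "supp a \<subseteq> E1" "supp b \<subseteq> E2"
  obtains k :: int where "a = unit_at p k" "b = unit_at p (- k)"
proof
  have ab: "a e + b e = 0" for e using assms(1) by (metis plus_fun_apply zero_fun_apply)
  have "e \<in> E1 \<or> a e = 0" "e \<in> E2 \<or> b e = 0" for e using assms(2,3) by (auto simp: supp_def)
  then have "a e = 0 \<and> b e = 0" if "e \<noteq> p" for e
    using that inter ab[of e] by (metis IntI add.right_neutral add.left_neutral singletonD)
  moreover have "b p = - a p" using ab[of p] by simp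
  ultimately show "a = unit_at p (a p)" "b = unit_at p (- a p)"
    by (auto simp: unit_at_def fun_eq_iff)
qed

lemma glued_diffE:
  assumes "(c1 + c2) - (d1 + d2) \<in> glued" "supp c1 \<subseteq> E1" "supp d1 \<subseteq> E1" "supp c2 \<subseteq> E2" "supp d2 \<subseteq> E2"
  obtains k where "c1 - (d1 + unit_at p k) \<in> \<Lambda>1" "c2 - (d2 + unit_at p (- k)) \<in> \<Lambda>2"
proof -
  obtain a b where ab: "a \<in> \<Lambda>1" "b \<in> \<Lambda>2" "(c1 + c2) - (d1 + d2) = a + b" using assms(1) by blast
  have "(c1 - d1 - a) + (c2 - d2 - b) = 0" using ab(3) by (simp add: algebra_simps)
  moreover have "supp (c1 - d1 - a) \<subseteq> E1"
    using supp_diff[of "c1 - d1" a] supp_diff[of c1 d1] assms l1.supp_mem[OF ab(1)] by blast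
  moreover have "supp (c2 - d2 - b) \<subseteq> E2"
    using supp_diff[of "c2 - d2" b] supp_diff[of c2 d2] assms l2.supp_mem[OF ab(2)] by blast
  ultimately obtain k where k: "c1 - d1 - a = unit_at p k" "c2 - d2 - b = unit_at p (- k)"
    by (rule eq_unit_at)
  have "c1 - (d1 + unit_at p k) = a" "c2 - (d2 + unit_at p (- k)) = b"
    using k[symmetric] by (simp_all add: algebra_simps)
  with ab that show ?thesis by metis
qed

lemma line_min_V: "line_min c \<Longrightarrow> wt \<Lambda>1 (c + unit_at p k) = wt \<Lambda>1 c + nat \<bar>k\<bar>"
  unfolding line_min_def by (rule V_shaped) auto

lemma p_in: "p \<in> E1" "p \<in> E2" using inter by auto

lemma supp_add_unit:
  fixes c :: "'a \<Rightarrow> int"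
  shows "supp c \<subseteq> E1 \<Longrightarrow> supp (c + unit_at p k) \<subseteq> E1"
  "supp c \<subseteq> E2 \<Longrightarrow> supp (c + unit_at p k) \<subseteq> E2"
  using supp_add[of c "unit_at p k"] supp_unit_at[of p k] p_in by auto

text \<open>The lower bound is the point: a shortest representative may split into vectors shifted
  by \<open>k\<close> at \<open>p\<close> on one side and by \<open>-k\<close> on the other. The
  V-shape charges the full \<open>\<bar>k\<bar>\<close> on the first side, while the Lipschitz bound
  lets the second side save at most that.\<close>

lemma wt_glued:
  assumes "line_min c1" "supp c2 \<subseteq> E2"
  shows "wt glued (c1 + c2) = wt \<Lambda>1 c1 + wt \<Lambda>2 c2"
proof (rule antisym)
  have s1: "supp c1 \<subseteq> E1" using assms(1) by (simp add: line_min_def)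
  obtain d1 where d1: "d1 - c1 \<in> \<Lambda>1" "l1_norm d1 = wt \<Lambda>1 c1" by (rule l1.wt_attained)
  obtain d2 where d2: "d2 - c2 \<in> \<Lambda>2" "l1_norm d2 = wt \<Lambda>2 c2" by (rule l2.wt_attained)
  have "wt glued (c1 + c2) \<le> l1_norm (d1 + d2)"
    by (intro glued.wt_le gluedI[OF d1(1) d2(1)]) (simp add: algebra_simps)
  also have "\<dots> \<le> l1_norm d1 + l1_norm d2"
    using l1.finite_supp l2.finite_supp l1.supp_coset[OF d1(1) s1] l2.supp_coset[OF d2(1) assms(2)]
    by (intro l1_norm_add) auto
  finally show "wt glued (c1 + c2) \<le> wt \<Lambda>1 c1 + wt \<Lambda>2 c2" using d1 d2 by simp
  obtain d where d: "d - (c1 + c2) \<in> glued" "l1_norm d = wt glued (c1 + c2)"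
    by (rule glued.wt_attained)
  have sd: "supp d \<subseteq> E1 \<union> E2"
    by (rule glued.supp_coset[OF d(1)]) (use s1 assms(2) supp_add[of c1 c2] in blast)
  \<comment> \<open>The coordinate at \<open>p\<close> goes entirely to the second part, so the
    supports are disjoint and the norms add up exactly.\<close>
  define e1 where "e1 = (\<lambda>e. if e \<in> E2 then 0 else d e)"
  define e2 where "e2 = (\<lambda>e. if e \<in> E2 then d e else 0)"
  have de: "d = e1 + e2" by (auto simp: e1_def e2_def fun_eq_iff)
  have se: "supp e1 \<subseteq> E1" "supp e2 \<subseteq> E2" "supp e1 \<inter> supp e2 = {}"
    using sd by (auto simp: e1_def e2_def supp_def split: if_splits)
  obtain k where k: "e1 - (c1 + unit_at p k) \<in> \<Lambda>1" "e2 - (c2 + unit_at p (- k)) \<in> \<Lambda>2"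
    using d(1) unfolding de by (rule glued_diffE) (use se s1 assms in auto)
  have "c2 - (c2 + unit_at p (- k) + unit_at p k) = 0"
    by (simp add: unit_at_add[symmetric] add.assoc)
  then have "wt \<Lambda>2 c2 = wt \<Lambda>2 (c2 + unit_at p (- k) + unit_at p k)"
    by (intro l2.wt_cong) (simp add: l2.zero_mem)
  also have "\<dots> \<le> wt \<Lambda>2 (c2 + unit_at p (- k)) + nat \<bar>k\<bar>"
    by (intro l2.wt_add_unit supp_add_unit assms)
  finally have "wt \<Lambda>1 c1 + wt \<Lambda>2 c2 \<le> wt \<Lambda>1 (c1 + unit_at p k) + wt \<Lambda>2 (c2 + unit_at p (- k))"
    by (simp add: line_min_V[OF assms(1)])
  also have "\<dots> \<le> l1_norm e1 + l1_norm e2"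
    by (intro add_mono l1.wt_le l2.wt_le k)
  also have "\<dots> = l1_norm d"
    unfolding de using se l1.finite_supp l2.finite_supp by (intro l1_norm_add_disjoint[symmetric]) auto
  finally show "wt \<Lambda>1 c1 + wt \<Lambda>2 c2 \<le> wt glued (c1 + c2)" using d(2) by simp
qed

lemma ex_line_min:
  assumes "supp c \<subseteq> E1"
  obtains k where "line_min (c + unit_at p k)"
proof -
  define k where "k = (ARG_MIN (\<lambda>k. wt \<Lambda>1 (c + unit_at p k)) k. True)"
  have "wt \<Lambda>1 (c + unit_at p k) \<le> wt \<Lambda>1 (c + unit_at p j)" for j
    unfolding k_def by (rule arg_min_nat_le) simp
  then have "line_min (c + unit_at p k)"
    unfolding line_min_def using supp_add_unit assms
    by (auto simp: add.assoc unit_at_add[symmetric])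
  with that show ?thesis by blast
qed

lemma card_shell_glued:
  "card (shell (E1 \<union> E2) glued m) = (\<Sum>i\<le>m. card (min_shell i) * card (shell E2 \<Lambda>2 (m - i)))"
proof -
  define T where "T = (SIGMA i:{..m}. min_shell i \<times> shell E2 \<Lambda>2 (m - i))"
  \<comment> \<open>The map is a Minkowski sum of cosets, which avoids choosing representatives. The
    tag \<open>i\<close> only records the norm of the first coset and is ignored.\<close>
  define g where "g = (\<lambda>(i::nat, X, Y). {a + b | a b. a \<in> X \<and> b \<in> (Y :: ('a \<Rightarrow> int) set)})"
  have g: "g (i, coset \<Lambda>1 c1, coset \<Lambda>2 c2) = coset glued (c1 + c2)" for i c1 c2
  proof (intro equalityI subsetI)
    fix x assume "x \<in> g (i, coset \<Lambda>1 c1, coset \<Lambda>2 c2)"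
    then obtain a b where "x = a + b" "a - c1 \<in> \<Lambda>1" "b - c2 \<in> \<Lambda>2" by (auto simp: g_def coset_def)
    then have "x - (c1 + c2) \<in> glued" by (intro gluedI[of "a - c1" "b - c2"]) (auto simp: algebra_simps)
    then show "x \<in> coset glued (c1 + c2)" by (simp add: coset_def)
  next
    fix x assume "x \<in> coset glued (c1 + c2)"
    then obtain a b where "x - (c1 + c2) = a + b" "a \<in> \<Lambda>1" "b \<in> \<Lambda>2" unfolding coset_def by blast
    then have "x = (a + c1) + (b + c2)" "a + c1 \<in> coset \<Lambda>1 c1" "b + c2 \<in> coset \<Lambda>2 c2"
      by (auto simp: algebra_simps coset_def)
    then show "x \<in> g (i, coset \<Lambda>1 c1, coset \<Lambda>2 c2)" unfolding g_def by blast
  qed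
  have "bij_betw g T (shell (E1 \<union> E2) glued m)"
  proof (rule bij_betw_imageI)
    show "inj_on g T"
    proof (rule inj_onI)
      fix x y assume x: "x \<in> T" and y: "y \<in> T" and eq: "g x = g y"
      obtain i c1 c2 where c: "x = (i, coset \<Lambda>1 c1, coset \<Lambda>2 c2)" "line_min c1" "supp c2 \<subseteq> E2"
        "wt \<Lambda>1 c1 = i" using x by (auto simp: T_def min_shell_def shell_def)
      obtain j d1 d2 where d: "y = (j, coset \<Lambda>1 d1, coset \<Lambda>2 d2)" "line_min d1" "supp d2 \<subseteq> E2"
        "wt \<Lambda>1 d1 = j" using y by (auto simp: T_def min_shell_def shell_def)
      have "(c1 + c2) - (d1 + d2) \<in> glued" using eq unfolding c(1) d(1) g glued.coset_eq_iff .
      then obtain k where k: "c1 - (d1 + unit_at p k) \<in> \<Lambda>1" "c2 - (d2 + unit_at p (- k)) \<in> \<Lambda>2"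
        by (rule glued_diffE) (use c d in \<open>auto simp: line_min_def\<close>)
      \<comment> \<open>Both \<open>c1\<close> and \<open>d1\<close> are minima of the same line, so
        each norm exceeds the other by \<open>\<bar>k\<bar>\<close>, which forces
        \<open>k = 0\<close>.\<close>
      have "wt \<Lambda>1 c1 = wt \<Lambda>1 d1 + nat \<bar>k\<bar>"
        using l1.wt_cong[OF k(1)] line_min_V[OF d(2)] by simp
      moreover have "wt \<Lambda>1 d1 = wt \<Lambda>1 c1 + nat \<bar>- k\<bar>"
      proof -
        have "c1 + unit_at p (- k) - d1 \<in> \<Lambda>1"
          using k(1) unit_at_diff[of p 0 k] by (simp add: algebra_simps)
        from l1.wt_cong[OF this] line_min_V[OF c(2)] show ?thesis by simp
      qed
      ultimately have "k = 0" by simp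
      with k c d l1.wt_cong[of c1 d1] show "x = y"
        by (auto simp: l1.coset_eq_iff l2.coset_eq_iff)
    qed
    show "g ` T = shell (E1 \<union> E2) glued m"
    proof (intro equalityI subsetI)
      fix X assume "X \<in> g ` T"
      then obtain i c1 c2 where c: "X = g (i, coset \<Lambda>1 c1, coset \<Lambda>2 c2)" "line_min c1" "supp c2 \<subseteq> E2"
        "wt \<Lambda>1 c1 = i" "wt \<Lambda>2 c2 = m - i" "i \<le> m" by (auto simp: T_def min_shell_def shell_def)
      have "supp (c1 + c2) \<subseteq> E1 \<union> E2" using c supp_add[of c1 c2] by (auto simp: line_min_def)
      moreover have "wt glued (c1 + c2) = m" using wt_glued[OF c(2,3)] c by simp
      ultimately show "X \<in> shell (E1 \<union> E2) glued m" unfolding c(1) g shell_def by blast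
    next
      fix X assume "X \<in> shell (E1 \<union> E2) glued m"
      then obtain c where c: "X = coset glued c" "supp c \<subseteq> E1 \<union> E2" "wt glued c = m"
        by (auto simp: shell_def)
      define c1 where "c1 = (\<lambda>e. if e \<in> E2 then 0 else c e)"
      define c2 where "c2 = (\<lambda>e. if e \<in> E2 then c e else 0)"
      have s: "supp c1 \<subseteq> E1" "supp c2 \<subseteq> E2"
        using c(2) by (auto simp: c1_def c2_def supp_def split: if_splits)
      obtain k where k: "line_min (c1 + unit_at p k)" using ex_line_min[OF s(1)] .
      have cc: "c = (c1 + unit_at p k) + (c2 + unit_at p (- k))"
        by (auto simp: c1_def c2_def fun_eq_iff unit_at_def)
      have s2: "supp (c2 + unit_at p (- k)) \<subseteq> E2" by (intro supp_add_unit s)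
      define i where "i = wt \<Lambda>1 (c1 + unit_at p k)"
      have m: "m = i + wt \<Lambda>2 (c2 + unit_at p (- k))"
        using wt_glued[OF k s2] c(3) by (simp add: i_def flip: cc)
      have "(i, coset \<Lambda>1 (c1 + unit_at p k), coset \<Lambda>2 (c2 + unit_at p (- k))) \<in> T"
        using k s2 m by (auto simp: T_def min_shell_def shell_def i_def)
      moreover have "X = g (i, coset \<Lambda>1 (c1 + unit_at p k), coset \<Lambda>2 (c2 + unit_at p (- k)))"
        unfolding g c(1) by (simp flip: cc)
      ultimately show "X \<in> g ` T" by blast
    qed
  qed
  then have "card (shell (E1 \<union> E2) glued m) = card T" by (simp add: bij_betw_same_card)
  moreover have "finite (min_shell i)" for i
    by (rule finite_subset[OF _ l1.finite_shell[of i]]) (auto simp: min_shell_def shell_def line_min_def)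
  ultimately show ?thesis
    by (simp add: T_def card_SigmaI card_cartesian_product l2.finite_shell)
qed

lemma shell_fps_glued:
  "(Abs_fps (\<lambda>m. of_nat (card (shell (E1 \<union> E2) glued m))) :: rat fps)
    = Abs_fps (\<lambda>m. of_nat (card (min_shell m))) * Abs_fps (\<lambda>m. of_nat (card (shell E2 \<Lambda>2 m)))"
  by (rule fps_ext) (simp add: card_shell_glued fps_mult_nth atLeast0AtMost)

end

text \<open>With only the zero relation on one element, the cosets are the integers with their
  absolute values. Their generating function \<open>(1 + t) / (1 - t)\<close> is the origin of the
  factor \<open>1 + t\<close>.\<close>

lemma card_shell_point:
  fixes p :: 'a
  shows "card (shell {p} {0} m) = (if m = 0 then 1 else 2)"
proof -
  interpret int_lattice "{p}" "{0}" by standard (auto simp: lattice_in_def supp_def)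
  have w: "wt {0} c = l1_norm c" for c :: "'a \<Rightarrow> int"
    by (rule wt_attained[of c]) simp
  have "{c. supp c \<subseteq> {p} \<and> wt {0} c = m} = unit_at p ` {int m, - int m}"
  proof (intro equalityI subsetI)
    fix c assume c: "c \<in> {c. supp c \<subseteq> {p} \<and> wt {0} c = m}"
    then have "c = unit_at p (c p)" by (auto simp: supp_def unit_at_def fun_eq_iff)
    moreover from this have "nat \<bar>c p\<bar> = m" using c w l1_norm_unit_at by (metis (mono_tags) mem_Collect_eq)
    then have "c p \<in> {int m, - int m}" by auto
    ultimately show "c \<in> unit_at p ` {int m, - int m}" by blast
  qed (use supp_unit_at w in fastforce)
  moreover have "inj (coset {0 :: 'a \<Rightarrow> int})" by (rule injI) (simp add: coset_eq_iff)
  moreover have "inj (unit_at p :: int \<Rightarrow> _)" by (rule injI) (metis unit_at_def)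
  ultimately have "card (shell {p} {0} m) = card {int m, - int m}"
    unfolding shell_def by (metis card_image inj_on_subset subset_UNIV)
  then show ?thesis by simp
qed

text \<open>Gluing the one-point lattice along \<open>p\<close> leaves the first lattice unchanged,
  so the product formula for gluings, applied to this trivial one, evaluates the first lattice
  itself.\<close>

lemma (in glued_lattices) shell_fps:
  "(Abs_fps (\<lambda>m. of_nat (card (shell E1 \<Lambda>1 m))) :: rat fps) * (1 - fps_X)
    = Abs_fps (\<lambda>m. of_nat (card (min_shell m))) * (1 + fps_X)"
proof -
  interpret pt: glued_lattices E1 "{p}" \<Lambda>1 "{0}" p
    using V_shaped inter by unfold_locales (auto simp: lattice_in_def supp_def)
  have "pt.glued = \<Lambda>1" "E1 \<union> {p} = E1" using p_in by auto
  moreover have "pt.min_shell = min_shell"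
    by (simp add: fun_eq_iff pt.min_shell_def min_shell_def pt.line_min_def line_min_def)
  moreover have "(Abs_fps (\<lambda>m. of_nat (card (shell {p} {0} m))) :: rat fps) * (1 - fps_X) = 1 + fps_X"
  proof (rule fps_ext)
    fix n
    show "fps_nth ((Abs_fps (\<lambda>m. of_nat (card (shell {p} {0} m))) :: rat fps) * (1 - fps_X)) n
      = fps_nth (1 + fps_X) n"
      by (cases n) (auto simp: card_shell_point algebra_simps)
  qed
  ultimately show ?thesis using pt.shell_fps_glued by (simp add: mult.assoc)
qed


subsection \<open>Spaces of linear relations\<close>

lemma scaleR_fun_apply [simp]: "(r *\<^sub>R f) x = r *\<^sub>R f x"
  by (simp add: scaleR_fun_def)

lemma sum_fun_apply: "(\<Sum>i\<in>I. f i) x = (\<Sum>i\<in>I. f i x)"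
  by (induction I rule: infinite_finite_induct) auto

text \<open>Parity rules out a flat first step, so the minimum at 0 makes its slope at least 1.
  Convexity preserves this bound, and the Lipschitz premise caps every slope at 1.\<close>

lemma V_shape_nat:
  fixes g :: "int \<Rightarrow> nat"
  assumes min: "\<And>k. g 0 \<le> g k"
    and cvx: "\<And>k. 2 * g k \<le> g (k - 1) + g (k + 1)"
    and flip: "even (g 1) \<longleftrightarrow> odd (g 0)"
    and step: "\<And>k. g (k + 1) \<le> g k + 1"
  shows "g (int n) = g 0 + n"
proof -
  have "g (int n + 1) = g (int n) + 1" for n
  proof (induction n)
    case 0
    have "g 1 \<noteq> g 0" using flip by auto
    with min[of 1] step[of 0] show ?case by simp
  next
    case (Suc n)
    from cvx[of "int (Suc n)"] Suc step[of "int (Suc n)"] show ?case by (simp add: add.commute)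
  qed
  then show ?thesis by (induction n) (auto simp: add.commute)
qed

lemma V_shape:
  fixes g :: "int \<Rightarrow> nat"
  assumes min: "\<And>k. g 0 \<le> g k"
    and cvx: "\<And>k. 2 * g k \<le> g (k - 1) + g (k + 1)"
    and flip: "\<And>k. even (g (k + 1)) \<longleftrightarrow> odd (g k)"
    and step: "\<And>k. g (k + 1) \<le> g k + 1" "\<And>k. g (k - 1) \<le> g k + 1"
  shows "g k = g 0 + nat \<bar>k\<bar>"
proof (cases "k \<ge> 0")
  case True
  then show ?thesis
    using V_shape_nat[of g "nat k"] min cvx flip[of 0] step(1) by simp
next
  case False
  have "2 * g (- k) \<le> g (- k + 1) + g (- k - 1)" for k
    using cvx[of "- k"] by simp
  then show ?thesis
    using False V_shape_nat[of "\<lambda>k. g (- k)" "nat (- k)"] min flip[of "-1"] step(2)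
    by (simp add: algebra_simps minus_diff_eq)
qed

text \<open>The absolute value stays linear in \<open>t\<close> as long as the coordinate does not
  pass through 0. The last premise says exactly that.\<close>

lemma abs_add_scaled:
  fixes c t y :: real
  assumes "t \<ge> 0" "y \<noteq> 0 \<Longrightarrow> c \<noteq> 0" "sgn c * y < 0 \<Longrightarrow> t * \<bar>y\<bar> \<le> \<bar>c\<bar>"
  shows "\<bar>c + t * y\<bar> = \<bar>c\<bar> + t * (sgn c * y)"
proof -
  consider "c > 0" | "c = 0" | "c < 0" by linarith
  then show ?thesis
  proof cases
    case 1
    then have "y < 0 \<Longrightarrow> - (t * y) \<le> c" using assms(3) by simp
    moreover have "y \<ge> 0 \<Longrightarrow> t * y \<ge> 0" using assms(1) by simp
    ultimately show ?thesis using 1 by (cases "y < 0") auto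
  next
    case 2 then show ?thesis using assms(2) by auto
  next
    case 3
    then have "y > 0 \<Longrightarrow> t * y \<le> - c" using assms(3) by simp
    moreover have "y \<le> 0 \<Longrightarrow> t * y \<le> 0" using assms(1) by (simp add: mult_nonneg_nonpos)
    ultimately show ?thesis using 3 by (cases "y > 0") auto
  qed
qed

lemma even_sum_abs: "even (\<Sum>e\<in>A. \<bar>f e\<bar>) \<longleftrightarrow> even (\<Sum>e\<in>A. f e :: int)"
  by (induction A rule: infinite_finite_induct) auto

lemma even_sum_nat_abs: "even (\<Sum>e\<in>A. nat \<bar>f e\<bar>) \<longleftrightarrow> even (\<Sum>e\<in>A. f e :: int)"
  by (induction A rule: infinite_finite_induct) (auto simp: even_nat_iff)

text \<open>
  A linear matroid is handled through the space of linear relations among its vectors.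
\<close>

definition free :: "('a \<Rightarrow> real) set \<Rightarrow> 'a set \<Rightarrow> bool"
  where "free K I \<longleftrightarrow> (\<forall>x\<in>K. supp x \<subseteq> I \<longrightarrow> x = 0)"

definition relation_matroid :: "'a set \<Rightarrow> ('a \<Rightarrow> real) set \<Rightarrow> 'a matroid"
  where "relation_matroid E K = \<lparr>ground = E, indeps = {I. I \<subseteq> E \<and> free K I}\<rparr>"

text \<open>For a space of vectors with finite support, this says that the vectors of minimal
  nonzero support are multiples of vectors with entries 0 and 1 and -1: the real form of Tutte's
  regular chain groups. No matrix is mentioned, so the property can be checked on sums of
  spaces.\<close>

definition unimodular :: "('a \<Rightarrow> real) set \<Rightarrow> bool"
  where "unimodular K \<longleftrightarrow>
    (\<forall>x\<in>K. x \<noteq> 0 \<longrightarrow> (\<exists>y\<in>K. y \<noteq> 0 \<and> supp y \<subseteq> supp x \<and> range y \<subseteq> {-1, 0, 1}))"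

definition int_relations :: "('a \<Rightarrow> real) set \<Rightarrow> ('a \<Rightarrow> int) set"
  where "int_relations K = {c. (\<lambda>e. real_of_int (c e)) \<in> K}"

locale relation_space =
  fixes E :: "'a set" and K :: "('a \<Rightarrow> real) set"
  assumes finite_E: "finite E" and subspace: "subspace K" and supp_mem: "x \<in> K \<Longrightarrow> supp x \<subseteq> E"
begin

lemmas add_mem = subspace_add[OF subspace]
lemmas diff_mem = subspace_diff[OF subspace]
lemmas scale_mem = subspace_scale[OF subspace]
lemmas zero_mem = subspace_0[OF subspace]
lemmas sum_mem = subspace_sum[OF subspace]

definition basis :: "'a set \<Rightarrow> bool"
  where "basis B \<longleftrightarrow> B \<subseteq> E \<and> free K B \<and> (\<forall>e\<in>E - B. \<not> free K (insert e B))"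

lemma free_subset: "free K I \<Longrightarrow> J \<subseteq> I \<Longrightarrow> free K J"
  by (auto simp: free_def)

lemma free_empty: "free K {}"
  by (auto simp: free_def supp_def fun_eq_iff)

lemma ex_basis:
  assumes "free K I" "I \<subseteq> E"
  obtains B where "basis B" "I \<subseteq> B"
proof -
  have "\<exists>J. (J \<subseteq> E \<and> free K J \<and> I \<subseteq> J) \<and> (\<forall>J'. J' \<subseteq> E \<and> free K J' \<and> I \<subseteq> J' \<longrightarrow> card J' \<le> card J)"
    using assms by (intro ex_has_greatest_nat[of _ I _ "Suc (card E)"])
      (auto intro!: card_mono finite_E simp: less_Suc_eq_le)
  then obtain B where B: "B \<subseteq> E" "free K B" "I \<subseteq> B"
    and max: "\<And>J. J \<subseteq> E \<Longrightarrow> free K J \<Longrightarrow> I \<subseteq> J \<Longrightarrow> card J \<le> card B" by auto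
  have "finite B" using B(1) finite_E by (rule finite_subset)
  then have "\<not> free K (insert e B)" if "e \<in> E - B" for e
    using max[of "insert e B"] B that by auto
  with B that show ?thesis by (auto simp: basis_def)
qed

lemma eq_off_free:
  assumes "free K B" "x \<in> K" "y \<in> K" "\<And>e. e \<notin> B \<Longrightarrow> x e = y e"
  shows "x = y"
proof -
  have "supp (x - y) \<subseteq> B" using assms(4) by (auto simp: supp_def)
  then have "x - y = 0" using assms(1) diff_mem[OF assms(2,3)] by (auto simp: free_def)
  then show ?thesis by simp
qed

text \<open>This is the relation on the fundamental circuit of \<open>e\<close> with respect to
  \<open>B\<close>, normalized at \<open>e\<close>. For a basis \<open>B\<close> and
  \<open>e\<close> in \<open>E - B\<close> the choice is unique.\<close>

definition fund :: "'a set \<Rightarrow> 'a \<Rightarrow> 'a \<Rightarrow> real"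
  where "fund B e = (SOME x. x \<in> K \<and> x e = 1 \<and> supp x \<subseteq> insert e B)"

lemma fund:
  assumes "basis B" "e \<in> E - B"
  shows "fund B e \<in> K" "fund B e e = 1" "supp (fund B e) \<subseteq> insert e B"
proof -
  obtain x where x: "x \<in> K" "supp x \<subseteq> insert e B" "x \<noteq> 0"
    using assms unfolding basis_def free_def by blast
  have "x e \<noteq> 0"
  proof
    assume "x e = 0"
    then have "supp x \<subseteq> B" using x(2) by (auto simp: supp_def)
    then show False using x assms by (auto simp: basis_def free_def)
  qed
  then have "inverse (x e) *\<^sub>R x \<in> K \<and> (inverse (x e) *\<^sub>R x) e = 1
    \<and> supp (inverse (x e) *\<^sub>R x) \<subseteq> insert e B"
    using x scale_mem by (auto simp: supp_def)
  then have "fund B e \<in> K \<and> fund B e e = 1 \<and> supp (fund B e) \<subseteq> insert e B"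
    unfolding fund_def by (rule someI[where P = "\<lambda>x. x \<in> K \<and> x e = 1 \<and> supp x \<subseteq> insert e B"])
  then show "fund B e \<in> K" "fund B e e = 1" "supp (fund B e) \<subseteq> insert e B" by auto
qed

lemma fund_nonzero: "basis B \<Longrightarrow> e \<in> E - B \<Longrightarrow> fund B e \<noteq> 0"
  using fund(2)[of B e] by force

lemma fund_off: "basis B \<Longrightarrow> e \<in> E - B \<Longrightarrow> g \<notin> B \<Longrightarrow> fund B e g = (if g = e then 1 else 0)"
  using fund[of B e] by (auto simp: supp_def)

text \<open>Off \<open>B\<close> the vector \<open>fund B e\<close> is the unit vector at
  \<open>e\<close>, so both sides agree there, and a relation is determined by its values off a free
  set.\<close>

lemma fund_expansion:
  assumes "basis B" "x \<in> K"
  shows "x = (\<Sum>e\<in>E - B. x e *\<^sub>R fund B e)"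
proof (rule eq_off_free)
  show "free K B" using assms by (simp add: basis_def)
  show "(\<Sum>e\<in>E - B. x e *\<^sub>R fund B e) \<in> K" using fund assms by (intro sum_mem scale_mem) auto
  fix g assume g: "g \<notin> B"
  have "(\<Sum>e\<in>E - B. x e *\<^sub>R fund B e) g = (\<Sum>e\<in>E - B. if e = g then x e else 0)"
    unfolding sum_fun_apply using assms g by (intro sum.cong) (auto simp: fund_off)
  also have "\<dots> = x g"
    using finite_E g supp_mem[OF assms(2)] by (auto simp: supp_def)
  finally show "x g = (\<Sum>e\<in>E - B. x e *\<^sub>R fund B e) g" by simp
qed (use assms in auto)

lemma fund_unique:
  assumes "basis B" "e \<in> E - B" "x \<in> K" "supp x \<subseteq> insert e B"
  shows "x = x e *\<^sub>R fund B e"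
proof (rule eq_off_free)
  show "free K B" using assms by (simp add: basis_def)
  show "x g = (x e *\<^sub>R fund B e) g" if "g \<notin> B" for g
    using assms that by (auto simp: fund_off supp_def)
qed (use assms fund scale_mem in auto)

text \<open>A relation inside the support is a multiple of the fundamental one, and a nonzero
  multiple has the whole support. This is how the hypothesis on circuits reaches the
  relations.\<close>

lemma supp_fund_circuit:
  assumes "basis B" "e \<in> E - B"
  shows "supp (fund B e) \<in> circuits (relation_matroid E K)"
proof -
  note f = fund[OF assms]
  have "\<not> free K (supp (fund B e))"
    using f(1) fund_nonzero[OF assms] unfolding free_def by blast
  moreover have "free K D" if D: "D \<subset> supp (fund B e)" for D
    unfolding free_def
  proof (intro ballI impI)
    fix x assume x: "x \<in> K" "supp x \<subseteq> D"
    have *: "x = x e *\<^sub>R fund B e" by (rule fund_unique[OF assms x(1)]) (use x D f in auto)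
    show "x = 0"
    proof (rule ccontr)
      assume "x \<noteq> 0"
      then have "x e \<noteq> 0" using * scaleR_zero_left by metis
      then have "supp x = supp (fund B e)" by (subst *) (auto simp: supp_def)
      then show False using x D by auto
    qed
  qed
  ultimately show ?thesis
    using supp_mem[OF f(1)] by (auto simp: circuits_def relation_matroid_def)
qed

text \<open>This is a simplex-like descent: move \<open>c\<close> along a relation supported within
  \<open>supp c\<close>, in a direction that does not increase the norm, until a coordinate
  vanishes. The support shrinks each time.\<close>

lemma eliminate:
  assumes "supp c \<subseteq> E"
  obtains c' where "c' - c \<in> K" "free K (supp c')" "(\<Sum>e\<in>E. \<bar>c' e\<bar>) \<le> (\<Sum>e\<in>E. \<bar>c e\<bar>)"
  using assms
proof (induction "card (supp c)" arbitrary: c thesis rule: less_induct)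
  case less
  show ?case
  proof (cases "free K (supp c)")
    case True
    then show ?thesis using less.prems(1)[of c] zero_mem by simp
  next
    case False
    then obtain y0 where y0: "y0 \<in> K" "supp y0 \<subseteq> supp c" "y0 \<noteq> 0" by (auto simp: free_def)
    \<comment> \<open>The sum is the derivative of the norm of \<open>c\<close> in the direction
      \<open>y0\<close>; the sign is chosen so that the norm does not grow.\<close>
    define y where "y = (if (\<Sum>e\<in>E. sgn (c e) * y0 e) \<le> 0 then y0 else - y0)"
    have y: "y \<in> K" "supp y \<subseteq> supp c" "y \<noteq> 0" "(\<Sum>e\<in>E. sgn (c e) * y e) \<le> 0"
    proof -
      have "- y0 \<in> K" "supp (- y0) = supp y0" using y0(1) subspace_neg[OF subspace] by (auto simp: supp_def)
      then show "y \<in> K" "supp y \<subseteq> supp c" "y \<noteq> 0" using y0 by (simp_all add: y_def)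
      show "(\<Sum>e\<in>E. sgn (c e) * y e) \<le> 0" by (simp add: y_def sum_negf)
    qed
    define N where "N = {e\<in>E. sgn (c e) * y e < 0}"
    have "N \<noteq> {}"
    proof
      assume "N = {}"
      then have nn: "\<forall>e\<in>E. 0 \<le> sgn (c e) * y e" unfolding N_def by force
      then have "0 \<le> (\<Sum>e\<in>E. sgn (c e) * y e)" by (intro sum_nonneg) simp
      with y(4) have "(\<Sum>e\<in>E. sgn (c e) * y e) = 0" by linarith
      with nn have zero: "\<forall>e\<in>E. sgn (c e) * y e = 0"
        using sum_nonneg_eq_0_iff[OF finite_E, of "\<lambda>e. sgn (c e) * y e"] by simp
      obtain e where "y e \<noteq> 0" using y(3) by (auto simp: fun_eq_iff)
      then have "e \<in> supp y" by (simp add: supp_def)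
      then have "e \<in> E" "c e \<noteq> 0" using supp_mem[OF y(1)] y(2) by (auto simp: supp_def)
      with bspec[OF zero \<open>e \<in> E\<close>] \<open>y e \<noteq> 0\<close> show False by (simp add: sgn_eq_0_iff)
    qed
    have finN: "finite N" using finite_E by (simp add: N_def)
    \<comment> \<open>\<open>N\<close> holds the coordinates that move towards 0, and
      \<open>t\<close> is the first time at which one of them arrives. Until then no coordinate
      changes sign, so the norm is affine in \<open>t\<close>.\<close>
    define t where "t = Min ((\<lambda>e. \<bar>c e\<bar> / \<bar>y e\<bar>) ` N)"
    have "t \<in> (\<lambda>e. \<bar>c e\<bar> / \<bar>y e\<bar>) ` N" unfolding t_def using \<open>N \<noteq> {}\<close> finN by (intro Min_in) auto
    then obtain e1 where e1: "e1 \<in> N" "t = \<bar>c e1\<bar> / \<bar>y e1\<bar>" by auto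
    have t_le: "t \<le> \<bar>c e\<bar> / \<bar>y e\<bar>" if "e \<in> N" for e
      unfolding t_def using that finN by (intro Min_le) auto
    have t0: "t \<ge> 0" using e1 by simp
    have abs_eq: "\<bar>c e + t * y e\<bar> = \<bar>c e\<bar> + t * (sgn (c e) * y e)" if "e \<in> E" for e
    proof (rule abs_add_scaled[OF t0])
      show "y e \<noteq> 0 \<Longrightarrow> c e \<noteq> 0" using y(2) by (auto simp: supp_def)
      assume neg: "sgn (c e) * y e < 0"
      then have "e \<in> N" "y e \<noteq> 0" using that by (auto simp: N_def)
      with t_le[of e] show "t * \<bar>y e\<bar> \<le> \<bar>c e\<bar>" by (simp add: field_simps)
    qed
    define c2 where "c2 = c + t *\<^sub>R y"
    have "y e1 \<noteq> 0" "e1 \<in> E" "sgn (c e1) * y e1 < 0" using e1(1) by (auto simp: N_def)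
    moreover from this(3) have "sgn (c e1) * y e1 = - \<bar>y e1\<bar>"
      by (cases "c e1 > 0"; cases "c e1 = 0") simp_all
    ultimately have "t * (sgn (c e1) * y e1) = - \<bar>c e1\<bar>"
      unfolding e1(2) by simp
    then have "c2 e1 = 0" using abs_eq[of e1] e1(1) by (simp add: c2_def N_def)
    moreover have "c e1 \<noteq> 0" using e1(1) by (auto simp: N_def)
    moreover have "supp c2 \<subseteq> supp c" using y(2) by (auto simp: c2_def supp_def)
    ultimately have "e1 \<in> supp c" "e1 \<notin> supp c2" "supp c2 \<subseteq> supp c" by (simp_all add: supp_def)
    then have "supp c2 \<subset> supp c" by blast
    moreover have "finite (supp c)" using less.prems(2) finite_E by (rule finite_subset)
    ultimately have "card (supp c2) < card (supp c)" by (intro psubset_card_mono)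
    moreover have "supp c2 \<subseteq> E" using \<open>supp c2 \<subseteq> supp c\<close> less.prems(2) by auto
    ultimately obtain c' where c': "c' - c2 \<in> K" "free K (supp c')"
      "(\<Sum>e\<in>E. \<bar>c' e\<bar>) \<le> (\<Sum>e\<in>E. \<bar>c2 e\<bar>)"
      using less.hyps[of c2] by blast
    have "(\<Sum>e\<in>E. \<bar>c2 e\<bar>) = (\<Sum>e\<in>E. \<bar>c e\<bar>) + t * (\<Sum>e\<in>E. sgn (c e) * y e)"
      by (simp add: c2_def abs_eq sum.distrib sum_distrib_left)
    also have "\<dots> \<le> (\<Sum>e\<in>E. \<bar>c e\<bar>)" using t0 y(4) by (simp add: mult_nonneg_nonpos)
    finally have "(\<Sum>e\<in>E. \<bar>c2 e\<bar>) \<le> (\<Sum>e\<in>E. \<bar>c e\<bar>)" .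
    moreover have "c' - c \<in> K"
      using add_mem[OF c'(1) scale_mem[OF y(1), of t]] by (simp add: c2_def algebra_simps)
    ultimately show ?thesis
      using c' by (intro less.prems(1)[of c']) simp_all
  qed
qed

end

locale unimodular_space = relation_space +
  assumes unimodular: "unimodular K"
begin

text \<open>The signed vector that unimodularity provides inside the fundamental circuit is a
  multiple of \<open>fund B e\<close>, with factor 1 or -1 because of the normalization at
  \<open>e\<close>.\<close>

lemma fund_range:
  assumes "basis B" "e \<in> E - B"
  shows "fund B e g \<in> {-1, 0, 1}"
proof -
  note f = fund[OF assms]
  have "fund B e \<noteq> 0" by (rule fund_nonzero[OF assms])
  then obtain y where y: "y \<in> K" "y \<noteq> 0" "supp y \<subseteq> supp (fund B e)" "range y \<subseteq> {-1, 0, 1}"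
    using unimodular f(1) by (auto simp: unimodular_def)
  have *: "y = y e *\<^sub>R fund B e" using y f by (intro fund_unique assms) auto
  then have "y e \<noteq> 0" using y(2) scaleR_zero_left by metis
  then have ye: "y e = 1 \<or> y e = -1" using y(4) by (auto simp: image_subset_iff)
  have "y g = y e * fund B e g" by (subst *) simp
  moreover have "y g \<in> {-1, 0, 1}" using y(4) by auto
  ultimately show ?thesis using ye by auto
qed

definition ifund :: "'a set \<Rightarrow> 'a \<Rightarrow> 'a \<Rightarrow> int"
  where "ifund B e g = \<lfloor>fund B e g\<rfloor>"

lemma of_int_ifund:
  assumes "basis B" "e \<in> E - B"
  shows "real_of_int (ifund B e g) = fund B e g" "\<bar>ifund B e g\<bar> = (if g \<in> supp (fund B e) then 1 else 0)"
proof -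
  have "fund B e g \<in> real_of_int ` {-1, 0, 1}" using fund_range[OF assms, of g] by simp
  then obtain k where k: "fund B e g = real_of_int k" "k \<in> {-1, 0, 1}" by blast
  then have "ifund B e g = k" by (simp add: ifund_def)
  with k show "real_of_int (ifund B e g) = fund B e g"
    "\<bar>ifund B e g\<bar> = (if g \<in> supp (fund B e) then 1 else 0)"
    by (auto simp: supp_def)
qed

lemma int_lattice: "int_lattice E (int_relations K)"
proof (standard, unfold lattice_in_def, intro conjI ballI)
  show "0 \<in> int_relations K" using zero_mem by (simp add: int_relations_def zero_fun_def)
  show "supp a \<subseteq> E" if "a \<in> int_relations K" for a
    using that supp_mem[of "\<lambda>e. real_of_int (a e)"] by (auto simp: int_relations_def supp_def)
  show "a - b \<in> int_relations K" if "a \<in> int_relations K" "b \<in> int_relations K" for a b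
    using that diff_mem[of "\<lambda>e. real_of_int (a e)" "\<lambda>e. real_of_int (b e)"]
    by (simp add: int_relations_def fun_diff_def)
qed (rule finite_E)

text \<open>Elimination ends at a vector with free support, which unimodularity forces to be integral.\<close>

lemma integral_reduction:
  assumes c: "supp c \<subseteq> E" and d: "supp d \<subseteq> E" and cd: "(\<lambda>e. real_of_int (d e)) - c \<in> K"
  obtains d' where "d' - d \<in> int_relations K" "real (l1_norm d') \<le> (\<Sum>e\<in>E. \<bar>c e\<bar>)"
proof -
  obtain c' where c': "c' - c \<in> K" "free K (supp c')" "(\<Sum>e\<in>E. \<bar>c' e\<bar>) \<le> (\<Sum>e\<in>E. \<bar>c e\<bar>)"
    using eliminate[OF c] .
  have "supp c' \<subseteq> E" using supp_add[of "c' - c" c] supp_mem[OF c'(1)] c by auto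
  then obtain B where B: "basis B" "supp c' \<subseteq> B" using ex_basis[OF c'(2)] by blast
  \<comment> \<open>This is the integral relation that agrees with \<open>d\<close> off
    \<open>B\<close>. Then \<open>d - k\<close> and \<open>c'\<close> both live on the free set
    \<open>B\<close> and differ by a relation, hence they coincide.\<close>
  define k where "k = (\<Sum>e\<in>E - B. (\<lambda>g. d e * ifund B e g))"
  define d' where "d' = d - k"
  have "(\<lambda>g. real_of_int (k g)) = (\<Sum>e\<in>E - B. real_of_int (d e) *\<^sub>R fund B e)"
    using of_int_ifund(1)[OF B(1)] by (auto simp: k_def sum_fun_apply fun_eq_iff intro!: sum.cong)
  also have "\<dots> \<in> K" using fund[OF B(1)] by (intro sum_mem scale_mem) auto
  finally have kK: "(\<lambda>g. real_of_int (k g)) \<in> K" .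
  have kd: "k g = d g" if "g \<notin> B" for g
  proof -
    have "k g = (\<Sum>e\<in>E - B. if e = g then d e else 0)"
      unfolding k_def sum_fun_apply
      using fund_off[OF B(1) _ that] by (intro sum.cong) (auto simp: ifund_def)
    also have "\<dots> = d g" using finite_E that d by (auto simp: supp_def)
    finally show ?thesis .
  qed
  have "(\<lambda>e. real_of_int (d e)) - (\<lambda>g. real_of_int (k g)) - c' = 0"
  proof -
    have "((\<lambda>e. real_of_int (d e)) - c) - (\<lambda>g. real_of_int (k g)) - (c' - c) \<in> K"
      by (intro diff_mem cd kK c')
    then have "(\<lambda>e. real_of_int (d e)) - (\<lambda>g. real_of_int (k g)) - c' \<in> K" by (simp add: algebra_simps)
    moreover have "supp ((\<lambda>e. real_of_int (d e)) - (\<lambda>g. real_of_int (k g)) - c') \<subseteq> B"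
      using kd B(2) by (auto simp: supp_def)
    ultimately show ?thesis using B(1) by (auto simp: basis_def free_def)
  qed
  then have dc: "real_of_int (d' e) = c' e" for e by (auto simp: fun_eq_iff d'_def)
  show thesis
  proof (rule that)
    show "d' - d \<in> int_relations K"
      using scale_mem[OF kK, of "-1"] by (simp add: int_relations_def d'_def scaleR_fun_def)
    have "supp d' = supp c'" unfolding supp_def dc[symmetric] by simp
    with \<open>supp c' \<subseteq> E\<close> have "supp d' \<subseteq> E" by simp
    then have "real (l1_norm d') = (\<Sum>e\<in>E. \<bar>c' e\<bar>)"
      by (simp add: l1_norm_eq[OF finite_E] of_nat_nat flip: dc)
    then show "real (l1_norm d') \<le> (\<Sum>e\<in>E. \<bar>c e\<bar>)" using c' by simp
  qed
qed

sublocale int: int_lattice E "int_relations K" by (rule int_lattice)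

text \<open>The midpoint of shortest vectors for the two neighbours differs from \<open>c\<close> by
  a real relation, and its norm is at most the average. \<open>integral_reduction\<close> replaces
  it by an integral vector in the coset of \<open>c\<close> that is no longer.\<close>

lemma wt_convex:
  assumes "supp c \<subseteq> E" "p \<in> E"
  shows "2 * wt (int_relations K) c
    \<le> wt (int_relations K) (c - unit_at p 1) + wt (int_relations K) (c + unit_at p 1)"
proof -
  let ?W = "wt (int_relations K)"
  obtain a where a: "a - (c - unit_at p 1) \<in> int_relations K" "l1_norm a = ?W (c - unit_at p 1)"
    by (rule int.wt_attained)
  obtain b where b: "b - (c + unit_at p 1) \<in> int_relations K" "l1_norm b = ?W (c + unit_at p 1)"
    by (rule int.wt_attained)
  have "supp (c - unit_at p 1) \<subseteq> E" "supp (c + unit_at p 1) \<subseteq> E"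
    using supp_diff[of c "unit_at p 1"] supp_add[of c "unit_at p 1"] supp_unit_at[of p "1::int"] assms by auto
  then have s: "supp a \<subseteq> E" "supp b \<subseteq> E" using int.supp_coset a(1) b(1) by auto
  define m where "m = (\<lambda>e. (real_of_int (a e) + real_of_int (b e)) / 2)"
  have "supp m \<subseteq> E" using s unfolding m_def supp_def by force
  moreover have "(\<lambda>e. real_of_int (c e)) - m \<in> K"
  proof -
    have "(-1/2) *\<^sub>R ((\<lambda>e. real_of_int ((a - (c - unit_at p 1)) e)) + (\<lambda>e. real_of_int ((b - (c + unit_at p 1)) e))) \<in> K"
      using a(1) b(1) unfolding int_relations_def by (intro scale_mem add_mem) auto
    also have "(-1/2) *\<^sub>R ((\<lambda>e. real_of_int ((a - (c - unit_at p 1)) e)) + (\<lambda>e. real_of_int ((b - (c + unit_at p 1)) e)))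
      = (\<lambda>e. real_of_int (c e)) - m"
      by (auto simp: fun_eq_iff m_def field_simps)
    finally show ?thesis .
  qed
  ultimately obtain d where d: "d - c \<in> int_relations K" "real (l1_norm d) \<le> (\<Sum>e\<in>E. \<bar>m e\<bar>)"
    using integral_reduction[of m c] assms(1) by blast
  have "real (2 * ?W c) \<le> 2 * real (l1_norm d)" using int.wt_le[OF d(1)] by simp
  also have "\<dots> \<le> (\<Sum>e\<in>E. 2 * \<bar>m e\<bar>)" using d(2) by (simp flip: sum_distrib_left)
  also have "\<dots> \<le> (\<Sum>e\<in>E. \<bar>real_of_int (a e)\<bar> + \<bar>real_of_int (b e)\<bar>)"
    by (intro sum_mono) (simp add: m_def)
  also have "\<dots> = real (l1_norm a + l1_norm b)"
    using s by (simp add: l1_norm_eq[OF finite_E] sum.distrib)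
  finally show ?thesis using a(2) b(2) by linarith
qed

text \<open>An integral relation is an integral combination of fundamental ones, and the coordinate
  sum of a fundamental relation has the parity of the size of its circuit.\<close>

lemma even_sum_int_relation:
  assumes bip: "bipartite_matroid (relation_matroid E K)" and c: "c \<in> int_relations K"
  shows "even (\<Sum>e\<in>E. c e)"
proof -
  obtain B where B: "basis B" using ex_basis[OF free_empty] by blast
  have ev: "even (\<Sum>g\<in>E. ifund B e g)" if "e \<in> E - B" for e
  proof -
    have "even (card (supp (fund B e)))"
      using supp_fund_circuit[OF B that] bip by (auto simp: bipartite_matroid_def)
    moreover have "E \<inter> supp (fund B e) = supp (fund B e)"
      using supp_mem[OF fund(1)[OF B that]] by auto
    then have "(\<Sum>g\<in>E. \<bar>ifund B e g\<bar>) = int (card (supp (fund B e)))"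
      by (simp add: of_int_ifund(2)[OF B that] sum.If_cases finite_E)
    ultimately show ?thesis using even_sum_abs[of "ifund B e" E] by simp
  qed
  have exp: "(\<lambda>e. real_of_int (c e)) = (\<Sum>e\<in>E - B. real_of_int (c e) *\<^sub>R fund B e)"
    using c unfolding int_relations_def by (intro fund_expansion[OF B]) simp
  have cg: "c g = (\<Sum>e\<in>E - B. c e * ifund B e g)" for g
  proof -
    have "real_of_int (c g) = (\<Sum>e\<in>E - B. real_of_int (c e) *\<^sub>R fund B e) g"
      by (rule fun_cong[OF exp])
    also have "\<dots> = real_of_int (\<Sum>e\<in>E - B. c e * ifund B e g)"
      unfolding sum_fun_apply of_int_sum using of_int_ifund(1)[OF B] by (intro sum.cong) auto
    finally show ?thesis unfolding of_int_eq_iff .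
  qed
  have "(\<Sum>g\<in>E. c g) = (\<Sum>g\<in>E. \<Sum>e\<in>E - B. c e * ifund B e g)"
    by (intro sum.cong refl) (rule cg)
  also have "\<dots> = (\<Sum>e\<in>E - B. c e * (\<Sum>g\<in>E. ifund B e g))"
    by (subst sum.swap) (simp add: sum_distrib_left)
  also have "even \<dots>" using ev by (intro dvd_sum) auto
  finally show ?thesis .
qed

text \<open>A norm is congruent to the coordinate sum modulo 2, and this sum is constant modulo 2 on
  each coset.\<close>

lemma wt_parity:
  assumes bip: "bipartite_matroid (relation_matroid E K)" and c: "supp c \<subseteq> E"
  shows "even (wt (int_relations K) c) \<longleftrightarrow> even (\<Sum>e\<in>E. c e)"
proof -
  obtain d where d: "d - c \<in> int_relations K" "l1_norm d = wt (int_relations K) c"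
    by (rule int.wt_attained)
  have "even (\<Sum>e\<in>E. (d - c) e)" by (rule even_sum_int_relation[OF bip d(1)])
  then have "even (\<Sum>e\<in>E. d e) \<longleftrightarrow> even (\<Sum>e\<in>E. c e)" by (simp add: sum_subtractf)
  then show ?thesis
    using d(2) l1_norm_eq[OF finite_E int.supp_coset[OF d(1) c]] even_sum_nat_abs[of d E] by simp
qed

lemma wt_V_shaped:
  assumes bip: "bipartite_matroid (relation_matroid E K)" and p: "p \<in> E" and c: "supp c \<subseteq> E"
    and min: "\<And>j. wt (int_relations K) c \<le> wt (int_relations K) (c + unit_at p j)"
  shows "wt (int_relations K) (c + unit_at p k) = wt (int_relations K) c + nat \<bar>k\<bar>"
proof -
  define g where "g = (\<lambda>j. wt (int_relations K) (c + unit_at p j))"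
  have s: "supp (c + unit_at p j) \<subseteq> E" for j
    using supp_add[of c "unit_at p j"] supp_unit_at[of p j] c p by auto
  have "g k = g 0 + nat \<bar>k\<bar>"
  proof (rule V_shape)
    show "g 0 \<le> g j" for j using min by (simp add: g_def)
    show "2 * g j \<le> g (j - 1) + g (j + 1)" for j
      using wt_convex[OF s p, of j] by (simp add: g_def unit_at_add unit_at_diff add.assoc add_diff_eq)
    have sum: "(\<Sum>e\<in>E. (c + unit_at p j) e) = (\<Sum>e\<in>E. c e) + j" for j
      using p finite_E by (simp add: sum.distrib unit_at_def)
    show "even (g (j + 1)) \<longleftrightarrow> odd (g j)" for j
      unfolding g_def wt_parity[OF bip s] sum by simp
    show "g (j + 1) \<le> g j + 1" for j
      using int.wt_add_unit[OF s, of j p 1] by (simp add: g_def unit_at_add add.assoc)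
    show "g (j - 1) \<le> g j + 1" for j
      using int.wt_add_unit[OF s, of j p "-1"] unit_at_add[of p j "-1"] by (simp add: g_def add.assoc)
  qed
  then show ?thesis by (simp add: g_def)
qed

end


subsection \<open>Uniqueness of unimodular representations\<close>

lemma card_image_eq_fibres:
  assumes "\<And>x y. x \<in> S \<Longrightarrow> y \<in> S \<Longrightarrow> f x = f y \<longleftrightarrow> g x = g y"
  shows "card (f ` S) = card (g ` S)"
proof -
  define h where "h = (\<lambda>z. g (inv_into S f z))"
  have h: "h (f x) = g x" if "x \<in> S" for x
    using that assms[of "inv_into S f (f x)" x] by (simp add: h_def inv_into_into f_inv_into_f)
  have "inj_on h (f ` S)"
    by (rule inj_onI) (use h assms in auto)
  moreover have "h ` f ` S = g ` S" using h by (auto simp: image_iff)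
  ultimately show ?thesis by (metis card_image)
qed

lemma sign_cases: "x \<in> {-1, 0, 1} \<Longrightarrow> x \<noteq> 0 \<Longrightarrow> x = 1 \<or> x = (-1 :: real)"
  by auto

context relation_space
begin

text \<open>Basis exchange reads the zero pattern of the fundamental relations off the free sets
  alone. Two representations of one matroid can therefore differ only in the nonzero values.\<close>

lemma fund_nonzero_iff:
  assumes "basis B" "e \<in> E - B" "b \<in> B"
  shows "fund B e b \<noteq> 0 \<longleftrightarrow> free K (insert e B - {b})"
proof
  assume nz: "fund B e b \<noteq> 0"
  show "free K (insert e B - {b})"
    unfolding free_def
  proof (intro ballI impI)
    fix x assume x: "x \<in> K" "supp x \<subseteq> insert e B - {b}"
    have *: "x = x e *\<^sub>R fund B e" using x by (intro fund_unique assms) auto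
    have "x b = 0" using x(2) by (auto simp: supp_def)
    then have "x e = 0" using fun_cong[OF *, of b] nz by auto
    then show "x = 0" using * by (metis scaleR_zero_left)
  qed
next
  assume "free K (insert e B - {b})"
  then have "\<not> supp (fund B e) \<subseteq> insert e B - {b}"
    using fund(1)[OF assms(1,2)] fund_nonzero[OF assms(1,2)] by (auto simp: free_def)
  then show "fund B e b \<noteq> 0" using fund(3)[OF assms(1,2)] by (auto simp: supp_def)
qed

end

context unimodular_space
begin

lemma fund_sign:
  assumes "basis B" "e \<in> E - B" "fund B e b \<noteq> 0"
  shows "fund B e b = 1 \<or> fund B e b = -1"
  using fund_range[OF assms(1,2)] assms(3) by (rule sign_cases)

text \<open>
  The columns \<open>e 0, \<dots>, e (k - 1), f\<close> and the rows \<open>b 0, \<dots>, b k\<close> form the incidence matrix of a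
  chordless cycle.  Its determinant is $0$ or $\pm 2$, so unimodularity fixes the product of its
  nonzero entries.
\<close>

lemma chordless_cycle:
  fixes b e :: "nat \<Rightarrow> 'a"
  assumes B: "basis B" and k: "k > 0"
    and b: "\<And>j. j \<le> k \<Longrightarrow> b j \<in> B" and e: "\<And>i. i < k \<Longrightarrow> e i \<in> E - B"
    and f: "f \<in> E - B" and ef: "\<And>i. i < k \<Longrightarrow> e i \<noteq> f"
    and nz: "\<And>i. i < k \<Longrightarrow> fund B (e i) (b i) \<noteq> 0" "\<And>i. i < k \<Longrightarrow> fund B (e i) (b (Suc i)) \<noteq> 0"
    and chordless: "\<And>i j. i < k \<Longrightarrow> j \<le> k \<Longrightarrow> j \<noteq> i \<Longrightarrow> j \<noteq> Suc i \<Longrightarrow> fund B (e i) (b j) = 0"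
    and f_nz: "fund B f (b 0) \<noteq> 0" "fund B f (b k) \<noteq> 0"
    and f_zero: "\<And>j. 0 < j \<Longrightarrow> j < k \<Longrightarrow> fund B f (b j) = 0"
  shows "(\<Prod>i<k. fund B (e i) (b i) * fund B (e i) (b (Suc i))) * (fund B f (b 0) * fund B f (b k))
    = - ((-1) ^ k)"
proof -
  define D where "D = (\<lambda>g b. fund B g b)"
  \<comment> \<open>The signs are chosen recursively so that the combination \<open>u\<close> of the
    columns \<open>e i\<close> cancels in the inner rows \<open>b 1, ..., b (k - 1)\<close>.\<close>
  define \<sigma> where "\<sigma> = (\<lambda>i. (-1) ^ i * (\<Prod>j<i. D (e j) (b (Suc j)) * D (e (Suc j)) (b (Suc j))))"
  have sgn: "D (e i) (b i) = 1 \<or> D (e i) (b i) = -1"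
    "D (e i) (b (Suc i)) = 1 \<or> D (e i) (b (Suc i)) = -1" if "i < k" for i
    using fund_sign[OF B e nz(1)] fund_sign[OF B e nz(2)] that by (auto simp: D_def)
  have sgnf: "D f (b 0) = 1 \<or> D f (b 0) = -1" "D f (b k) = 1 \<or> D f (b k) = -1"
    using fund_sign[OF B f] f_nz by (auto simp: D_def)
  have \<sigma>0: "\<sigma> 0 = 1" by (simp add: \<sigma>_def)
  have \<sigma>Suc: "\<sigma> (Suc i) = - (\<sigma> i * D (e i) (b (Suc i)) * D (e (Suc i)) (b (Suc i)))" for i
    by (simp add: \<sigma>_def)
  have \<sigma>_sgn: "i < k \<Longrightarrow> \<sigma> i = 1 \<or> \<sigma> i = -1" for i
  proof (induction i)
    case (Suc i)
    then show ?case using sgn(2)[of i] sgn(1)[of "Suc i"] by (auto simp: \<sigma>Suc)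
  qed (simp add: \<sigma>0)
  define u where "u = (\<Sum>i<k. \<sigma> i *\<^sub>R fund B (e i))"
  have uK: "u \<in> K" unfolding u_def using fund(1)[OF B] e by (intro sum_mem scale_mem) auto
  have u: "u g = (\<Sum>i<k. \<sigma> i * D (e i) g)" for g by (simp add: u_def sum_fun_apply D_def)
  have u_0: "u (b 0) = D (e 0) (b 0)"
  proof -
    have "u (b 0) = (\<Sum>i\<in>{0}. \<sigma> i * D (e i) (b 0))"
      unfolding u using k chordless by (intro sum.mono_neutral_right) (auto simp: D_def)
    then show ?thesis by (simp add: \<sigma>0)
  qed
  obtain n where n: "k = Suc n" using k by (cases k) auto
  have u_k: "u (b k) = \<sigma> n * D (e n) (b k)"
  proof -
    have "u (b k) = (\<Sum>i\<in>{n}. \<sigma> i * D (e i) (b k))"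
      unfolding u using n chordless by (intro sum.mono_neutral_right) (auto simp: D_def)
    then show ?thesis by simp
  qed
  have u_mid: "u (b (Suc j)) = 0" if "Suc j < k" for j
  proof -
    have "u (b (Suc j)) = (\<Sum>i\<in>{j, Suc j}. \<sigma> i * D (e i) (b (Suc j)))"
      unfolding u using that chordless by (intro sum.mono_neutral_right) (auto simp: D_def)
    also have "\<dots> = 0" using sgn(1)[OF that] by (auto simp: \<sigma>Suc)
    finally show ?thesis .
  qed
  have u_off: "u g = 0" if "g \<notin> B" "g \<notin> e ` {..<k}" for g
    unfolding u using that e fund_off[OF B] by (intro sum.neutral) (auto simp: D_def)
  \<comment> \<open>Subtracting \<open>a\<close> times column \<open>f\<close> also clears row
    \<open>b 0\<close>. What remains at \<open>b k\<close> is a sum of two signs, so it is 0 or has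
    absolute value 2.\<close>
  define a where "a = u (b 0) * D f (b 0)"
  define w where "w = u - a *\<^sub>R fund B f"
  have wK: "w \<in> K" unfolding w_def by (intro diff_mem uK scale_mem fund(1)[OF B f])
  have w: "w g = u g - a * D f g" for g by (simp add: w_def D_def)
  have a: "a = 1 \<or> a = -1" using sgn(1)[OF k] sgnf(1) by (auto simp: a_def u_0)
  have w_f: "w f = - a"
    using u_off[of f] ef f fund(2)[OF B f] by (auto simp: w D_def)
  have w_b: "w (b j) = 0" if "j < k" for j
  proof (cases j)
    case 0
    then show ?thesis using sgnf(1) by (auto simp: w a_def)
  next
    case (Suc i)
    then show ?thesis using that u_mid[of i] f_zero[of j] by (simp add: w D_def)
  qed
  have w_off: "w g = 0" if "g \<notin> B" "g \<notin> e ` {..<k}" "g \<noteq> f" for g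
    using that u_off[of g] fund(3)[OF B f] by (auto simp: w D_def supp_def)
  have "w (b k) = 0"
  proof (rule ccontr)
    assume wk: "w (b k) \<noteq> 0"
    have "u (b k) = 1 \<or> u (b k) = -1" unfolding u_k using \<sigma>_sgn[of n] sgn(2)[of n] n by auto
    then have wk2: "\<bar>w (b k)\<bar> = 2" using wk a sgnf(2) by (auto simp: w)
    then have "w \<noteq> 0" by auto
    then obtain y where y: "y \<in> K" "y \<noteq> 0" "supp y \<subseteq> supp w" "range y \<subseteq> {-1, 0, 1}"
      using unimodular wK by (auto simp: unimodular_def)
    \<comment> \<open>The aim is \<open>v = 0\<close>, which makes \<open>y\<close> a multiple of
      \<open>w\<close>. This is absurd, because \<open>w\<close> has absolute value 1 at
      \<open>f\<close> and 2 at \<open>b k\<close>, while the entries of \<open>y\<close> are 0 or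
      signs.\<close>
    define v where "v = y - (y f / w f) *\<^sub>R w"
    have vK: "v \<in> K" unfolding v_def by (intro diff_mem scale_mem y wK)
    have v: "v g = y g - (y f / w f) * w g" for g by (simp add: v_def)
    have yz: "w g = 0 \<Longrightarrow> y g = 0" for g using y(3) by (auto simp: supp_def)
    have vz: "w g = 0 \<Longrightarrow> v g = 0" for g using yz by (simp add: v)
    have vf: "v f = 0" using w_f a by (auto simp: v)
    \<comment> \<open>Row \<open>b i\<close> meets only \<open>e i\<close>, its predecessor and
      possibly \<open>f\<close> among the relevant columns. The coefficients of the latter two
      already vanish, and so does the row, hence the coefficient of \<open>e i\<close> vanishes
      too.\<close>
    have v_e: "i < k \<Longrightarrow> v (e i) = 0" for i
    proof (induction i rule: less_induct)
      case (less i)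
      have "0 = v (b i)" using vz w_b less.prems by simp
      also have "\<dots> = (\<Sum>g\<in>E - B. v g * D g (b i))"
        using fun_cong[OF fund_expansion[OF B vK], of "b i"] by (simp add: sum_fun_apply D_def)
      also have "\<dots> = (\<Sum>g\<in>{e i}. v g * D g (b i))"
      proof (intro sum.mono_neutral_right ballI)
        fix g assume g: "g \<in> E - B - {e i}"
        show "v g * D g (b i) = 0"
        proof (cases "g = f \<or> w g = 0")
          case True then show ?thesis using vf vz by auto
        next
          case False
          then obtain j where j: "j < k" "g = e j" using w_off[of g] g by auto
          with g have "j \<noteq> i" by auto
          then consider "j < i" | "i \<noteq> Suc j" "j > i" by linarith
          then show ?thesis
          proof cases
            case 1 then show ?thesis using less.IH j by auto
          next
            case 2 then show ?thesis
              using chordless[of j i] j less.prems by (auto simp: D_def)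
          qed
        qed
      qed (use e less.prems finite_E in auto)
      finally show ?case using sgn(1)[OF less.prems] by auto
    qed
    have "v = 0"
    proof (rule eq_off_free[OF _ vK zero_mem])
      show "free K B" using B by (simp add: basis_def)
      show "v g = 0 g" if "g \<notin> B" for g
        using that vz vf v_e w_off[of g] by (cases "g = f \<or> g \<in> e ` {..<k}") auto
    qed
    then have yw: "y g = (y f / w f) * w g" for g using v[of g] by simp
    have "y f \<noteq> 0"
    proof
      assume "y f = 0"
      then have "y g = 0" for g using yw[of g] by simp
      then show False using y(2) by (auto simp: fun_eq_iff)
    qed
    moreover have "y g = -1 \<or> y g = 0 \<or> y g = 1" for g using y(4) by (auto simp: image_subset_iff)
    ultimately have "\<bar>y f\<bar> = 1" "\<bar>y (b k)\<bar> \<le> 1"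
      by (metis abs_minus_cancel abs_one, metis abs_minus_cancel abs_one abs_zero order_refl zero_le_one)
    moreover have "\<bar>y (b k)\<bar> = \<bar>y f\<bar> / \<bar>w f\<bar> * \<bar>w (b k)\<bar>"
      by (subst yw) (simp add: abs_mult)
    moreover have "\<bar>w f\<bar> = 1" using w_f a by auto
    ultimately show False using wk2 by simp
  qed
  then have eq: "D (e 0) (b 0) * D f (b 0) * D f (b k) = \<sigma> n * D (e n) (b k)"
    by (simp add: w u_k a_def u_0)
  \<comment> \<open>The product in \<open>\<sigma>\<close> pairs entries in a common row; the two
    extra factors at the ends regroup it into pairs in a common column.\<close>
  have "\<sigma> i * D (e i) (b (Suc i)) * D (e 0) (b 0)
      = (-1) ^ i * (\<Prod>j<Suc i. D (e j) (b j) * D (e j) (b (Suc j)))" if "i < k" for i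
    using that
  proof (induction i)
    case (Suc i)
    have "\<sigma> (Suc i) * D (e (Suc i)) (b (Suc (Suc i))) * D (e 0) (b 0)
      = - (\<sigma> i * D (e i) (b (Suc i)) * D (e 0) (b 0))
        * (D (e (Suc i)) (b (Suc i)) * D (e (Suc i)) (b (Suc (Suc i))))"
      by (simp add: \<sigma>Suc)
    also have "\<sigma> i * D (e i) (b (Suc i)) * D (e 0) (b 0)
      = (-1) ^ i * (\<Prod>j<Suc i. D (e j) (b j) * D (e j) (b (Suc j)))"
      using Suc by simp
    finally show ?case by simp
  qed (simp add: \<sigma>0)
  from this[of n] have "\<sigma> n * D (e n) (b k) * D (e 0) (b 0)
      = (-1) ^ n * (\<Prod>j<k. D (e j) (b j) * D (e j) (b (Suc j)))" using n by simp
  then have "D f (b 0) * D f (b k) = (-1) ^ n * (\<Prod>j<k. D (e j) (b j) * D (e j) (b (Suc j)))"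
    using eq sgn(1)[OF k] by (auto simp: algebra_simps)
  then have "(-1) ^ n * (D f (b 0) * D f (b k)) = (\<Prod>j<k. D (e j) (b j) * D (e j) (b (Suc j)))"
    by (simp add: mult.assoc[symmetric] flip: power_mult_distrib)
  then have "(\<Prod>j<k. D (e j) (b j) * D (e j) (b (Suc j))) * (D f (b 0) * D f (b k))
    = (-1) ^ n * ((D f (b 0) * D f (b k)) * (D f (b 0) * D f (b k)))" by (simp add: mult.assoc)
  also have "\<dots> = (-1) ^ n" using sgnf by auto
  finally show ?thesis unfolding D_def n by simp
qed

end

lemma relpow_segment:
  assumes "\<And>i. i < k \<Longrightarrow> (q i, q (Suc i)) \<in> R" "i \<le> j" "j \<le> k"
  shows "(q i, q j) \<in> R ^^ (j - i)"
  unfolding relpow_fun_conv using assms by (intro exI[of _ "\<lambda>n. q (i + n)"]) auto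

section \<open>Two unimodular spaces with the same free sets\<close>

locale same_matroid =
  K: unimodular_space E K + K': unimodular_space E K' for E :: "'a set" and K K' +
  assumes same_free: "\<And>I. I \<subseteq> E \<Longrightarrow> free K I \<longleftrightarrow> free K' I"
begin

lemma basis_iff: "K.basis B \<longleftrightarrow> K'.basis B"
  using same_free by (auto simp: K.basis_def K'.basis_def)

text \<open>The numbers \<open>fund B e b\<close> form the reduced matrix of a representation, with
  columns \<open>e\<close> and rows \<open>b\<close>. \<open>F\<close> is the set of columns already
  matched by sign changes of rows and columns; it grows one column at a time.\<close>

definition signing :: "'a set \<Rightarrow> 'a set \<Rightarrow> ('a \<Rightarrow> real) \<Rightarrow> bool"
  where "signing B F s \<longleftrightarrow> (\<forall>e. s e = 1 \<or> s e = -1)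
    \<and> (\<forall>e\<in>F. \<forall>b\<in>B. K'.fund B e b = s e * s b * K.fund B e b)"

text \<open>Induction on the path length leaves only a path without shortcuts and without inner rows
  in column \<open>f\<close>. With \<open>f\<close> it closes to a chordless cycle in both matrices,
  and \<open>chordless_cycle\<close> gives the two products of entries the same value.\<close>

lemma signing_connected:
  assumes B: "K.basis B" and F: "F \<subseteq> E - B" and f: "f \<in> E - B" "f \<notin> F" and s: "signing B F s"
    and R: "R = {(a, b). a \<in> B \<and> b \<in> B \<and> (\<exists>e\<in>F. K.fund B e a \<noteq> 0 \<and> K.fund B e b \<noteq> 0)}"
    and ab: "a \<in> B" "b \<in> B" "K.fund B f a \<noteq> 0" "K.fund B f b \<noteq> 0" "(a, b) \<in> R ^^ k"
  shows "s a * K.fund B f a * K'.fund B f a = s b * K.fund B f b * K'.fund B f b"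
  using ab
proof (induction k arbitrary: a b rule: less_induct)
  case (less k)
  define D where "D = K.fund B"
  define D' where "D' = K'.fund B"
  define \<rho> where "\<rho> = (\<lambda>b. s b * D f b * D' f b)"
  have B': "K'.basis B" using B basis_iff by simp
  have D'_iff: "D' e c \<noteq> 0 \<longleftrightarrow> D e c \<noteq> 0" if "e \<in> E - B" "c \<in> B" for e c
  proof -
    have "insert e B - {c} \<subseteq> E" using that B by (auto simp: K.basis_def)
    then show ?thesis
      using that K.fund_nonzero_iff[OF B] K'.fund_nonzero_iff[OF B'] same_free by (simp add: D_def D'_def)
  qed
  show ?case
  proof (rule ccontr)
    assume "\<not> ?thesis"
    then have bad: "\<rho> a \<noteq> \<rho> b" by (simp add: \<rho>_def D_def D'_def)
    have IH: "\<rho> c = \<rho> d" if "m < k" "c \<in> B" "d \<in> B" "D f c \<noteq> 0" "D f d \<noteq> 0" "(c, d) \<in> R ^^ m" for c d m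
      using less.IH[of m c d] that by (simp add: \<rho>_def D_def D'_def)
    obtain q where q: "q 0 = a" "q k = b" "\<And>i. i < k \<Longrightarrow> (q i, q (Suc i)) \<in> R"
      using less.prems(5) unfolding relpow_fun_conv by blast
    have k: "k > 0" using q bad by (cases k) auto
    have "\<forall>i<k. \<exists>e\<in>F. D e (q i) \<noteq> 0 \<and> D e (q (Suc i)) \<noteq> 0"
      using q(3) by (auto simp: R D_def)
    then obtain e where e: "\<And>i. i < k \<Longrightarrow> e i \<in> F" "\<And>i. i < k \<Longrightarrow> D (e i) (q i) \<noteq> 0"
      "\<And>i. i < k \<Longrightarrow> D (e i) (q (Suc i)) \<noteq> 0" by metis
    have qB: "q j \<in> B" if "j \<le> k" for j
    proof (cases "j < k")
      case True then show ?thesis using q(3)[of j] by (auto simp: R)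
    next
      case False then show ?thesis using that less.prems q by auto
    qed
    have seg: "(q i, q j) \<in> R ^^ (j - i)" if "i \<le> j" "j \<le> k" for i j
      using q(3) that by (rule relpow_segment)
    \<comment> \<open>A chord would bypass part of the path, and the shorter path would already give
      equality at its ends by induction.\<close>
    have chordless: "D (e i) (q j) = 0" if ij: "i < k" "j \<le> k" "j \<noteq> i" "j \<noteq> Suc i" for i j
    proof (rule ccontr)
      assume nz: "D (e i) (q j) \<noteq> 0"
      have "\<exists>m<k. (a, b) \<in> R ^^ m"
      proof (cases "j > i")
        case True
        have "(q i, q j) \<in> R" using nz e(1,2)[OF ij(1)] qB ij by (auto simp: R D_def)
        moreover have "(q 0, q i) \<in> R ^^ (i - 0)" "(q j, q k) \<in> R ^^ (k - j)"
          by (rule seg; use ij in simp)+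
        ultimately have "(q 0, q k) \<in> (R ^^ (i - 0) O R) O R ^^ (k - j)" by blast
        moreover have "(R ^^ (i - 0) O R) O R ^^ (k - j) = R ^^ (Suc i + (k - j))"
          by (simp only: relpow_add relpow.simps(2) diff_zero)
        ultimately have "(a, b) \<in> R ^^ (Suc i + (k - j))" using q(1,2) by metis
        moreover have "Suc i + (k - j) < k" using True ij by simp
        ultimately show ?thesis by blast
      next
        case False
        have "(q j, q (Suc i)) \<in> R" using nz e(1,3)[OF ij(1)] qB ij by (auto simp: R D_def)
        moreover have "(q 0, q j) \<in> R ^^ (j - 0)" "(q (Suc i), q k) \<in> R ^^ (k - Suc i)"
          by (rule seg; use ij in simp)+
        ultimately have "(q 0, q k) \<in> (R ^^ (j - 0) O R) O R ^^ (k - Suc i)" by blast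
        moreover have "(R ^^ (j - 0) O R) O R ^^ (k - Suc i) = R ^^ (Suc j + (k - Suc i))"
          by (simp only: relpow_add relpow.simps(2) diff_zero)
        ultimately have "(a, b) \<in> R ^^ (Suc j + (k - Suc i))" using q(1,2) by metis
        moreover have "Suc j + (k - Suc i) < k" using False ij by simp
        ultimately show ?thesis by blast
      qed
      then show False using IH less.prems bad by (auto simp: D_def)
    qed
    \<comment> \<open>An inner row in which \<open>f\<close> is nonzero would split the path into
      two shorter ones, to each of which the induction hypothesis applies.\<close>
    have mid: "D f (q j) = 0" if "0 < j" "j < k" for j
    proof (rule ccontr)
      assume "D f (q j) \<noteq> 0"
      then have "\<rho> (q 0) = \<rho> (q j)" "\<rho> (q j) = \<rho> (q k)"
        using seg[of 0 j] seg[of j k] qB that less.prems q IH[of j "q 0" "q j"] IH[of "k - j" "q j" "q k"]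
        by (auto simp: D_def)
      with bad q show False by simp
    qed
    have eE: "e i \<in> E - B" "e i \<noteq> f" if "i < k" for i using e(1)[OF that] F f by auto
    have f_nz: "D f (q 0) \<noteq> 0" "D f (q k) \<noteq> 0" using less.prems q by (auto simp: D_def)
    have c1: "(\<Prod>i<k. D (e i) (q i) * D (e i) (q (Suc i))) * (D f (q 0) * D f (q k)) = - ((-1) ^ k)"
      unfolding D_def
      by (rule K.chordless_cycle[OF B k qB eE(1) f(1) eE(2)])
        (use e chordless f_nz mid in \<open>auto simp: D_def\<close>)
    have c2: "(\<Prod>i<k. D' (e i) (q i) * D' (e i) (q (Suc i))) * (D' f (q 0) * D' f (q k)) = - ((-1) ^ k)"
      unfolding D'_def
    proof (rule K'.chordless_cycle[OF B' k qB eE(1) f(1) eE(2)])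
      show "K'.fund B (e i) (q i) \<noteq> 0" "K'.fund B (e i) (q (Suc i)) \<noteq> 0" if "i < k" for i
        using e(2,3)[OF that] D'_iff[OF eE(1)[OF that] qB] that by (auto simp: D'_def)
      show "K'.fund B (e i) (q j) = 0" if "i < k" "j \<le> k" "j \<noteq> i" "j \<noteq> Suc i" for i j
        using chordless[OF that] D'_iff[OF eE(1) qB] that by (auto simp: D'_def)
      show "K'.fund B f (q 0) \<noteq> 0" "K'.fund B f (q k) \<noteq> 0"
        using f_nz D'_iff[OF f(1) qB] by (auto simp: D'_def)
      show "K'.fund B f (q j) = 0" if "0 < j" "j < k" for j
        using mid[OF that] D'_iff[OF f(1) qB] that by (auto simp: D'_def)
    qed auto
    have s1: "s c * s c = 1" for c
    proof -
      have "s c = 1 \<or> s c = -1" using s unfolding signing_def by blast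
      then show ?thesis by auto
    qed
    have D': "D' (e i) c = s (e i) * s c * D (e i) c" if "i < k" "c \<in> B" for i c
      using s e(1)[OF that(1)] that(2) by (auto simp: signing_def D_def D'_def)
    \<comment> \<open>Each column sign and each inner row sign occurs twice, so only the signs of
      the two end rows survive.\<close>
    have tele: "m \<le> k \<Longrightarrow> (\<Prod>i<m. D' (e i) (q i) * D' (e i) (q (Suc i)))
        = s (q 0) * s (q m) * (\<Prod>i<m. D (e i) (q i) * D (e i) (q (Suc i)))" for m
    proof (induction m)
      case 0 then show ?case by (simp add: s1)
    next
      case (Suc m)
      have "D' (e m) (q m) * D' (e m) (q (Suc m))
        = (s (e m) * s (e m)) * s (q m) * s (q (Suc m)) * (D (e m) (q m) * D (e m) (q (Suc m)))"
        using Suc.prems D'[of m] qB by simp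
      then have "(\<Prod>i<Suc m. D' (e i) (q i) * D' (e i) (q (Suc i)))
        = s (q 0) * (s (q m) * s (q m)) * s (q (Suc m)) * (\<Prod>i<m. D (e i) (q i) * D (e i) (q (Suc i)))
          * (D (e m) (q m) * D (e m) (q (Suc m)))"
        using Suc by (simp add: s1)
      then show ?case by (simp add: s1)
    qed
    define P where "P = (\<Prod>i<k. D (e i) (q i) * D (e i) (q (Suc i)))"
    have "P * (D f (q 0) * D f (q k)) = s (q 0) * s (q k) * P * (D' f (q 0) * D' f (q k))"
      using c1 c2 tele[of k] by (simp add: P_def)
    moreover have "P \<noteq> 0" using e by (auto simp: P_def)
    ultimately have eq: "D f (q 0) * D f (q k) = s (q 0) * s (q k) * (D' f (q 0) * D' f (q k))" by simp
    have sq: "D f c * D f c = 1" "D' f c * D' f c = 1" if "c \<in> B" "D f c \<noteq> 0" for c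
      using K.fund_sign[OF B f(1), of c] K'.fund_sign[OF B' f(1), of c] D'_iff[OF f(1)] that
      by (auto simp: D_def D'_def)
    have "\<rho> (q 0) = s (q 0) * D f (q 0) * D' f (q 0) * (D f (q k) * D f (q k))"
      using sq(1)[OF qB f_nz(2)] by (simp add: \<rho>_def)
    also have "\<dots> = (D f (q 0) * D f (q k)) * (s (q 0) * D' f (q 0) * D f (q k))" by simp
    also have "\<dots> = (s (q 0) * s (q 0)) * (D' f (q 0) * D' f (q 0)) * (s (q k) * D f (q k) * D' f (q k))"
      unfolding eq by simp
    also have "\<dots> = \<rho> (q k)" using sq(2)[OF qB f_nz(1)] by (simp add: s1 \<rho>_def)
    finally show False using bad q by simp
  qed
qed

text \<open>Flipping all rows of a component of \<open>R\<close> together with the columns of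
  \<open>F\<close> that meet it keeps the matching on \<open>F\<close>. Within a component the flip
  that column \<open>f\<close> demands is constant by \<open>signing_connected\<close>, so all
  demands can be met at once.\<close>

lemma signing_insert:
  assumes B: "K.basis B" and F: "F \<subseteq> E - B" and f: "f \<in> E - B" "f \<notin> F" and s: "signing B F s"
  obtains s' where "signing B (insert f F) s'"
proof -
  define D where "D = K.fund B"
  define D' where "D' = K'.fund B"
  \<comment> \<open>For a row in \<open>T\<close>, this is the factor by which its sign has to
    change if column \<open>f\<close> itself gets sign 1.\<close>
  define \<rho> where "\<rho> = (\<lambda>b. s b * D f b * D' f b)"
  define T where "T = {b\<in>B. D f b \<noteq> 0}"
  define R where "R = {(a, b). a \<in> B \<and> b \<in> B \<and> (\<exists>e\<in>F. D e a \<noteq> 0 \<and> D e b \<noteq> 0)}"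
  have B': "K'.basis B" using B basis_iff by simp
  have fD': "D' f c \<noteq> 0 \<longleftrightarrow> D f c \<noteq> 0" if "c \<in> B" for c
  proof -
    have "insert f B - {c} \<subseteq> E" using f B by (auto simp: K.basis_def)
    then show ?thesis
      using that f K.fund_nonzero_iff[OF B] K'.fund_nonzero_iff[OF B'] same_free by (simp add: D_def D'_def)
  qed
  have s1: "s c = 1 \<or> s c = -1" for c using s unfolding signing_def by blast
  have symR: "sym R" by (auto simp: sym_def R_def)
  have \<rho>_eq: "\<rho> a = \<rho> b" if "a \<in> T" "b \<in> T" "(a, b) \<in> R\<^sup>*" for a b
  proof -
    obtain k where "(a, b) \<in> R ^^ k" using \<open>(a, b) \<in> R\<^sup>*\<close> rtrancl_imp_relpow by blast
    then show ?thesis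
      using signing_connected[OF B F f s, of R a b k] that by (auto simp: \<rho>_def D_def D'_def R_def T_def)
  qed
  have \<rho>1: "\<rho> c = 1 \<or> \<rho> c = -1" if "c \<in> T" for c
    using K.fund_sign[OF B f(1), of c] K'.fund_sign[OF B' f(1), of c] fD'[of c] s1[of c] that
    by (auto simp: \<rho>_def T_def D_def D'_def)
  \<comment> \<open>The flip of the component of \<open>b\<close>, read off at any of its rows in
    \<open>T\<close>. Components that miss column \<open>f\<close> keep their signs, hence the
    default 1.\<close>
  define h where "h = (\<lambda>b. if \<exists>t\<in>T. (t, b) \<in> R\<^sup>* then \<rho> (SOME t. t \<in> T \<and> (t, b) \<in> R\<^sup>*) else 1)"
  have h_eq: "h b = \<rho> t" if "t \<in> T" "(t, b) \<in> R\<^sup>*" for t b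
  proof -
    define t' where "t' = (SOME t. t \<in> T \<and> (t, b) \<in> R\<^sup>*)"
    have t': "t' \<in> T \<and> (t', b) \<in> R\<^sup>*" unfolding t'_def by (rule someI[of _ t]) (use that in auto)
    then have "(b, t) \<in> R\<^sup>*" using that symR by (meson sym_rtrancl symD)
    then have "\<rho> t' = \<rho> t" using t' that by (intro \<rho>_eq) (auto intro: rtrancl_trans)
    moreover have "h b = \<rho> t'" using that unfolding h_def t'_def by auto
    ultimately show ?thesis by simp
  qed
  have h1: "h b = 1 \<or> h b = -1" for b
  proof (cases "\<exists>t\<in>T. (t, b) \<in> R\<^sup>*")
    case True
    then obtain t where "t \<in> T" "(t, b) \<in> R\<^sup>*" by auto
    with h_eq[OF this] \<rho>1 show ?thesis by simp
  qed (simp add: h_def)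
  have h_R: "h a = h b" if "(a, b) \<in> R" for a b
  proof (cases "\<exists>t\<in>T. (t, a) \<in> R\<^sup>*")
    case True
    then obtain t where t: "t \<in> T" "(t, a) \<in> R\<^sup>*" by auto
    then have "(t, b) \<in> R\<^sup>*" using that by (meson rtrancl.rtrancl_into_rtrancl)
    then show ?thesis using h_eq t by simp
  next
    case False
    have "(b, a) \<in> R" using that symR by (meson symD)
    then have "\<not> (\<exists>t\<in>T. (t, b) \<in> R\<^sup>*)" using False by (meson rtrancl.rtrancl_into_rtrancl)
    with False show ?thesis by (simp add: h_def)
  qed
  \<comment> \<open>All nonzero rows of a column in \<open>F\<close> lie in one component, so any of
    them tells how the column has to flip. For a column that is zero on \<open>B\<close> the value
    is arbitrary.\<close>
  define c where "c = (\<lambda>e. SOME b. b \<in> B \<and> D e b \<noteq> 0)"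
  define s' where "s' = (\<lambda>e. if e \<in> B then s e * h e else if e \<in> F then s e * h (c e) else 1)"
  have "signing B (insert f F) s'"
    unfolding signing_def
  proof (intro conjI allI ballI)
    show "s' e = 1 \<or> s' e = -1" for e
      using s1[of e] h1[of e] h1[of "c e"] by (auto simp: s'_def)
    fix e b assume e: "e \<in> insert f F" and b: "b \<in> B"
    have "D' e b = s' e * s' b * D e b"
    proof (cases "e = f")
      case True
      have s': "s' f = 1" "s' b = s b * h b" using f b by (auto simp: s'_def)
      show ?thesis
      proof (cases "b \<in> T")
        case bT: True
        then have "h b = \<rho> b" by (rule h_eq) simp
        then have "s' b * D f b = (s b * s b) * (D f b * D f b) * D' f b" by (simp add: s' \<rho>_def)
        moreover have "s b * s b = 1" using s1[of b] by auto
        moreover have "D f b * D f b = 1" using K.fund_sign[OF B f(1), of b] bT by (auto simp: D_def T_def)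
        ultimately show ?thesis using True s' by simp
      next
        case False
        then show ?thesis using fD'[OF b] b True by (auto simp: T_def)
      qed
    next
      case False
      then have eF: "e \<in> F" "e \<notin> B" using e F by auto
      have *: "D' e b = s e * s b * D e b" using s eF b by (auto simp: signing_def D_def D'_def)
      show ?thesis
      proof (cases "D e b = 0")
        case True with * show ?thesis by simp
      next
        case nz: False
        have "c e \<in> B \<and> D e (c e) \<noteq> 0" unfolding c_def by (rule someI[of _ b]) (use nz b in auto)
        then have "(c e, b) \<in> R" using nz b eF by (auto simp: R_def)
        then have "h (c e) = h b" by (rule h_R)
        moreover have "h b * h b = 1" using h1[of b] by auto
        ultimately have "s' e * s' b = s e * s b"
          using eF b by (simp add: s'_def mult.assoc mult.left_commute)
        with * show ?thesis by simp
      qed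
    qed
    then show "K'.fund B e b = s' e * s' b * K.fund B e b" by (simp add: D_def D'_def)
  qed
  with that show ?thesis by blast
qed

lemma ex_signing:
  assumes B: "K.basis B"
  obtains s where "signing B (E - B) s"
proof -
  have "\<exists>s. signing B F s" if "F \<subseteq> E - B" for F
    using finite_subset[OF that] K.finite_E that
  proof (induction F rule: infinite_finite_induct)
    case empty
    show ?case by (intro exI[of _ "\<lambda>_. 1"]) (simp add: signing_def)
  next
    case (insert f F)
    then obtain s where "signing B F s" by auto
    then show ?case using signing_insert[OF B, of F f s] insert by auto
  qed auto
  with that show ?thesis by blast
qed

text \<open>A signing of all columns carries fundamental relations to fundamental relations up to
  sign, and these span both spaces. The signs are returned as integers so that they act on the
  integral relations as well.\<close>

theorem unique_up_to_signs:
  obtains s :: "'a \<Rightarrow> int" where "\<And>e. s e = 1 \<or> s e = -1" "K' = {x. (\<lambda>e. s e * x e) \<in> K}"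
proof -
  obtain B where B: "K.basis B" using K.ex_basis[OF K.free_empty] by blast
  then have B': "K'.basis B" using basis_iff by simp
  obtain s where "signing B (E - B) s" using ex_signing[OF B] .
  then have s1: "\<And>e. s e = 1 \<or> s e = -1"
    and s: "\<And>e b. e \<in> E - B \<Longrightarrow> b \<in> B \<Longrightarrow> K'.fund B e b = s e * s b * K.fund B e b"
    by (auto simp: signing_def)
  have ss: "s e * s e = 1" for e using s1[of e] by auto
  \<comment> \<open>On \<open>B\<close> this is the signing; off \<open>B\<close> both fundamental
    relations are the unit vector at \<open>e\<close>.\<close>
  have f1: "s g * K.fund B e g = s e * K'.fund B e g" "s g * K'.fund B e g = s e * K.fund B e g"
    if "e \<in> E - B" for e g
    using s1[of e] s1[of g] s[OF that, of g] K.fund_off[OF B that, of g] K'.fund_off[OF B' that, of g]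
    by (cases "g \<in> B"; auto)+
  have 1: "(\<lambda>e. s e * x e) \<in> K'" if "x \<in> K" for x
  proof -
    have "(\<lambda>g. s g * x g) = (\<Sum>e\<in>E - B. (x e * s e) *\<^sub>R K'.fund B e)"
    proof
      fix g
      have "s g * x g = s g * (\<Sum>e\<in>E - B. x e *\<^sub>R K.fund B e) g"
        using fun_cong[OF K.fund_expansion[OF B that], of g] by simp
      also have "\<dots> = (\<Sum>e\<in>E - B. (x e * s e) *\<^sub>R K'.fund B e) g"
        unfolding sum_fun_apply sum_distrib_left
      proof (intro sum.cong refl)
        fix e assume "e \<in> E - B"
        have "s g * (x e *\<^sub>R K.fund B e) g = x e * (s g * K.fund B e g)" by simp
        also have "\<dots> = ((x e * s e) *\<^sub>R K'.fund B e) g" unfolding f1(1)[OF \<open>e \<in> E - B\<close>] by simp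
        finally show "s g * (x e *\<^sub>R K.fund B e) g = ((x e * s e) *\<^sub>R K'.fund B e) g" .
      qed
      finally show "s g * x g = (\<Sum>e\<in>E - B. (x e * s e) *\<^sub>R K'.fund B e) g" .
    qed
    also have "\<dots> \<in> K'" by (intro K'.sum_mem K'.scale_mem K'.fund(1)[OF B'])
    finally show ?thesis .
  qed
  have 2: "(\<lambda>e. s e * x e) \<in> K" if "x \<in> K'" for x
  proof -
    have "(\<lambda>g. s g * x g) = (\<Sum>e\<in>E - B. (x e * s e) *\<^sub>R K.fund B e)"
    proof
      fix g
      have "s g * x g = s g * (\<Sum>e\<in>E - B. x e *\<^sub>R K'.fund B e) g"
        using fun_cong[OF K'.fund_expansion[OF B' that], of g] by simp
      also have "\<dots> = (\<Sum>e\<in>E - B. (x e * s e) *\<^sub>R K.fund B e) g"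
        unfolding sum_fun_apply sum_distrib_left
      proof (intro sum.cong refl)
        fix e assume "e \<in> E - B"
        have "s g * (x e *\<^sub>R K'.fund B e) g = x e * (s g * K'.fund B e g)" by simp
        also have "\<dots> = ((x e * s e) *\<^sub>R K.fund B e) g" unfolding f1(2)[OF \<open>e \<in> E - B\<close>] by simp
        finally show "s g * (x e *\<^sub>R K'.fund B e) g = ((x e * s e) *\<^sub>R K.fund B e) g" .
      qed
      finally show "s g * x g = (\<Sum>e\<in>E - B. (x e * s e) *\<^sub>R K.fund B e) g" .
    qed
    also have "\<dots> \<in> K" by (intro K.sum_mem K.scale_mem K.fund(1)[OF B])
    finally show ?thesis .
  qed
  have inv: "(\<lambda>e. s e * (s e * x e)) = x" for x
    unfolding mult.assoc[symmetric] ss by simp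
  define \<sigma> :: "'a \<Rightarrow> int" where "\<sigma> = (\<lambda>e. if s e = 1 then 1 else -1)"
  have \<sigma>: "real_of_int (\<sigma> e) = s e" for e using s1[of e] by (auto simp: \<sigma>_def)
  have "K' = {x. (\<lambda>e. \<sigma> e * x e) \<in> K}"
  proof (unfold \<sigma>, intro equalityI subsetI CollectI)
    show "(\<lambda>e. s e * x e) \<in> K" if "x \<in> K'" for x using that by (rule 2)
    show "x \<in> K'" if "x \<in> {x. (\<lambda>e. s e * x e) \<in> K}" for x
      using 1[of "\<lambda>e. s e * x e"] that by (simp only: inv mem_Collect_eq)
  qed
  moreover have "\<sigma> e = 1 \<or> \<sigma> e = -1" for e by (simp add: \<sigma>_def)
  ultimately show ?thesis using that by blast
qed

text \<open>Changing signs of coordinates preserves the norm and maps one lattice of relations onto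
  the other, hence cosets to cosets.\<close>

lemma coset_count_eq: "coset_count E (int_relations K') m = coset_count E (int_relations K) m"
proof -
  obtain s :: "'a \<Rightarrow> int" where s: "\<And>e. s e = 1 \<or> s e = -1" and K': "K' = {x. (\<lambda>e. s e * x e) \<in> K}"
    using unique_up_to_signs by blast
  define \<phi> where "\<phi> = (\<lambda>(c :: 'a \<Rightarrow> int) e. s e * c e)"
  let ?U = "{c. supp c \<subseteq> E \<and> l1_norm c \<le> m}"
  have ss: "s e * (s e * x) = x" for e x using s[of e] by auto
  have \<phi>\<phi>: "\<phi> (\<phi> c) = c" for c by (simp add: \<phi>_def ss)
  have snz: "s e \<noteq> 0" "\<bar>s e\<bar> = 1" for e using s[of e] by auto
  have supp: "supp (\<phi> c) = supp c" for c using snz by (auto simp: \<phi>_def supp_def)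
  have l1: "l1_norm (\<phi> c) = l1_norm c" for c
    unfolding l1_norm_def supp by (simp add: \<phi>_def abs_mult snz)
  have "\<phi> ` ?U = ?U"
  proof (intro equalityI subsetI)
    show "c \<in> ?U" if "c \<in> \<phi> ` ?U" for c using that by (auto simp: supp l1)
    show "c \<in> \<phi> ` ?U" if "c \<in> ?U" for c
      using that by (intro image_eqI[of _ _ "\<phi> c"]) (auto simp: \<phi>\<phi> supp l1)
  qed
  moreover have "card (coset (int_relations K') ` ?U) = card ((\<lambda>c. coset (int_relations K) (\<phi> c)) ` ?U)"
  proof (rule card_image_eq_fibres)
    fix c d
    have "(\<lambda>e. real_of_int (s e) * real_of_int ((c - d) e)) = (\<lambda>e. real_of_int ((\<phi> c - \<phi> d) e))"
      by (simp add: \<phi>_def fun_eq_iff algebra_simps)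
    then have "c - d \<in> int_relations K' \<longleftrightarrow> \<phi> c - \<phi> d \<in> int_relations K"
      by (simp only: int_relations_def K' mem_Collect_eq)
    then show "coset (int_relations K') c = coset (int_relations K') d
        \<longleftrightarrow> coset (int_relations K) (\<phi> c) = coset (int_relations K) (\<phi> d)"
      by (simp only: K.int.coset_eq_iff K'.int.coset_eq_iff)
  qed
  ultimately show ?thesis unfolding coset_count_def by (simp only: image_image[symmetric, of _ \<phi>])
qed

end


subsection \<open>Totally unimodular matrices\<close>

definition columns_mat :: "nat \<Rightarrow> (nat \<Rightarrow> nat \<Rightarrow> real) \<Rightarrow> real mat"
  where "columns_mat n V = mat n n (\<lambda>(i, j). V j i)"

definition combination :: "nat \<Rightarrow> (nat \<Rightarrow> nat \<Rightarrow> real) \<Rightarrow> (nat \<Rightarrow> real) \<Rightarrow> nat \<Rightarrow> real"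
  where "combination n V v = (\<Sum>j<n. v j *\<^sub>R V j)"

lemma columns_mat_carrier [simp]: "columns_mat n V \<in> carrier_mat n n"
  by (simp add: columns_mat_def)

lemma det_columns_mat: "det (columns_mat n V) = matrix_minor V {..<n} id"
  unfolding matrix_minor_def det_def'[OF columns_mat_carrier]
proof (intro sum.cong)
  fix \<pi> assume "\<pi> \<in> {\<pi>. \<pi> permutes {..<n}}"
  then have "\<pi> i < n" if "i < n" for i using permutes_in_image[of \<pi> "{..<n}" i] that by simp
  then show "signof \<pi> * (\<Prod>i = 0..<n. columns_mat n V $$ (i, \<pi> i))
    = signof \<pi> * (\<Prod>i\<in>{..<n}. V (id (\<pi> i)) i)"
    by (simp add: columns_mat_def atLeast0LessThan)
qed (simp add: atLeast0LessThan)

lemma columns_mat_mult_vec: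
  "columns_mat n V *\<^sub>v vec n v = vec n (combination n V v)"
proof (rule eq_vecI)
  fix i assume "i < dim_vec (vec n (combination n V v))"
  then have i: "i < n" by simp
  then have "(columns_mat n V *\<^sub>v vec n v) $ i = (\<Sum>j = 0..<n. V j i * v j)"
    by (simp add: columns_mat_def scalar_prod_def)
  also have "\<dots> = combination n V v i"
    by (simp add: combination_def sum_fun_apply atLeast0LessThan mult.commute)
  finally show "(columns_mat n V *\<^sub>v vec n v) $ i = vec n (combination n V v) $ i" using i by simp
qed (simp add: columns_mat_def)

lemma minor_replace_column:
  assumes "r < n"
  shows "matrix_minor (V(r := combination n V v)) {..<n} id = v r * matrix_minor V {..<n} id"
proof -
  have "replace_col (columns_mat n V) (columns_mat n V *\<^sub>v vec n v) r
    = columns_mat n (V(r := combination n V v))"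
    unfolding columns_mat_mult_vec
    by (rule eq_matI) (auto simp: replace_col_def columns_mat_def)
  then show ?thesis
    using cramer_lemma_mat[of "columns_mat n V" n "vec n v" r] assms by (simp add: det_columns_mat)
qed

lemma minor_eq_0_iff:
  "matrix_minor V {..<n} id = 0
    \<longleftrightarrow> (\<exists>v. (\<exists>j<n. v j \<noteq> 0) \<and> (\<forall>i<n. combination n V v i = 0))"
proof -
  have "matrix_minor V {..<n} id = 0 \<longleftrightarrow>
    (\<exists>w. w \<in> carrier_vec n \<and> w \<noteq> 0\<^sub>v n \<and> columns_mat n V *\<^sub>v w = 0\<^sub>v n)"
    unfolding det_columns_mat[symmetric] by (rule det_0_iff_vec_prod_zero_field) simp
  also have "\<dots> \<longleftrightarrow> (\<exists>v. vec n v \<noteq> 0\<^sub>v n \<and> columns_mat n V *\<^sub>v vec n v = 0\<^sub>v n)"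
  proof (intro iffI; elim exE conjE)
    fix w :: "real Matrix.vec"
    assume w: "w \<in> carrier_vec n" "w \<noteq> 0\<^sub>v n" "columns_mat n V *\<^sub>v w = 0\<^sub>v n"
    have "vec n (\<lambda>i. w $ i) = w" using w(1) by auto
    with w show "\<exists>v. vec n v \<noteq> 0\<^sub>v n \<and> columns_mat n V *\<^sub>v vec n v = 0\<^sub>v n" by metis
  next
    fix v :: "nat \<Rightarrow> real"
    assume "vec n v \<noteq> 0\<^sub>v n" "columns_mat n V *\<^sub>v vec n v = 0\<^sub>v n"
    then show "\<exists>w. w \<in> carrier_vec n \<and> w \<noteq> 0\<^sub>v n \<and> columns_mat n V *\<^sub>v w = 0\<^sub>v n"
      by (intro exI[of _ "vec n v"]) simp
  qed
  also have "\<dots> \<longleftrightarrow> (\<exists>v. (\<exists>j<n. v j \<noteq> 0) \<and> (\<forall>i<n. combination n V v i = 0))"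
    unfolding columns_mat_mult_vec by (auto simp: vec_eq_iff)
  finally show ?thesis .
qed

lemma ex_combination:
  assumes "matrix_minor V {..<n} id \<noteq> 0"
  obtains v where "\<And>i. i < n \<Longrightarrow> combination n V v i = x i"
proof -
  let ?M = "columns_mat n V"
  define a where "a = inverse (det ?M)"
  define w where "w = a \<cdot>\<^sub>v (adj_mat ?M *\<^sub>v vec n x)"
  have adj: "adj_mat ?M \<in> carrier_mat n n" "?M * adj_mat ?M = det ?M \<cdot>\<^sub>m 1\<^sub>m n"
    by (rule adj_mat(1,2)[of _ n]; simp)+
  have w: "w \<in> carrier_vec n" using adj(1) by (auto simp: w_def)
  have "?M *\<^sub>v w = a \<cdot>\<^sub>v (?M *\<^sub>v (adj_mat ?M *\<^sub>v vec n x))"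
    unfolding w_def using adj(1) by (intro mult_mat_vec[of _ n n]) auto
  also have "?M *\<^sub>v (adj_mat ?M *\<^sub>v vec n x) = (?M * adj_mat ?M) *\<^sub>v vec n x"
    using adj(1) by (intro assoc_mult_mat_vec[symmetric, of _ n n _ n]) auto
  also have "a \<cdot>\<^sub>v \<dots> = vec n x"
    using assms unfolding adj(2) a_def det_columns_mat[symmetric]
    by (intro eq_vecI) (simp_all add: smult_scalar_prod_distrib[of _ n])
  finally have "?M *\<^sub>v w = vec n x" .
  moreover have "w = vec n (\<lambda>i. w $ i)" using w by auto
  ultimately have "vec n (combination n V (\<lambda>i. w $ i)) = vec n x"
    using columns_mat_mult_vec[of n V "\<lambda>i. w $ i"] by simp
  then have "combination n V (\<lambda>i. w $ i) i = x i" if "i < n" for i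
    using that by (auto simp: vec_eq_iff)
  with that show ?thesis by blast
qed

text \<open>A permutation that moves an index outside \<open>R\<close> picks an off-diagonal zero of
  a unit column. Minors on arbitrary row sets thus become full determinants of size
  \<open>n\<close>, where Cramer's rule applies.\<close>

lemma matrix_minor_extend:
  assumes R: "R \<subseteq> {..<n}" and unit: "\<And>j. j \<in> {..<n} - R \<Longrightarrow> V j = unit_at j 1"
  shows "matrix_minor V {..<n} id = matrix_minor V R id"
  unfolding matrix_minor_def
proof (rule sum.mono_neutral_cong_right)
  show "{\<pi>. \<pi> permutes R} \<subseteq> {\<pi>. \<pi> permutes {..<n}}" using R permutes_subset by blast
  show "\<forall>\<pi>\<in>{\<pi>. \<pi> permutes {..<n}} - {\<pi>. \<pi> permutes R}. of_int (sign \<pi>) * (\<Prod>i<n. V (id (\<pi> i)) i) = 0"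
  proof
    fix \<pi> assume \<pi>: "\<pi> \<in> {\<pi>. \<pi> permutes {..<n}} - {\<pi>. \<pi> permutes R}"
    have "\<exists>i\<in>{..<n} - R. \<pi> i \<noteq> i"
    proof (rule ccontr)
      assume "\<not> ?thesis"
      then have "\<pi> i = i" if "i \<notin> R" for i
        using that \<pi> permutes_not_in[of \<pi> "{..<n}" i] by auto
      then have "\<pi> permutes R" using \<pi> by (auto simp: permutes_def)
      with \<pi> show False by simp
    qed
    then obtain j where j: "j < n" "j \<notin> R" "\<pi> j \<noteq> j" by auto
    have "j \<in> \<pi> ` {..<n}" using permutes_image[of \<pi> "{..<n}"] \<pi> j by auto
    then obtain i where i: "i < n" "\<pi> i = j" by auto
    then have "V (id (\<pi> i)) i = 0" using unit[of j] j by (auto simp: unit_at_def)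
    then show "of_int (sign \<pi>) * (\<Prod>i<n. V (id (\<pi> i)) i) = 0"
      using i(1) by (auto intro!: bexI[of _ i])
  qed
  show "of_int (sign \<pi>) * (\<Prod>i<n. V (id (\<pi> i)) i) = of_int (sign \<pi>) * (\<Prod>i\<in>R. V (id (\<pi> i)) i)"
    if "\<pi> \<in> {\<pi>. \<pi> permutes R}" for \<pi>
  proof -
    have "(\<Prod>i<n. V (id (\<pi> i)) i) = (\<Prod>i\<in>R. V (id (\<pi> i)) i)"
    proof (rule prod.mono_neutral_right)
      show "\<forall>i\<in>{..<n} - R. V (id (\<pi> i)) i = 1"
        using unit that permutes_not_in[of \<pi> R] by (auto simp: unit_at_def)
    qed (use R in auto)
    then show ?thesis by simp
  qed
qed (auto intro: finite_permutations)

lemma matrix_minor_comp: "matrix_minor A R c = matrix_minor (A \<circ> c) R id"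
  by (simp add: matrix_minor_def)

lemma matrix_minor_cong:
  "(\<And>j. j \<in> R \<Longrightarrow> V j = W j) \<Longrightarrow> matrix_minor V R id = matrix_minor W R id"
  unfolding matrix_minor_def by (intro sum.cong arg_cong2[of _ _ _ _ "(*)"] refl prod.cong)
    (auto simp: permutes_in_image)

lemma matrix_minor_Ints:
  assumes "\<And>j i. j \<in> R \<Longrightarrow> i \<in> R \<Longrightarrow> V j i \<in> \<int>"
  shows "matrix_minor V R id \<in> \<int>"
  unfolding matrix_minor_def using assms
  by (intro Ints_sum Ints_mult Ints_prod) (auto simp: permutes_in_image)

section \<open>Relations among the columns of a matrix\<close>

definition relations :: "'a set \<Rightarrow> ('a \<Rightarrow> nat \<Rightarrow> real) \<Rightarrow> ('a \<Rightarrow> real) set"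
  where "relations E A = {x. supp x \<subseteq> E \<and> (\<Sum>e\<in>E. x e *\<^sub>R A e) = 0}"

lemma relation_space_relations:
  assumes "finite E"
  shows "relation_space E (relations E A)"
proof
  show "subspace (relations E A)"
  proof (rule subspaceI)
    show "0 \<in> relations E A" by (simp add: relations_def supp_def)
  next
    fix x y :: "'a \<Rightarrow> real" and a :: real assume x: "x \<in> relations E A"
    show "a *\<^sub>R x \<in> relations E A"
      using x by (auto simp: relations_def supp_def simp flip: scaleR_scaleR scaleR_sum_right)
    assume "y \<in> relations E A"
    with x show "x + y \<in> relations E A"
      using supp_add[of x y] by (auto simp: relations_def scaleR_add_left sum.distrib)
  qed
qed (use assms in \<open>auto simp: relations_def\<close>)

lemma relations_iff:
  assumes "finite E" "I \<subseteq> E" "supp x \<subseteq> I"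
  shows "x \<in> relations E A \<longleftrightarrow> (\<Sum>e\<in>I. x e *\<^sub>R A e) = 0"
proof -
  have "(\<Sum>e\<in>E. x e *\<^sub>R A e) = (\<Sum>e\<in>I. x e *\<^sub>R A e)"
    using assms by (intro sum.mono_neutral_right) (auto simp: supp_def)
  with assms show ?thesis by (auto simp: relations_def)
qed

lemma independent_family_zero:
  assumes "finite J" "inj_on V J" "independent (V ` J)" "(\<Sum>j\<in>J. v j *\<^sub>R V j) = 0" "j \<in> J"
  shows "v j = 0"
proof -
  have "(\<Sum>y\<in>V ` J. v (inv_into J V y) *\<^sub>R y) = 0"
    using assms by (simp add: sum.reindex)
  then have "v (inv_into J V (V j)) = 0"
    using assms by (intro independentD[of "V ` J" "V ` J" "\<lambda>y. v (inv_into J V y)"]) auto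
  then show ?thesis using assms by simp
qed

lemma free_relations_iff:
  assumes "finite E" "I \<subseteq> E"
  shows "free (relations E A) I \<longleftrightarrow> inj_on A I \<and> independent (A ` I)"
proof
  have fin: "finite I" using assms finite_subset by blast
  assume "inj_on A I \<and> independent (A ` I)"
  then show "free (relations E A) I"
    unfolding free_def
  proof (intro ballI impI ext)
    fix x e assume "x \<in> relations E A" "supp x \<subseteq> I"
    with \<open>inj_on A I \<and> independent (A ` I)\<close> have "x e = 0" if "e \<in> I"
      using independent_family_zero[of I A x e] relations_iff[OF assms] fin that by auto
    with \<open>supp x \<subseteq> I\<close> show "x e = 0 e" by (auto simp: supp_def)
  qed
next
  have fin: "finite I" using assms finite_subset by blast
  assume free: "free (relations E A) I"
  have zero: "x e = 0" if "(\<Sum>e\<in>I. x e *\<^sub>R A e) = 0" "e \<in> I" for x e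
  proof -
    define y where "y = (\<lambda>e. if e \<in> I then x e else 0)"
    have sy: "supp y \<subseteq> I" by (auto simp: supp_def y_def)
    have "(\<Sum>e\<in>I. y e *\<^sub>R A e) = 0" using that(1) by (simp add: y_def)
    then have "y \<in> relations E A" using relations_iff[OF assms sy] by simp
    then have "y = 0" using free sy by (auto simp: free_def)
    then have "y e = 0" by simp
    then show ?thesis using that(2) by (simp add: y_def)
  qed
  have inj: "inj_on A I"
  proof (rule inj_onI, rule ccontr)
    fix a b assume ab: "a \<in> I" "b \<in> I" "A a = A b" "a \<noteq> b"
    define x where "x = (\<lambda>e. if e = a then 1 else if e = b then -1 else 0 :: real)"
    have "(\<Sum>e\<in>I. x e *\<^sub>R A e) = (\<Sum>e\<in>{a, b}. x e *\<^sub>R A e)"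
      using ab fin by (intro sum.mono_neutral_right) (auto simp: x_def)
    also have "\<dots> = 0" using ab by (simp add: x_def)
    finally have "x a = 0" using zero ab by blast
    then show False by (simp add: x_def)
  qed
  moreover have "independent (A ` I)"
  proof
    assume "dependent (A ` I)"
    then obtain u where u: "\<exists>v\<in>A ` I. u v \<noteq> 0" "(\<Sum>v\<in>A ` I. u v *\<^sub>R v) = 0"
      using dependent_finite[of "A ` I"] fin by auto
    have "(\<Sum>e\<in>I. u (A e) *\<^sub>R A e) = 0" using u(2) inj by (simp add: sum.reindex)
    with zero[of "\<lambda>e. u (A e)"] u(1) show False by auto
  qed
  ultimately show "inj_on A I \<and> independent (A ` I)" by simp
qed

lemma vector_matroid_eq: "finite E \<Longrightarrow> vector_matroid E A = relation_matroid E (relations E A)"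
  unfolding vector_matroid_def relation_matroid_def using free_relations_iff by blast

lemma tu_entry:
  assumes "totally_unimodular n E A" "e \<in> E"
  shows "A e i \<in> {-1, 0, 1}"
proof (cases "i < n")
  case True
  then have "matrix_minor A {i} (\<lambda>_. e) \<in> {-1, 0, 1}"
    using assms unfolding totally_unimodular_def by auto
  then show ?thesis by (simp add: matrix_minor_def sign_id)
next
  case False
  then show ?thesis using assms by (auto simp: totally_unimodular_def is_matrix_def)
qed

lemma sum_units:
  assumes "\<And>i. i \<ge> n \<Longrightarrow> x i = 0"
  shows "x = (\<Sum>j<n. x j *\<^sub>R (unit_at j 1 :: nat \<Rightarrow> real))"
proof
  fix i
  have "(\<Sum>j<n. x j *\<^sub>R (unit_at j 1 :: nat \<Rightarrow> real)) i = (\<Sum>j<n. if j = i then x j else 0)"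
    unfolding sum_fun_apply by (intro sum.cong) (auto simp: unit_at_def)
  also have "\<dots> = x i" using assms[of i] by auto
  finally show "x i = (\<Sum>j<n. x j *\<^sub>R (unit_at j 1 :: nat \<Rightarrow> real)) i" by simp
qed

lemma independent_units: "independent ((\<lambda>j. unit_at j 1 :: nat \<Rightarrow> real) ` {..<n})"
  and card_units: "card ((\<lambda>j. unit_at j 1 :: nat \<Rightarrow> real) ` {..<n}) = n"
proof -
  let ?u = "\<lambda>j. unit_at j 1 :: nat \<Rightarrow> real"
  have inj: "inj_on ?u {..<n}"
  proof (rule inj_onI)
    fix i j assume "?u i = ?u j"
    then have "?u i i = ?u j i" by (rule fun_cong)
    then show "i = j" by (simp add: unit_at_def split: if_splits)
  qed
  then show "card (?u ` {..<n}) = n" by (simp add: card_image)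
  show "independent (?u ` {..<n})"
  proof
    assume "dependent (?u ` {..<n})"
    then obtain c where c: "\<exists>v\<in>?u ` {..<n}. c v \<noteq> 0" "(\<Sum>v\<in>?u ` {..<n}. c v *\<^sub>R v) = 0"
      using dependent_finite[of "?u ` {..<n}"] by auto
    then have s: "(\<Sum>j<n. c (?u j) *\<^sub>R ?u j) = 0" using inj by (simp add: sum.reindex)
    have "c (?u i) = 0" if "i < n" for i
    proof -
      have "0 = (\<Sum>j<n. c (?u j) *\<^sub>R ?u j) i" by (simp add: s)
      also have "\<dots> = (\<Sum>j<n. if j = i then c (?u j) else 0)"
        unfolding sum_fun_apply by (intro sum.cong) (auto simp: unit_at_def)
      finally show ?thesis using that by simp
    qed
    with c(1) show False by auto
  qed
qed

text \<open>
  Completing independent columns to a basis by unit vectors exhibits a square submatrix on which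
  Cramer's rule computes the coordinates.
\<close>

lemma tu_coordinates:
  assumes tu: "totally_unimodular n E A" and I: "I \<subseteq> E" "free (relations E A) I"
  shows "\<exists>R c. R \<subseteq> {..<n} \<and> bij_betw c R I \<and> matrix_minor A R c \<in> {-1, 1} \<and>
    (\<forall>x. \<forall>r\<in>R. matrix_minor ((A \<circ> c)(r := \<Sum>b\<in>I. x b *\<^sub>R A b)) R id
      = x (c r) * matrix_minor A R c)"
proof -
  let ?u = "\<lambda>j. unit_at j 1 :: nat \<Rightarrow> real"
  let ?U = "?u ` {..<n}"
  have mat: "finite E" "\<And>e i. e \<in> E \<Longrightarrow> i \<ge> n \<Longrightarrow> A e i = 0"
    using tu by (auto simp: totally_unimodular_def is_matrix_def)
  have finI: "finite I" using I mat finite_subset by blast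
  have AI: "inj_on A I" "independent (A ` I)" using free_relations_iff[OF mat(1) I(1)] I(2) by auto
  have in_span: "A e \<in> span ?U" if "e \<in> E" for e
  proof -
    have "A e = (\<Sum>j<n. A e j *\<^sub>R ?u j)" by (rule sum_units) (rule mat(2)[OF that])
    also have "\<dots> \<in> span ?U" by (intro span_sum span_scale span_base) auto
    finally show ?thesis .
  qed
  obtain B where B: "A ` I \<subseteq> B" "B \<subseteq> A ` I \<union> ?U" "independent B" "A ` I \<union> ?U \<subseteq> span B"
    using maximal_independent_subset_extend[of "A ` I" "A ` I \<union> ?U"] AI(2) by auto
  have "B \<subseteq> span ?U" using B(2) in_span I(1) span_superset by blast
  then have finB: "finite B" and "card B \<le> card ?U"
    using independent_span_bound[of ?U B] B(3) by auto
  moreover have "card ?U \<le> card B"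
    using independent_span_bound[OF finB independent_units[of n]] B(4) by auto
  ultimately have cardB: "card B = n" by (simp add: card_units)
  \<comment> \<open>These are the positions of the unit vectors added to the basis. The remaining
    rows form \<open>R\<close>, which a dimension count shows to have as many elements as
    \<open>I\<close>.\<close>
  define J where "J = {j. j < n \<and> ?u j \<in> B - A ` I}"
  have uJ: "?u ` J = B - A ` I" using B(2) by (auto simp: J_def)
  have inj_u: "inj_on ?u {..<n}" by (rule eq_card_imp_inj_on) (simp_all add: card_units)
  have J: "J \<subseteq> {..<n}" by (auto simp: J_def)
  have "card J = card (B - A ` I)"
    using uJ card_image[OF inj_on_subset[OF inj_u J]] by simp
  also have "\<dots> = n - card I"
    using B(1) finI cardB by (simp add: card_Diff_subset card_image AI(1))
  finally have cJ: "card J = n - card I" .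
  have cI: "card I \<le> n"
    using card_mono[OF finB B(1)] by (simp add: card_image AI(1) cardB)
  define R where "R = {..<n} - J"
  have "card R = card I" using cJ cI J by (simp add: R_def card_Diff_subset finite_subset[OF J])
  then obtain c where c: "bij_betw c R I" using finite_same_card_bij[of R I] finI by (auto simp: R_def)
  \<comment> \<open>Each unit vector sits in its own position and the columns of \<open>I\<close>
    fill the others, so that \<open>matrix_minor_extend\<close> equates the full determinant with
    the minor on \<open>R\<close>.\<close>
  define V where "V = (\<lambda>j. if j \<in> R then A (c j) else ?u j)"
  have cR: "c r \<in> I" if "r \<in> R" for r using c that by (auto simp: bij_betw_def)
  have R: "R \<subseteq> {..<n}" by (auto simp: R_def)
  have VB: "V ` {..<n} = B"
  proof -
    have "{..<n} = R \<union> J" using J by (auto simp: R_def)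
    then have "V ` {..<n} = V ` R \<union> V ` J" by (simp add: image_Un)
    also have "V ` R = A ` c ` R" by (auto simp: V_def)
    also have "c ` R = I" using c by (simp add: bij_betw_def)
    also have "V ` J = ?u ` J" by (auto simp: V_def R_def)
    finally show ?thesis using uJ B(1) by auto
  qed
  have injV: "inj_on V {..<n}" by (rule eq_card_imp_inj_on) (simp_all add: VB cardB)
  have ext: "matrix_minor V' {..<n} id = matrix_minor V' R id"
    if "\<And>j. j \<notin> R \<Longrightarrow> V' j = V j" for V'
    using R that by (intro matrix_minor_extend) (auto simp: V_def)
  have VR: "matrix_minor V R id = matrix_minor A R c"
    unfolding matrix_minor_comp[of A] by (rule matrix_minor_cong) (simp add: V_def)
  have "matrix_minor V {..<n} id \<noteq> 0"
    unfolding minor_eq_0_iff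
  proof
    assume "\<exists>v. (\<exists>j<n. v j \<noteq> 0) \<and> (\<forall>i<n. combination n V v i = 0)"
    then obtain v where v: "\<exists>j<n. v j \<noteq> 0" "\<forall>i<n. combination n V v i = 0" by blast
    have "V j i = 0" if "j < n" "i \<ge> n" for i j
      using that cR I(1) mat(2) by (auto simp: V_def unit_at_def)
    then have "combination n V v i = 0" for i
      using v(2) by (cases "i < n") (auto simp: combination_def sum_fun_apply)
    then have "(\<Sum>j<n. v j *\<^sub>R V j) = 0" by (auto simp: combination_def fun_eq_iff)
    then have "v j = 0" if "j < n" for j
      using independent_family_zero[of "{..<n}" V v j] injV B(3) that by (simp add: VB)
    with v(1) show False by blast
  qed
  then have "matrix_minor A R c \<noteq> 0" using ext[of V] VR by simp
  moreover have "matrix_minor A R c \<in> {-1, 0, 1}"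
    using tu R c I(1) unfolding totally_unimodular_def by (auto simp: bij_betw_def)
  ultimately have "matrix_minor A R c \<in> {-1, 1}" by auto
  moreover have "matrix_minor ((A \<circ> c)(r := \<Sum>b\<in>I. x b *\<^sub>R A b)) R id = x (c r) * matrix_minor A R c"
    if r: "r \<in> R" for x r
  proof -
    define v where "v = (\<lambda>j. if j \<in> R then x (c j) else 0)"
    have "combination n V v = (\<Sum>j\<in>R. x (c j) *\<^sub>R A (c j))"
      unfolding combination_def using R
      by (intro sum.mono_neutral_cong_right) (auto simp: v_def V_def)
    also have "\<dots> = (\<Sum>b\<in>I. x b *\<^sub>R A b)" using c by (rule sum.reindex_bij_betw)
    finally have comb: "combination n V v = (\<Sum>b\<in>I. x b *\<^sub>R A b)" .
    have "matrix_minor ((A \<circ> c)(r := \<Sum>b\<in>I. x b *\<^sub>R A b)) R id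
      = matrix_minor (V(r := combination n V v)) R id"
      unfolding comb by (rule matrix_minor_cong) (simp add: V_def)
    also have "\<dots> = matrix_minor (V(r := combination n V v)) {..<n} id"
      using r by (intro ext[symmetric]) auto
    also have "\<dots> = v r * matrix_minor V {..<n} id"
      using r R by (intro minor_replace_column) auto
    also have "\<dots> = x (c r) * matrix_minor A R c"
      using r ext[of V] VR by (simp add: v_def)
    finally show ?thesis .
  qed
  ultimately show ?thesis using R c by (intro exI[of _ R] exI[of _ c] conjI allI ballI) simp_all
qed

text \<open>A relation of minimal support expresses one column through independent others. By
  Cramer's rule each coefficient is a quotient of a minor by a minor of absolute value 1.\<close>

lemma tu_unimodular:
  assumes tu: "totally_unimodular n E A"
  shows "unimodular (relations E A)"
  unfolding unimodular_def
proof (intro ballI impI)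
  have fin: "finite E" using tu by (simp add: totally_unimodular_def is_matrix_def)
  interpret relation_space E "relations E A" by (rule relation_space_relations[OF fin])
  fix x assume x: "x \<in> relations E A" "x \<noteq> 0"
  define P where "P = (\<lambda>y. y \<in> relations E A \<and> y \<noteq> 0 \<and> supp y \<subseteq> supp x)"
  define y0 where "y0 = (ARG_MIN (\<lambda>y. card (supp y)) y. P y)"
  have y0: "P y0" "\<And>y. P y \<Longrightarrow> card (supp y0) \<le> card (supp y)"
    using arg_min_nat_lemma[of P x "\<lambda>y. card (supp y)"] x by (auto simp: P_def y0_def)
  from y0(1) have "y0 \<noteq> 0" by (simp add: P_def)
  then obtain e where e: "y0 e \<noteq> 0" by (auto simp: fun_eq_iff)
  \<comment> \<open>The value -1 at \<open>e\<close> makes column \<open>e\<close> equal to the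
    combination of the columns in \<open>I\<close> with coefficients \<open>y\<close>.\<close>
  define y where "y = (- inverse (y0 e)) *\<^sub>R y0"
  have yK: "y \<in> relations E A" using y0(1) scale_mem unfolding y_def P_def by blast
  have ye: "y e = -1" using e by (simp add: y_def)
  have sy: "supp y = supp y0" using e by (auto simp: y_def supp_def)
  define I where "I = supp y - {e}"
  have syE: "supp y \<subseteq> E" using supp_mem[OF yK] .
  then have I: "I \<subseteq> E" "e \<in> E" "e \<in> supp y" using ye by (auto simp: I_def supp_def)
  have finy: "finite (supp y)" using syE fin finite_subset by blast
  have freeI: "free (relations E A) I"
    unfolding free_def
  proof (intro ballI impI, rule ccontr)
    fix z assume z: "z \<in> relations E A" "supp z \<subseteq> I" "z \<noteq> 0"
    then have "card (supp y0) \<le> card (supp z)"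
      using y0(1) sy by (intro y0(2)) (auto simp: P_def I_def)
    moreover have "card (supp z) < card (supp y)"
      by (rule psubset_card_mono[OF finy]) (use z(2) I in \<open>auto simp: I_def\<close>)
    ultimately show False using sy by simp
  qed
  obtain R c where R: "R \<subseteq> {..<n}" "bij_betw c R I" "matrix_minor A R c \<in> {-1, 1}"
    and cramer: "\<forall>x. \<forall>r\<in>R. matrix_minor ((A \<circ> c)(r := \<Sum>b\<in>I. x b *\<^sub>R A b)) R id
      = x (c r) * matrix_minor A R c"
    using tu_coordinates[OF tu I(1) freeI] by (elim exE conjE)
  have "(\<Sum>b\<in>E. y b *\<^sub>R A b) = 0" using yK by (simp add: relations_def)
  moreover have "(\<Sum>b\<in>E. y b *\<^sub>R A b) = (\<Sum>b\<in>insert e I. y b *\<^sub>R A b)"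
    using I fin by (intro sum.mono_neutral_right) (auto simp: I_def supp_def)
  moreover have "e \<notin> I" "finite I" using finy by (auto simp: I_def)
  ultimately have Ae: "(\<Sum>b\<in>I. y b *\<^sub>R A b) = A e" using ye by simp
  have "y g \<in> {-1, 0, 1}" for g
  proof -
    consider "g = e" | "g \<notin> supp y" | "g \<in> I" by (auto simp: I_def)
    then show ?thesis
    proof cases
      case 3
      then obtain r where r: "r \<in> R" "g = c r" using R(2) by (auto simp: bij_betw_def)
      have "(A \<circ> c)(r := A e) = A \<circ> c(r := e)" by auto
      then have eq: "matrix_minor A R (c(r := e)) = y g * matrix_minor A R c"
        using bspec[OF spec[OF cramer, of y] r(1)] r(2) by (simp add: Ae matrix_minor_comp[of A R "c(r := e)"])
      have "inj_on (c(r := e)) R" "(c(r := e)) ` R \<subseteq> E"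
        using R(2) \<open>e \<notin> I\<close> I by (auto simp: bij_betw_def inj_on_def)
      then have "matrix_minor A R (c(r := e)) \<in> {-1, 0, 1}"
        using tu R(1) unfolding totally_unimodular_def by auto
      with eq R(3) show ?thesis by auto
    qed (auto simp: ye supp_def)
  qed
  then show "\<exists>y\<in>relations E A. y \<noteq> 0 \<and> supp y \<subseteq> supp x \<and> range y \<subseteq> {-1, 0, 1}"
  proof (intro bexI[OF _ yK] conjI)
    show "y \<noteq> 0" using ye by auto
    show "supp y \<subseteq> supp x" using sy y0(1) by (simp add: P_def)
  qed auto
qed

text \<open>Shifting the coefficients onto a basis by a real relation leaves the sum of the columns
  unchanged. There Cramer's rule, with a denominator of 1 or -1, makes the coefficients of an
  integral point integral.\<close>

lemma tu_integral:
  assumes tu: "totally_unimodular n E A" and c: "supp c \<subseteq> E"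
    and int: "\<And>i. (\<Sum>e\<in>E. c e *\<^sub>R A e) i \<in> \<int>"
  obtains d :: "'a \<Rightarrow> int" where "supp d \<subseteq> E" "(\<lambda>e. real_of_int (d e)) - c \<in> relations E A"
proof -
  have fin: "finite E" using tu by (simp add: totally_unimodular_def is_matrix_def)
  interpret unimodular_space E "relations E A"
    using relation_space_relations[OF fin] tu_unimodular[OF tu]
    by (simp add: unimodular_space_def unimodular_space_axioms_def)
  obtain B where B: "basis B" using ex_basis[OF free_empty] by blast
  define k where "k = (\<Sum>e\<in>E - B. c e *\<^sub>R fund B e)"
  have kK: "k \<in> relations E A" unfolding k_def using fund(1)[OF B] by (intro sum_mem scale_mem) auto
  define x where "x = c - k"
  have k_off: "k g = c g" if "g \<notin> B" for g
  proof -
    have "k g = (\<Sum>e\<in>E - B. if e = g then c e else 0)"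
      unfolding k_def sum_fun_apply using fund_off[OF B _ that] by (intro sum.cong) auto
    also have "\<dots> = c g" using fin that c by (auto simp: supp_def)
    finally show ?thesis .
  qed
  have sx: "supp x \<subseteq> B" using k_off unfolding x_def supp_def by fastforce
  have BE: "B \<subseteq> E" "free (relations E A) B" using B by (auto simp: basis_def)
  obtain R c' where R: "R \<subseteq> {..<n}" "bij_betw c' R B" "matrix_minor A R c' \<in> {-1, 1}"
    and cramer: "\<forall>x. \<forall>r\<in>R. matrix_minor ((A \<circ> c')(r := \<Sum>b\<in>B. x b *\<^sub>R A b)) R id
      = x (c' r) * matrix_minor A R c'"
    using tu_coordinates[OF tu BE] by (elim exE conjE)
  have "(\<Sum>b\<in>B. x b *\<^sub>R A b) = (\<Sum>b\<in>E. x b *\<^sub>R A b)"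
    using sx BE fin by (intro sum.mono_neutral_left) (auto simp: supp_def)
  also have "\<dots> = (\<Sum>e\<in>E. c e *\<^sub>R A e)"
    using kK by (simp add: x_def relations_def scaleR_diff_left sum_subtractf)
  finally have xb: "(\<Sum>b\<in>B. x b *\<^sub>R A b) i \<in> \<int>" for i using int by simp
  have x_int: "x b \<in> \<int>" for b
  proof (cases "b \<in> B")
    case True
    then obtain r where r: "r \<in> R" "b = c' r" using R(2) by (auto simp: bij_betw_def)
    have "A (c' j) i \<in> \<int>" if "j \<in> R" for i j
    proof -
      have "c' j \<in> E" using that R(2) BE by (auto simp: bij_betw_def)
      from tu_entry[OF tu this, of i] show ?thesis by auto
    qed
    then have "matrix_minor ((A \<circ> c')(r := \<Sum>b\<in>B. x b *\<^sub>R A b)) R id \<in> \<int>"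
      using xb by (intro matrix_minor_Ints) auto
    then have "x b * matrix_minor A R c' \<in> \<int>" using bspec[OF spec[OF cramer, of x] r(1)] r(2) by simp
    with R(3) show ?thesis by auto
  next
    case False
    then have "x b = 0" using sx by (auto simp: supp_def)
    then show ?thesis by simp
  qed
  define d where "d = (\<lambda>b. \<lfloor>x b\<rfloor>)"
  have dx: "real_of_int (d b) = x b" for b using x_int[of b] by (simp add: d_def)
  show thesis
  proof (rule that[of d])
    have "supp d \<subseteq> supp x" by (auto simp: d_def supp_def)
    with sx BE show "supp d \<subseteq> E" by blast
    have "(\<lambda>e. real_of_int (d e)) - c = - k" by (auto simp: dx x_def fun_eq_iff)
    then show "(\<lambda>e. real_of_int (d e)) - c \<in> relations E A"
      using kK subspace_neg[OF subspace] by simp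
  qed
qed

text \<open>This is the standard matrix over a basis. A nonzero minor, completed by unit columns, is
  the determinant of a change between two bases; the inverse change is integral by
  \<open>fund_range\<close> for the new basis, so the determinant is a unit among the integers. It
  takes the place of the known regularity of parallel connections.\<close>

lemma (in unimodular_space) ex_tu:
  obtains n A where "totally_unimodular n E A" "relations E A = K"
proof -
  obtain B where B: "basis B" using ex_basis[OF free_empty] by blast
  have BE: "B \<subseteq> E" using B by (simp add: basis_def)
  have finB: "finite B" using BE finite_E finite_subset by blast
  define n where "n = card B"
  obtain \<beta> where \<beta>: "bij_betw \<beta> {..<n} B"
    using finite_same_card_bij[of "{..<n}" B] finB by (auto simp: n_def)
  have \<beta>B: "\<beta> i \<in> B" if "i < n" for i using \<beta> that by (auto simp: bij_betw_def)
  \<comment> \<open>Unit columns on \<open>B\<close>; the minus sign in the others turns every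
    fundamental relation into a relation among these columns.\<close>
  define A where "A = (\<lambda>e i. if e \<in> E \<and> i < n then
    if e \<in> B then if \<beta> i = e then 1 else 0 else - fund B e (\<beta> i) else (0::real))"
  have A_unit: "A (\<beta> j) = unit_at j 1" if "j < n" for j
  proof
    fix i
    show "A (\<beta> j) i = unit_at j 1 i"
      using that \<beta> \<beta>B[OF that] BE by (auto simp: A_def unit_at_def bij_betw_def inj_on_def)
  qed
  have A_sum: "(\<Sum>e\<in>E. x e *\<^sub>R A e) i = x (\<beta> i) - (\<Sum>e\<in>E - B. x e * fund B e (\<beta> i))"
    if i: "i < n" for x i
  proof -
    have "(\<Sum>e\<in>E. x e * A e i) = (\<Sum>e\<in>B. x e * A e i) + (\<Sum>e\<in>E - B. x e * A e i)"
      using BE finite_E by (simp add: sum.subset_diff)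
    also have "(\<Sum>e\<in>B. x e * A e i) = (\<Sum>e\<in>B. if e = \<beta> i then x e else 0)"
      using BE i by (intro sum.cong) (auto simp: A_def)
    also have "\<dots> = x (\<beta> i)" using finB \<beta>B[OF i] by simp
    also have "(\<Sum>e\<in>E - B. x e * A e i) = (\<Sum>e\<in>E - B. - (x e * fund B e (\<beta> i)))"
      using i by (intro sum.cong) (auto simp: A_def)
    finally show ?thesis by (simp add: sum_fun_apply sum_negf)
  qed
  have A_high: "A e i = 0" if "i \<ge> n" for e i using that by (simp add: A_def)
  have rel: "relations E A = K"
  proof (intro equalityI subsetI)
    fix x assume x: "x \<in> K"
    have "(\<Sum>e\<in>E. x e *\<^sub>R A e) i = 0" for i
    proof (cases "i < n")
      case True
      then show ?thesis
        using A_sum[OF True, of x] fun_cong[OF fund_expansion[OF B x], of "\<beta> i"]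
        by (simp add: sum_fun_apply)
    qed (simp add: sum_fun_apply A_high)
    then show "x \<in> relations E A" using supp_mem[OF x] by (auto simp: relations_def fun_eq_iff)
  next
    fix x assume x: "x \<in> relations E A"
    have "x = (\<Sum>e\<in>E - B. x e *\<^sub>R fund B e)"
    proof
      fix g
      show "x g = (\<Sum>e\<in>E - B. x e *\<^sub>R fund B e) g"
      proof (cases "g \<in> B")
        case True
        then obtain i where i: "i < n" "g = \<beta> i" using \<beta> by (auto simp: bij_betw_def)
        have "(\<Sum>e\<in>E. x e *\<^sub>R A e) = 0" using x by (simp add: relations_def)
        then have "x (\<beta> i) = (\<Sum>e\<in>E - B. x e * fund B e (\<beta> i))"
          using A_sum[OF i(1), of x] by simp
        then show ?thesis using i by (simp add: sum_fun_apply)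
      next
        case False
        have "(\<Sum>e\<in>E - B. x e *\<^sub>R fund B e) g = (\<Sum>e\<in>E - B. if e = g then x e else 0)"
          unfolding sum_fun_apply using False fund_off[OF B] by (intro sum.cong) auto
        also have "\<dots> = x g" using finite_E False x by (auto simp: relations_def supp_def)
        finally show ?thesis by simp
      qed
    qed
    also have "\<dots> \<in> K" using fund(1)[OF B] by (intro sum_mem scale_mem) auto
    finally show "x \<in> K" .
  qed
  have tu: "matrix_minor A R c \<in> {-1, 0, 1}"
    if R: "R \<subseteq> {..<n}" and c: "inj_on c R" "c ` R \<subseteq> E" for R c
  proof (cases "matrix_minor A R c = 0")
    case nz: False
    define d where "d = (\<lambda>j. if j \<in> R then c j else \<beta> j)"
    define V where "V = (\<lambda>j. A (d j))"
    have dE: "d j \<in> E" if "j < n" for j using that c \<beta>B BE by (auto simp: d_def)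
    have "matrix_minor V {..<n} id = matrix_minor V R id"
      using R A_unit by (intro matrix_minor_extend) (auto simp: V_def d_def)
    also have "\<dots> = matrix_minor A R c"
      unfolding matrix_minor_comp[of A] by (intro matrix_minor_cong) (simp add: V_def d_def)
    finally have det: "matrix_minor V {..<n} id = matrix_minor A R c" .
    have V_high: "combination n V v i = 0" if "i \<ge> n" for v i
      using that by (simp add: combination_def sum_fun_apply V_def A_high)
    have ind: "v j = 0" if "combination n V v = 0" "j < n" for v j
      using nz that unfolding det[symmetric] minor_eq_0_iff by auto
    have inj: "inj_on d {..<n}"
    proof (rule inj_onI, rule ccontr)
      fix i j assume ij: "i \<in> {..<n}" "j \<in> {..<n}" "d i = d j" "i \<noteq> j"
      define v where "v = (\<lambda>k. if k = i then 1 else if k = j then -1 else 0 :: real)"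
      have "combination n V v = (\<Sum>k\<in>{i, j}. v k *\<^sub>R V k)"
        unfolding combination_def using ij by (intro sum.mono_neutral_right) (auto simp: v_def)
      also have "\<dots> = 0" using ij by (simp add: v_def V_def)
      finally have "v i = 0" using ind ij by auto
      then show False by (simp add: v_def)
    qed
    have comb: "combination n V (\<lambda>j. x (d j)) = (\<Sum>b\<in>d ` {..<n}. x b *\<^sub>R A b)" for x
      using inj by (simp add: combination_def V_def sum.reindex)
    have dE': "d ` {..<n} \<subseteq> E" using dE by auto
    have free: "free K (d ` {..<n})"
      unfolding free_def
    proof (intro ballI impI ext)
      fix x g assume x: "x \<in> K" "supp x \<subseteq> d ` {..<n}"
      then have "combination n V (\<lambda>j. x (d j)) = 0"
        using relations_iff[OF finite_E dE' x(2), of A] by (simp add: comb rel)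
      from ind[OF this] have "x (d j) = 0" if "j < n" for j using that by simp
      then have "g \<notin> supp x" using x(2) by (auto simp: supp_def)
      then show "x g = 0 g" by (simp add: supp_def)
    qed
    have coord: "\<exists>v. combination n V v = A e" for e
    proof -
      obtain v where v: "\<And>i. i < n \<Longrightarrow> combination n V v i = A e i"
        using ex_combination[of V n "A e"] nz det by metis
      have "combination n V v i = A e i" for i using v V_high A_high by (cases "i < n") auto
      then show ?thesis by blast
    qed
    \<comment> \<open>The coordinates of column \<open>e\<close> in the new basis, subtracted from
      the unit vector at \<open>e\<close>, are a relation, which makes statements about
      \<open>K\<close> available for them.\<close>
    have rel_of_coord: "(\<lambda>g. (if g = e then 1 else 0)
        - (if g \<in> d ` {..<n} then v (inv_into {..<n} d g) else 0)) \<in> K" (is "?x \<in> K")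
      if v: "combination n V v = A e" and e: "e \<in> E" for e v
    proof -
      define y where "y = (\<lambda>g. if g \<in> d ` {..<n} then v (inv_into {..<n} d g) else 0)"
      have "combination n V (\<lambda>j. y (d j)) = combination n V v"
        unfolding combination_def using inj by (intro sum.cong) (auto simp: y_def)
      then have "(\<Sum>b\<in>d ` {..<n}. y b *\<^sub>R A b) = A e" using v by (simp add: comb)
      moreover have "(\<Sum>b\<in>d ` {..<n}. y b *\<^sub>R A b) = (\<Sum>b\<in>E. y b *\<^sub>R A b)"
        using dE' finite_E by (intro sum.mono_neutral_left) (auto simp: y_def)
      moreover have "(\<Sum>b\<in>E. (if b = e then 1 else 0) *\<^sub>R A b) = A e"
      proof -
        have "(\<Sum>b\<in>E. (if b = e then 1 else 0) *\<^sub>R A b) = (\<Sum>b\<in>E. if b = e then A b else 0)"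
          by (intro sum.cong) auto
        then show ?thesis using e finite_E by simp
      qed
      ultimately have "(\<Sum>b\<in>E. ((if b = e then 1 else 0) - y b) *\<^sub>R A b) = 0"
        by (simp add: scaleR_diff_left sum_subtractf)
      then have "(\<Sum>b\<in>E. ?x b *\<^sub>R A b) = 0" unfolding y_def .
      then show ?thesis using e dE' unfolding rel[symmetric] relations_def by (auto simp: supp_def)
    qed
    have B': "basis (d ` {..<n})"
      unfolding basis_def
    proof (intro conjI ballI notI)
      fix e assume e: "e \<in> E - d ` {..<n}" "free K (insert e (d ` {..<n}))"
      obtain v where v: "combination n V v = A e" using coord by blast
      define x where "x = (\<lambda>g. (if g = e then 1 else 0)
        - (if g \<in> d ` {..<n} then v (inv_into {..<n} d g) else 0))"
      have "x \<in> K" unfolding x_def using rel_of_coord[OF v] e by blast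
      moreover have "supp x \<subseteq> insert e (d ` {..<n})" by (auto simp: supp_def x_def)
      ultimately have "x = 0" using e(2) by (auto simp: free_def)
      then have "x e = 0" by simp
      then show False using e(1) by (auto simp: x_def)
    qed (use dE' free in auto)
    have "\<forall>i. \<exists>v. combination n V v = A (\<beta> i)" using coord by blast
    from choice[OF this] obtain w where w: "\<And>i. combination n V (w i) = A (\<beta> i)" by blast
    \<comment> \<open>Off the new basis the relation has entries 0 and 1 only, so its expansion in
      fundamental relations has integral values everywhere. The coordinates \<open>w i\<close> fill
      the columns of the inverse matrix.\<close>
    have w_int: "w i j \<in> \<int>" if "i < n" "j < n" for i j
    proof -
      define x where "x = (\<lambda>g. (if g = \<beta> i then 1 else 0)
        - (if g \<in> d ` {..<n} then w i (inv_into {..<n} d g) else 0))"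
      have xK: "x \<in> K" unfolding x_def using rel_of_coord[OF w] \<beta>B BE that by blast
      have "x g \<in> \<int>" for g
      proof -
        have "x g = (\<Sum>e\<in>E - d ` {..<n}. x e * fund (d ` {..<n}) e g)"
          using fun_cong[OF fund_expansion[OF B' xK], of g] by (simp add: sum_fun_apply)
        also have "\<dots> \<in> \<int>"
        proof (intro Ints_sum Ints_mult)
          fix e assume "e \<in> E - d ` {..<n}"
          then show "fund (d ` {..<n}) e g \<in> \<int>" using fund_range[OF B', of e g] by auto
        qed (auto simp: x_def)
        finally show ?thesis .
      qed
      then have "(if d j = \<beta> i then 1 else 0) - x (d j) \<in> \<int>" by (intro Ints_diff) auto
      moreover have "(if d j = \<beta> i then 1 else 0) - x (d j) = w i j"
        using that inj by (simp add: x_def)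
      ultimately show ?thesis by simp
    qed
    have "columns_mat n V * columns_mat n w = 1\<^sub>m n"
    proof (rule eq_matI)
      fix i j assume "i < dim_row (1\<^sub>m n)" "j < dim_col (1\<^sub>m n)"
      then have ij: "i < n" "j < n" by auto
      then have "(columns_mat n V * columns_mat n w) $$ (i, j) = (\<Sum>k = 0..<n. V k i * w j k)"
        by (simp add: columns_mat_def scalar_prod_def)
      also have "\<dots> = combination n V (w j) i"
        by (simp add: combination_def sum_fun_apply atLeast0LessThan mult.commute)
      also have "\<dots> = unit_at j 1 i" using w[of j] A_unit[OF ij(2)] by simp
      finally show "(columns_mat n V * columns_mat n w) $$ (i, j) = 1\<^sub>m n $$ (i, j)"
        using ij by (simp add: unit_at_def)
    qed (simp_all add: columns_mat_def)
    then have prod: "matrix_minor V {..<n} id * matrix_minor w {..<n} id = 1"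
      using det_mult[of "columns_mat n V" n "columns_mat n w"] by (simp add: det_columns_mat)
    have "matrix_minor w {..<n} id \<in> \<int>" using w_int by (intro matrix_minor_Ints) auto
    moreover have "matrix_minor V {..<n} id \<in> \<int>"
    proof (intro matrix_minor_Ints)
      fix i j assume "j \<in> {..<n}" "i \<in> {..<n}"
      then have "d j \<in> E" using dE by simp
      then show "V j i \<in> \<int>"
        using fund_range[OF B, of "d j" "\<beta> i"] by (auto simp: V_def A_def)
    qed
    ultimately obtain a b :: int where ab: "matrix_minor V {..<n} id = a" "matrix_minor w {..<n} id = b"
      by (auto elim!: Ints_cases)
    then have "real_of_int (a * b) = 1" using prod by simp
    then have "a * b = 1" by linarith
    then have "a = 1 \<or> a = -1" by (auto simp: zmult_eq_1_iff)
    then show ?thesis using ab det by auto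
  qed simp
  have "totally_unimodular n E A"
    unfolding totally_unimodular_def is_matrix_def using finite_E A_high tu by auto
  with rel that show ?thesis by blast
qed


subsection \<open>The $h^*$-polynomial in terms of cosets\<close>

text \<open>The polytope is the linear image of the cross-polytope. For empty \<open>E\<close> the
  hull would be empty while the right side is \<open>{0}\<close>.\<close>

lemma convex_hull_symmetric:
  fixes A :: "'a \<Rightarrow> nat \<Rightarrow> real"
  assumes fin: "finite E" and ne: "E \<noteq> {}"
  shows "convex hull (A ` E \<union> (\<lambda>e. - A e) ` E) = {\<Sum>e\<in>E. c e *\<^sub>R A e | c. (\<Sum>e\<in>E. \<bar>c e\<bar>) \<le> 1}"
    (is "?H = ?S")
proof
  show "?H \<subseteq> ?S"
  proof (rule hull_minimal)
    show "A ` E \<union> (\<lambda>e. - A e) ` E \<subseteq> ?S"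
    proof
      fix x assume "x \<in> A ` E \<union> (\<lambda>e. - A e) ` E"
      then obtain e s where e: "e \<in> E" "x = s *\<^sub>R A e" "\<bar>s\<bar> = 1"
        by (elim UnE imageE) (metis abs_1 scaleR_one, metis abs_1 abs_minus_cancel scaleR_minus1_left)
      have "(\<Sum>g\<in>E. (if g = e then s else 0) *\<^sub>R A g) = (\<Sum>g\<in>E. if g = e then s *\<^sub>R A g else 0)"
        by (intro sum.cong) auto
      also have "\<dots> = x" using e fin by simp
      finally have "x = (\<Sum>g\<in>E. (if g = e then s else 0) *\<^sub>R A g)" by simp
      moreover have "(\<Sum>g\<in>E. \<bar>if g = e then s else 0\<bar>) = (\<Sum>g\<in>E. if g = e then \<bar>s\<bar> else 0)"
        by (intro sum.cong) auto
      then have "(\<Sum>g\<in>E. \<bar>if g = e then s else 0\<bar>) \<le> 1" using e fin by simp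
      ultimately show "x \<in> ?S"
        by (intro CollectI exI[of _ "\<lambda>g. if g = e then s else 0"] conjI)
    qed
    show "convex ?S"
    proof (rule convexI)
      fix x y and u v :: real
      assume "x \<in> ?S" "y \<in> ?S" and uv: "0 \<le> u" "0 \<le> v" "u + v = 1"
      then obtain c d where c: "x = (\<Sum>e\<in>E. c e *\<^sub>R A e)" "(\<Sum>e\<in>E. \<bar>c e\<bar>) \<le> 1"
        and d: "y = (\<Sum>e\<in>E. d e *\<^sub>R A e)" "(\<Sum>e\<in>E. \<bar>d e\<bar>) \<le> 1" by auto
      have "u *\<^sub>R x + v *\<^sub>R y = (\<Sum>e\<in>E. (u * c e + v * d e) *\<^sub>R A e)"
        by (simp add: c d scaleR_sum_right scaleR_add_left sum.distrib)
      moreover have "(\<Sum>e\<in>E. \<bar>u * c e + v * d e\<bar>) \<le> (\<Sum>e\<in>E. u * \<bar>c e\<bar> + v * \<bar>d e\<bar>)"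
      proof (rule sum_mono)
        fix e
        have "\<bar>u * c e + v * d e\<bar> \<le> \<bar>u * c e\<bar> + \<bar>v * d e\<bar>" by (rule abs_triangle_ineq)
        then show "\<bar>u * c e + v * d e\<bar> \<le> u * \<bar>c e\<bar> + v * \<bar>d e\<bar>" using uv by (simp add: abs_mult)
      qed
      moreover have "\<dots> = u * (\<Sum>e\<in>E. \<bar>c e\<bar>) + v * (\<Sum>e\<in>E. \<bar>d e\<bar>)"
        by (simp add: sum.distrib sum_distrib_left)
      moreover have "\<dots> \<le> u * 1 + v * 1" using uv c d by (intro add_mono mult_left_mono)
      ultimately show "u *\<^sub>R x + v *\<^sub>R y \<in> ?S" using uv by (intro CollectI exI conjI) auto
    qed
  qed
  show "?S \<subseteq> ?H"
  proof
    fix x assume "x \<in> ?S"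
    then obtain c where c: "x = (\<Sum>e\<in>E. c e *\<^sub>R A e)" "(\<Sum>e\<in>E. \<bar>c e\<bar>) \<le> 1" by auto
    define s where "s = (\<Sum>e\<in>E. \<bar>c e\<bar>)"
    have s0: "s \<ge> 0" by (simp add: s_def sum_nonneg)
    have gen: "A e \<in> ?H" "- A e \<in> ?H" if "e \<in> E" for e using that by (auto intro!: hull_inc)
    obtain e0 where e0: "e0 \<in> E" using ne by auto
    have "(1/2) *\<^sub>R A e0 + (1/2) *\<^sub>R (- A e0) \<in> ?H"
      by (rule convexD[OF convex_convex_hull]) (use gen[OF e0] in auto)
    then have zero: "0 \<in> ?H" by simp
    show "x \<in> ?H"
    proof (cases "s = 0")
      case True
      then have "c e = 0" if "e \<in> E" for e
        using that fin sum_nonneg_eq_0_iff[of E "\<lambda>e. \<bar>c e\<bar>"] by (simp add: s_def)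
      then have "x = 0" by (simp add: c)
      with zero show ?thesis by simp
    next
      case False
      \<comment> \<open>Normalizing the weights gives a genuine convex combination of the
        generators; the slack \<open>1 - s\<close> is then spent on 0.\<close>
      define y where "y = (\<Sum>e\<in>E. (\<bar>c e\<bar> / s) *\<^sub>R (if c e \<ge> 0 then A e else - A e))"
      have "y \<in> ?H"
        unfolding y_def
      proof (rule convex_sum[OF fin convex_convex_hull])
        show "(\<Sum>e\<in>E. \<bar>c e\<bar> / s) = 1" using False by (simp add: s_def flip: sum_divide_distrib)
      qed (use gen s0 in auto)
      moreover have "x = s *\<^sub>R y"
        unfolding c y_def scaleR_sum_right using False by (intro sum.cong) auto
      then have "x = s *\<^sub>R y + (1 - s) *\<^sub>R 0" by simp
      moreover have "s \<le> 1" using c by (simp add: s_def)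
      ultimately show ?thesis
        using convexD[OF convex_convex_hull, of y _ 0 s "1 - s"] zero s0 by auto
    qed
  qed
qed

lemma l1_norm_eq_0: "finite (supp c) \<Longrightarrow> l1_norm c = 0 \<Longrightarrow> c = 0"
  by (auto simp: l1_norm_def supp_def fun_eq_iff)

text \<open>The map \<open>val\<close> identifies cosets with points. A lattice point of the
  dilation has real coefficients of norm at most \<open>m\<close>; \<open>tu_integral\<close> finds
  integral ones, and \<open>integral_reduction\<close> brings them back within the bound.\<close>

lemma lattice_count_hull:
  assumes tu: "totally_unimodular n E A" and ne: "E \<noteq> {}"
  shows "lattice_count (convex hull (A ` E \<union> (\<lambda>e. - A e) ` E)) m
    = coset_count E (int_relations (relations E A)) m" (is "lattice_count ?H m = _")
proof -
  have fin: "finite E" using tu by (simp add: totally_unimodular_def is_matrix_def)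
  interpret unimodular_space E "relations E A"
    using relation_space_relations[OF fin] tu_unimodular[OF tu]
    by (simp add: unimodular_space_def unimodular_space_axioms_def)
  let ?\<Lambda> = "int_relations (relations E A)"
  define U where "U = {c. supp c \<subseteq> E \<and> l1_norm c \<le> m}"
  define val where "val = (\<lambda>c. \<Sum>e\<in>E. real_of_int (c e) *\<^sub>R A e)"
  have val_eq: "c - d \<in> ?\<Lambda> \<longleftrightarrow> val c = val d" if "supp c \<subseteq> E" "supp d \<subseteq> E" for c d
  proof -
    have s: "supp (\<lambda>e. real_of_int ((c - d) e)) \<subseteq> E" using that supp_diff[of c d] by (auto simp: supp_def)
    have "c - d \<in> ?\<Lambda> \<longleftrightarrow> (\<Sum>e\<in>E. real_of_int ((c - d) e) *\<^sub>R A e) = 0"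
      using relations_iff[OF fin subset_refl s] by (simp only: int_relations_def mem_Collect_eq)
    also have "(\<Sum>e\<in>E. real_of_int ((c - d) e) *\<^sub>R A e) = val c - val d"
      by (simp add: val_def scaleR_diff_left sum_subtractf)
    finally show ?thesis by (simp only: right_minus_eq)
  qed
  have count: "coset_count E ?\<Lambda> m = card (val ` U)"
    unfolding coset_count_def U_def[symmetric]
  proof (rule card_image_eq_fibres)
    fix c d assume "c \<in> U" "d \<in> U"
    then show "coset ?\<Lambda> c = coset ?\<Lambda> d \<longleftrightarrow> val c = val d"
      using val_eq by (simp add: U_def int.coset_eq_iff)
  qed
  show ?thesis
  proof (cases "m = 0")
    \<comment> \<open>The count at 0 is 1 by convention, in agreement with a ball of radius 0 that
      contains only the zero vector.\<close>
    case True
    have "U = {0}"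
    proof (intro equalityI subsetI)
      fix c assume "c \<in> U"
      then have "supp c \<subseteq> E" "l1_norm c = 0" using True by (auto simp: U_def)
      then show "c \<in> {0}" using l1_norm_eq_0[OF int.finite_supp] by simp
    qed (auto simp: U_def supp_def l1_norm_def)
    then show ?thesis using True count by (simp add: lattice_count_def)
  next
    case False
    have "{x \<in> (\<lambda>v. real m *\<^sub>R v) ` ?H. \<forall>i. x i \<in> \<int>} = val ` U"
    proof (intro equalityI subsetI)
      fix x assume "x \<in> {x \<in> (\<lambda>v. real m *\<^sub>R v) ` ?H. \<forall>i. x i \<in> \<int>}"
      then obtain y where y: "y \<in> ?H" "x = real m *\<^sub>R y" and int: "\<And>i. x i \<in> \<int>" by blast
      from y(1) obtain c where "y = (\<Sum>e\<in>E. c e *\<^sub>R A e)" and c1: "(\<Sum>e\<in>E. \<bar>c e\<bar>) \<le> 1"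
        unfolding convex_hull_symmetric[OF fin ne] by blast
      with y(2) have "x = real m *\<^sub>R (\<Sum>e\<in>E. c e *\<^sub>R A e)" by simp
      note c = this c1
      define c' where "c' = (\<lambda>e. if e \<in> E then real m * c e else 0)"
      have s: "supp c' \<subseteq> E" by (auto simp: c'_def supp_def)
      have x: "x = (\<Sum>e\<in>E. c' e *\<^sub>R A e)" by (simp add: c c'_def scaleR_sum_right)
      have "(\<Sum>e\<in>E. \<bar>c' e\<bar>) = real m * (\<Sum>e\<in>E. \<bar>c e\<bar>)"
        by (simp add: c'_def abs_mult sum_distrib_left)
      also have "\<dots> \<le> real m" using c(2) by (simp add: mult_left_le)
      finally have c'm: "(\<Sum>e\<in>E. \<bar>c' e\<bar>) \<le> real m" .
      obtain d where d: "supp d \<subseteq> E" "(\<lambda>e. real_of_int (d e)) - c' \<in> relations E A"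
        using tu_integral[OF tu s] int unfolding x by blast
      obtain d' where d': "d' - d \<in> ?\<Lambda>" "real (l1_norm d') \<le> (\<Sum>e\<in>E. \<bar>c' e\<bar>)"
        using integral_reduction[OF s d] .
      have sd': "supp d' \<subseteq> E" by (rule int.supp_coset[OF d'(1) d(1)])
      have "val d' = val d" using d'(1) val_eq[OF sd' d(1)] by simp
      also have "\<dots> = x"
        using d(2) by (simp add: relations_def val_def x scaleR_diff_left sum_subtractf)
      finally have "x = val d'" ..
      moreover have "d' \<in> U" using d'(2) c'm sd' by (simp add: U_def)
      ultimately show "x \<in> val ` U" by blast
    next
      fix x assume "x \<in> val ` U"
      then obtain c where c: "x = val c" "supp c \<subseteq> E" "l1_norm c \<le> m" by (auto simp: U_def)
      have "x = real m *\<^sub>R (\<Sum>e\<in>E. (real_of_int (c e) / real m) *\<^sub>R A e)"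
        using False by (simp add: c val_def scaleR_sum_right)
      moreover have "(\<Sum>e\<in>E. \<bar>real_of_int (c e) / real m\<bar>) \<le> 1"
      proof -
        have "(\<Sum>e\<in>E. \<bar>real_of_int (c e) / real m\<bar>) = real (l1_norm c) / real m"
          by (simp add: l1_norm_eq[OF fin c(2)] flip: sum_divide_distrib)
        also have "\<dots> \<le> 1" using c(3) False by simp
        finally show ?thesis .
      qed
      moreover have "x i \<in> \<int>" for i
        unfolding c val_def sum_fun_apply
      proof (intro Ints_sum)
        fix e assume "e \<in> E"
        from tu_entry[OF tu this, of i] show "(real_of_int (c e) *\<^sub>R A e) i \<in> \<int>" by auto
      qed
      ultimately show "x \<in> {x \<in> (\<lambda>v. real m *\<^sub>R v) ` ?H. \<forall>i. x i \<in> \<int>}"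
        unfolding convex_hull_symmetric[OF fin ne]
        by (intro CollectI conjI allI image_eqI[of x] exI[of _ "\<lambda>e. real_of_int (c e) / real m"])
          (assumption | rule refl)+
    qed
    then show ?thesis using False count by (simp add: lattice_count_def)
  qed
qed

text \<open>As 0 lies in the hull, the differences of its points span the same space as the
  columns.\<close>

lemma polytope_dim_hull:
  assumes fin: "finite E" and ne: "E \<noteq> {}" and B: "relation_space.basis E (relations E A) B"
  shows "polytope_dim (convex hull (A ` E \<union> (\<lambda>e. - A e) ` E)) = card B" (is "polytope_dim ?H = _")
proof -
  interpret relation_space E "relations E A" by (rule relation_space_relations[OF fin])
  have B': "B \<subseteq> E" "free (relations E A) B" using B by (auto simp: basis_def)
  have AB: "inj_on A B" "independent (A ` B)" using free_relations_iff[OF fin B'(1)] B'(2) by auto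
  let ?D = "{x - y | x y. x \<in> ?H \<and> y \<in> ?H}"
  have inB: "A e \<in> span (A ` B)" if e: "e \<in> E" for e
  proof (cases "e \<in> B")
    case True then show ?thesis by (simp add: span_base)
  next
    case False
    then have eB: "e \<in> E - B" using e by simp
    note f = fund[OF B eB]
    have "(\<Sum>g\<in>E. fund B e g *\<^sub>R A g) = 0" using f(1) by (simp add: relations_def)
    moreover have "(\<Sum>g\<in>E. fund B e g *\<^sub>R A g) = (\<Sum>g\<in>insert e B. fund B e g *\<^sub>R A g)"
      using f(3) B'(1) e fin by (intro sum.mono_neutral_right) (auto simp: supp_def)
    moreover have "finite B" using B'(1) fin finite_subset by blast
    ultimately have "A e = - (\<Sum>g\<in>B. fund B e g *\<^sub>R A g)"
      using False f(2) by (simp add: add_eq_0_iff)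
    also have "\<dots> \<in> span (A ` B)" by (intro span_neg span_sum span_scale span_base imageI)
    finally show ?thesis .
  qed
  have H_span: "?H \<subseteq> span (A ` B)"
    unfolding convex_hull_symmetric[OF fin ne] using inB by (auto intro!: span_sum span_scale)
  have zero: "0 \<in> ?H"
    unfolding convex_hull_symmetric[OF fin ne] by (intro CollectI exI[of _ "\<lambda>_. 0"]) simp
  have "?D \<subseteq> span (A ` B)" using H_span by (auto intro!: span_diff)
  then have 1: "span ?D \<subseteq> span (A ` B)" by (rule span_minimal) simp
  have "A ` B \<subseteq> ?D"
  proof
    fix x assume "x \<in> A ` B"
    then have "x \<in> ?H" using B'(1) by (intro hull_inc) auto
    then have "x - 0 \<in> ?D" using zero by blast
    then show "x \<in> ?D" by simp
  qed
  then have "span (A ` B) = span ?D" using 1 span_mono by blast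
  from dim_eq_card[OF this AB(2)] show ?thesis
    unfolding polytope_dim_def by (simp add: card_image[OF AB(1)])
qed

context unimodular_space
begin

lemma symmetric_edge_polytope_eq:
  assumes ne: "E \<noteq> {}"
  obtains n A where "tu_represents n A (relation_matroid E K)"
    "\<Sigma> (relation_matroid E K) = convex hull (A ` E \<union> (\<lambda>e. - A e) ` E)"
proof -
  let ?M = "relation_matroid E K"
  have g: "ground ?M = E" by (simp add: relation_matroid_def)
  define A where "A = (SOME A. \<exists>n. tu_represents n A ?M)"
  obtain n0 A0 where A0: "totally_unimodular n0 E A0" "relations E A0 = K" by (rule ex_tu)
  then have "tu_represents n0 A0 ?M"
    unfolding tu_represents_def g vector_matroid_eq[OF finite_E] by simp
  then have "\<exists>A n. tu_represents n A ?M" by blast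
  then have "\<exists>n. tu_represents n A ?M" unfolding A_def by (rule someI_ex)
  then obtain n where n: "tu_represents n A ?M" by blast
  have "\<Sigma> ?M = convex hull (A ` E \<union> (\<lambda>e. - A e) ` E)"
  proof (cases "matroid_rank ?M = 0")
    case False
    then show ?thesis by (simp add: symmetric_edge_polytope_def g A_def Let_def)
  next
    \<comment> \<open>In rank 0 all columns vanish, so the hull over the nonempty \<open>E\<close>
      is \<open>{0}\<close>, the value fixed by convention.\<close>
    case True
    have M: "?M = vector_matroid E A" using n by (simp add: tu_represents_def g)
    have fin: "finite (indeps ?M)"
      by (rule finite_subset[of _ "Pow E"]) (auto simp: relation_matroid_def finite_E)
    have "A e = 0" if "e \<in> E" for e
    proof (rule ccontr)
      assume "A e \<noteq> 0"
      then have "{e} \<in> indeps ?M" unfolding M vector_matroid_def using that by simp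
      then have "card {e} \<le> matroid_rank ?M"
        unfolding matroid_rank_def using fin by (intro Max_ge finite_imageI imageI)
      with True show False by simp
    qed
    then have "(\<Sum>e\<in>E. c e *\<^sub>R A e) = 0" for c by simp
    moreover have "(\<Sum>e\<in>E. \<bar>(\<lambda>_. 0 :: real) e\<bar>) \<le> 1" by simp
    ultimately have "{\<Sum>e\<in>E. c e *\<^sub>R A e | c. (\<Sum>e\<in>E. \<bar>c e\<bar>) \<le> 1} = {0}"
      by (auto intro!: exI[of _ "\<lambda>_. 0"])
    then show ?thesis using True by (simp add: symmetric_edge_polytope_def convex_hull_symmetric[OF finite_E ne])
  qed
  with n that show ?thesis by blast
qed

text \<open>Of the \<open>card B + 1\<close> factors in the definition, one passes from balls to
  shells, which leaves the exponent \<open>card B\<close>.\<close>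

theorem hstar_eq:
  assumes ne: "E \<noteq> {}" and B: "basis B"
  shows "hstar (\<Sigma> (relation_matroid E K))
    = Abs_fps (\<lambda>m. of_nat (card (shell E (int_relations K) m))) * (1 - fps_X) ^ card B"
proof -
  obtain n A where A: "tu_represents n A (relation_matroid E K)"
    and \<Sigma>: "\<Sigma> (relation_matroid E K) = convex hull (A ` E \<union> (\<lambda>e. - A e) ` E)"
    using symmetric_edge_polytope_eq[OF ne] .
  have tu: "totally_unimodular n E A" and M: "relation_matroid E K = relation_matroid E (relations E A)"
    using A by (auto simp: tu_represents_def vector_matroid_eq[OF finite_E] relation_matroid_def)
  interpret A: unimodular_space E "relations E A"
    using relation_space_relations[OF finite_E] tu_unimodular[OF tu]
    by (simp add: unimodular_space_def unimodular_space_axioms_def)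
  interpret same_matroid E K "relations E A"
  proof
    fix I assume "I \<subseteq> E"
    then show "free K I \<longleftrightarrow> free (relations E A) I"
      using arg_cong[OF M, of indeps] by (auto simp: relation_matroid_def)
  qed
  have "A.basis B" using B basis_iff by simp
  then have "polytope_dim (\<Sigma> (relation_matroid E K)) = card B"
    unfolding \<Sigma> by (rule polytope_dim_hull[OF finite_E ne])
  moreover have "lattice_count (\<Sigma> (relation_matroid E K)) m = coset_count E (int_relations K) m" for m
    unfolding \<Sigma> lattice_count_hull[OF tu ne] coset_count_eq ..
  ultimately show ?thesis
    unfolding hstar_def by (simp add: mult.assoc[symmetric] int.coset_count_fps)
qed

end


subsection \<open>Parallel connections\<close>

context relation_space
begin

lemma ground_matroid: "ground (relation_matroid E K) = E"
  and indeps_matroid: "indeps (relation_matroid E K) = {I. I \<subseteq> E \<and> free K I}"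
  by (simp_all add: relation_matroid_def)

lemma minimal_support:
  assumes "P x"
  obtains y where "P y" "\<And>z. P z \<Longrightarrow> card (supp y) \<le> card (supp (z :: 'a \<Rightarrow> real))"
  using ex_has_least_nat[of P x "\<lambda>y. card (supp y)"] assms by blast

lemma finite_supp: "x \<in> K \<Longrightarrow> finite (supp x)"
  using supp_mem finite_E finite_subset by blast

lemma circuit_in_dependent:
  assumes "I \<subseteq> E" "\<not> free K I"
  obtains C where "C \<in> circuits (relation_matroid E K)" "C \<subseteq> I"
proof -
  define P where "P = (\<lambda>y. y \<in> K \<and> y \<noteq> 0 \<and> supp y \<subseteq> I)"
  obtain x where x: "P x" using assms(2) unfolding free_def P_def by blast
  obtain y where y: "P y" and min: "\<And>z. P z \<Longrightarrow> card (supp y) \<le> card (supp z)"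
    by (rule minimal_support[of P x, OF x]) blast
  have yK: "y \<in> K" "y \<noteq> 0" "supp y \<subseteq> I" using y by (auto simp: P_def)
  have "free K D" if D: "D \<subset> supp y" for D
    unfolding free_def
  proof (intro ballI impI, rule ccontr)
    fix z assume z: "z \<in> K" "supp z \<subseteq> D" "z \<noteq> 0"
    then have "P z" using D yK by (auto simp: P_def)
    moreover have "card (supp z) < card (supp y)"
      by (rule psubset_card_mono[OF finite_supp[OF yK(1)]]) (use z D in auto)
    ultimately show False using min[of z] by simp
  qed
  moreover have "\<not> free K (supp y)" using yK unfolding free_def by blast
  ultimately have "supp y \<in> circuits (relation_matroid E K)"
    using yK assms(1) unfolding circuits_def ground_matroid indeps_matroid by auto
  with yK that show ?thesis by blast
qed

lemma circuit_vector:
  assumes "C \<in> circuits (relation_matroid E K)"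
  obtains x where "x \<in> K" "supp x = C" "x \<noteq> 0"
proof -
  have C: "C \<subseteq> E" "\<not> free K C" "\<And>D. D \<subset> C \<Longrightarrow> free K D"
    using assms unfolding circuits_def ground_matroid indeps_matroid by auto
  obtain x where x: "x \<in> K" "supp x \<subseteq> C" "x \<noteq> 0" using C(2) unfolding free_def by blast
  have "supp x = C"
  proof (rule ccontr)
    assume "supp x \<noteq> C"
    then have "free K (supp x)" using x(2) by (intro C(3)) auto
    with x show False unfolding free_def by blast
  qed
  with x that show ?thesis by blast
qed

lemma loop_iff: "loop (relation_matroid E K) p \<longleftrightarrow> p \<in> E \<and> \<not> free K {p}"
proof -
  have "D \<subset> {p} \<Longrightarrow> D = {}" for D by auto
  then show ?thesis
    unfolding loop_def circuits_def ground_matroid indeps_matroid using free_empty by auto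
qed

lemma basis_in_bases: "basis B \<Longrightarrow> B \<in> bases (relation_matroid E K)"
  unfolding bases_def indeps_matroid
proof (intro CollectI conjI ballI impI)
  fix J assume B: "basis B" and J: "J \<in> {I. I \<subseteq> E \<and> free K I}" "B \<subseteq> J"
  show "J = B"
  proof (rule ccontr)
    assume "J \<noteq> B"
    then obtain e where "e \<in> J - B" using J by auto
    then have "\<not> free K (insert e B)" using B J by (auto simp: basis_def)
    moreover have "free K (insert e B)"
      by (rule free_subset[of J]) (use J \<open>e \<in> J - B\<close> in auto)
    ultimately show False by simp
  qed
qed (auto simp: basis_def)

text \<open>If a relation involves \<open>p\<close>, one of minimal support among these has a free
  rest, which extends to a basis. A coloop lies in that basis too, which then contains the whole
  support of a nonzero relation.\<close>

lemma coloop_zero: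
  assumes "coloop (relation_matroid E K) p" "x \<in> K"
  shows "x p = 0"
proof (rule ccontr)
  assume "x p \<noteq> 0"
  define P where "P = (\<lambda>y. y \<in> K \<and> y p \<noteq> 0)"
  have x: "P x" using assms(2) \<open>x p \<noteq> 0\<close> by (simp add: P_def)
  obtain y where y: "P y" and min: "\<And>z. P z \<Longrightarrow> card (supp y) \<le> card (supp z)"
    by (rule minimal_support[of P x, OF x]) blast
  have yK: "y \<in> K" "y p \<noteq> 0" using y by (auto simp: P_def)
  have "free K (supp y - {p})"
    unfolding free_def
  proof (intro ballI impI, rule ccontr)
    fix z assume z: "z \<in> K" "supp z \<subseteq> supp y - {p}" "z \<noteq> 0"
    then obtain g where g: "z g \<noteq> 0" by (auto simp: fun_eq_iff)
    \<comment> \<open>The coordinate at \<open>g\<close> is cleared while the one at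
      \<open>p\<close> survives, because \<open>z\<close> vanishes there.\<close>
    define w where "w = y - (y g / z g) *\<^sub>R z"
    have "z p = 0" using z(2) by (auto simp: supp_def)
    then have "P w" using yK z(1) by (auto simp: P_def w_def intro!: diff_mem scale_mem)
    moreover have "supp w \<subset> supp y"
    proof
      show "supp w \<subseteq> supp y" using z(2) by (auto simp: w_def supp_def)
      have "g \<in> supp y" "g \<notin> supp w" using z(2) g by (auto simp: w_def supp_def)
      then show "supp w \<noteq> supp y" by blast
    qed
    then have "card (supp w) < card (supp y)" by (rule psubset_card_mono[OF finite_supp[OF yK(1)]])
    ultimately show False using min[of w] by simp
  qed
  moreover have "supp y - {p} \<subseteq> E" using supp_mem[OF yK(1)] by auto
  ultimately obtain B where B: "basis B" "supp y - {p} \<subseteq> B" by (rule ex_basis)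
  have "p \<in> B" using assms(1) basis_in_bases[OF B(1)] by (auto simp: coloop_def)
  with B have "supp y \<subseteq> B" "free K B" by (auto simp: basis_def)
  then have "y = 0" using yK(1) unfolding free_def by blast
  with yK show False by simp
qed

end

section \<open>Sums of unimodular spaces that meet in one coordinate\<close>

definition sum_space :: "('a \<Rightarrow> real) set \<Rightarrow> ('a \<Rightarrow> real) set \<Rightarrow> ('a \<Rightarrow> real) set"
  where "sum_space K L = {x + y | x y. x \<in> K \<and> y \<in> L}"

text \<open>
  Adding the relation spaces identifies the two copies of \<open>p\<close>.  This represents the parallel
  connection in all the cases of its definition, including that of a loop \<open>p\<close> of the second
  matroid.
\<close>

locale glued_spaces =
  k1: unimodular_space E1 K1 + k2: unimodular_space E2 K2 for E1 E2 :: "'a set" and K1 K2 +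
  fixes p :: 'a
  assumes inter: "E1 \<inter> E2 = {p}" and nonloop: "free K1 {p}"
begin

abbreviation K :: "('a \<Rightarrow> real) set" where "K \<equiv> sum_space K1 K2"

lemma KI: "x \<in> K1 \<Longrightarrow> y \<in> K2 \<Longrightarrow> x + y \<in> K"
  by (auto simp: sum_space_def)

lemma KE:
  assumes "z \<in> K"
  obtains x y where "z = x + y" "x \<in> K1" "y \<in> K2"
  using assms by (auto simp: sum_space_def)

lemma K1_sub: "x \<in> K1 \<Longrightarrow> x \<in> K"
  using KI[of x 0] k2.zero_mem by simp

lemma K2_sub: "x \<in> K2 \<Longrightarrow> x \<in> K"
  using KI[of 0 x] k1.zero_mem by simp

lemma p_in: "p \<in> E1" "p \<in> E2" using inter by auto

lemma off1: "x \<in> K1 \<Longrightarrow> e \<notin> E1 \<Longrightarrow> x e = 0"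
  using k1.supp_mem[of x] by (auto simp: supp_def)

lemma off2: "x \<in> K2 \<Longrightarrow> e \<notin> E2 \<Longrightarrow> x e = 0"
  using k2.supp_mem[of x] by (auto simp: supp_def)

text \<open>Away from \<open>p\<close> the two summands occupy different coordinates, so nothing can
  cancel there.\<close>

lemma supp1:
  assumes "x \<in> K1" "y \<in> K2" "supp (x + y) \<subseteq> I" "e \<in> supp x" "e \<noteq> p"
  shows "e \<in> I \<inter> E1"
proof -
  have "e \<in> E1" using k1.supp_mem assms by auto
  then have "e \<notin> E2" using inter assms by auto
  then have "(x + y) e = x e" using off2 assms by simp
  then have "e \<in> supp (x + y)" using assms(4) by (simp add: supp_def)
  with assms \<open>e \<in> E1\<close> show ?thesis by auto
qed

lemma supp2:
  assumes "x \<in> K1" "y \<in> K2" "supp (x + y) \<subseteq> I" "e \<in> supp y" "e \<noteq> p"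
  shows "e \<in> I \<inter> E2"
proof -
  have "e \<in> E2" using k2.supp_mem assms by auto
  then have "e \<notin> E1" using inter assms by auto
  then have "(x + y) e = y e" using off1 assms by simp
  then have "e \<in> supp (x + y)" using assms(4) by (simp add: supp_def)
  with assms \<open>e \<in> E2\<close> show ?thesis by auto
qed

lemma only_p: "x \<in> K1 \<Longrightarrow> supp x \<subseteq> {p} \<Longrightarrow> x = 0"
  using nonloop by (auto simp: free_def)

lemma relation_space_K: "relation_space (E1 \<union> E2) K"
proof
  show "finite (E1 \<union> E2)" using k1.finite_E k2.finite_E by simp
  show "subspace K"
  proof (rule subspaceI)
    show "0 \<in> K" by (rule K1_sub[OF k1.zero_mem])
  next
    fix z c assume "z \<in> K"
    then obtain x y where xy: "z = x + y" "x \<in> K1" "y \<in> K2" by (rule KE)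
    then show "c *\<^sub>R z \<in> K" using KI[OF k1.scale_mem k2.scale_mem] by (simp add: scaleR_add_right)
  next
    fix z z' assume "z \<in> K" "z' \<in> K"
    obtain x y where xy: "z = x + y" "x \<in> K1" "y \<in> K2" using \<open>z \<in> K\<close> by (rule KE)
    obtain x' y' where xy': "z' = x' + y'" "x' \<in> K1" "y' \<in> K2" using \<open>z' \<in> K\<close> by (rule KE)
    have "(x + x') + (y + y') \<in> K" using xy xy' by (intro KI k1.add_mem k2.add_mem)
    then show "z + z' \<in> K" using xy(1) xy'(1) by (simp add: algebra_simps)
  qed
  show "supp z \<subseteq> E1 \<union> E2" if z: "z \<in> K" for z
  proof -
    obtain x y where xy: "z = x + y" "x \<in> K1" "y \<in> K2" using z by (rule KE)
    then show ?thesis using supp_add[of x y] k1.supp_mem k2.supp_mem by blast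
  qed
qed

lemma unimodular_K: "unimodular K"
  unfolding unimodular_def
proof (intro ballI impI)
  fix z assume "z \<in> K" "z \<noteq> 0"
  then obtain x y where xy: "z = x + y" "x \<in> K1" "y \<in> K2" by (elim KE)
  have uni1: "\<exists>v\<in>K1. v \<noteq> 0 \<and> supp v \<subseteq> supp x \<and> range v \<subseteq> {-1, 0, 1}" if "x \<noteq> 0"
    using k1.unimodular xy that unfolding unimodular_def by blast
  have uni2: "\<exists>v\<in>K2. v \<noteq> 0 \<and> supp v \<subseteq> supp y \<and> range v \<subseteq> {-1, 0, 1}" if "y \<noteq> 0"
    using k2.unimodular xy that unfolding unimodular_def by blast
  have s1: "e \<in> supp z" if "e \<in> supp x" "e \<noteq> p" for e
    using supp1[OF xy(2,3), of "supp z" e] that xy(1) by auto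
  have s2: "e \<in> supp z" if "e \<in> supp y" "e \<noteq> p" for e
    using supp2[OF xy(2,3), of "supp z" e] that xy(1) by auto
  \<comment> \<open>Unless \<open>x\<close> and \<open>y\<close> cancel at \<open>p\<close>, a
    nonzero \<open>x\<close> keeps its support within that of \<open>z\<close>, and
    \<open>z = y\<close> otherwise; one summand then suffices. In the remaining case signed vectors
    of both spaces may have to be combined.\<close>
  show "\<exists>v\<in>K. v \<noteq> 0 \<and> supp v \<subseteq> supp z \<and> range v \<subseteq> {-1, 0, 1}"
  proof (cases "p \<in> supp z \<or> x p = 0")
    case True
    show ?thesis
    proof (cases "x = 0")
      case True
      then show ?thesis using uni2 xy \<open>z \<noteq> 0\<close> K2_sub by (metis add_0)
    next
      case False
      have "supp x \<subseteq> supp z"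
      proof
        fix e assume "e \<in> supp x"
        then show "e \<in> supp z" using s1[of e] \<open>p \<in> supp z \<or> x p = 0\<close> by (cases "e = p") (auto simp: supp_def)
      qed
      with uni1[OF False] K1_sub show ?thesis by (meson subset_trans)
    qed
  next
    case False
    then have "x p \<noteq> 0" "x p + y p = 0" by (auto simp: supp_def xy(1))
    then have "x \<noteq> 0" "y \<noteq> 0" by auto
    obtain v where v: "v \<in> K1" "v \<noteq> 0" "supp v \<subseteq> supp x" "range v \<subseteq> {-1, 0, 1}"
      using uni1[OF \<open>x \<noteq> 0\<close>] by blast
    obtain w where w: "w \<in> K2" "w \<noteq> 0" "supp w \<subseteq> supp y" "range w \<subseteq> {-1, 0, 1}"
      using uni2[OF \<open>y \<noteq> 0\<close>] by blast
    have sv: "e \<in> supp z" if "e \<in> supp v" "e \<noteq> p" for e using s1[of e] that v(3) by auto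
    have sw: "e \<in> supp z" if "e \<in> supp w" "e \<noteq> p" for e using s2[of e] that w(3) by auto
    show ?thesis
    proof (cases "v p = 0")
      case True
      then have "supp v \<subseteq> supp z" using sv by (auto simp: supp_def)
      with v K1_sub show ?thesis by blast
    next
      case vp: False
      show ?thesis
      proof (cases "w p = 0")
        case True
        then have "supp w \<subseteq> supp z" using sw by (auto simp: supp_def)
        with w K2_sub show ?thesis by blast
      next
        case wp: False
        have vr: "v e = -1 \<or> v e = 0 \<or> v e = 1" and wr: "w e = -1 \<or> w e = 0 \<or> w e = 1" for e
          using v(4) w(4) by (auto simp: image_subset_iff)
        \<comment> \<open>Both values at \<open>p\<close> are signs, so this sign makes
          \<open>v\<close> and \<open>a\<close> times \<open>w\<close> cancel at \<open>p\<close>;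
          elsewhere they do not overlap and the entries stay in range.\<close>
        define a where "a = - v p * w p"
        define u where "u = v + a *\<^sub>R w"
        have a: "a = 1 \<or> a = -1" using vr[of p] wr[of p] vp wp by (auto simp: a_def)
        have u: "u e = v e + a * w e" for e by (simp add: u_def)
        have up: "u p = 0" using wr[of p] wp by (auto simp: u a_def)
        have ev: "v e = 0 \<or> w e = 0" if "e \<noteq> p" for e
          using off1[OF v(1), of e] off2[OF w(1), of e] that inter by blast
        have "u \<in> K" unfolding u_def by (intro KI v k2.scale_mem w)
        moreover have "u \<noteq> 0"
        proof
          assume "u = 0"
          have "\<not> supp v \<subseteq> {p}" using only_p v by blast
          then obtain e where e: "v e \<noteq> 0" "e \<noteq> p" by (auto simp: supp_def)
          then have "u e \<noteq> 0" using ev[of e] by (simp add: u)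
          with \<open>u = 0\<close> show False by simp
        qed
        moreover have "supp u \<subseteq> supp z"
        proof
          fix e assume e: "e \<in> supp u"
          then have "e \<noteq> p" using up by (auto simp: supp_def)
          moreover have "e \<in> supp v \<or> e \<in> supp w" using e by (auto simp: supp_def u)
          ultimately show "e \<in> supp z" using sv sw by blast
        qed
        moreover have "u e \<in> {-1, 0, 1}" for e
          using up ev[of e] vr[of e] wr[of e] a by (cases "e = p") (auto simp: u)
        then have "range u \<subseteq> {-1, 0, 1}" by blast
        ultimately show ?thesis by blast
      qed
    qed
  qed
qed

sublocale unimodular_space "E1 \<union> E2" K
  using relation_space_K unimodular_K
  by (simp add: unimodular_space_def unimodular_space_axioms_def)

lemma basis_with_p:
  obtains B where "k1.basis B" "p \<in> B"
  using k1.ex_basis[OF nonloop] p_in by auto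

text \<open>Keeping \<open>p\<close> in \<open>B1\<close> confines the first summand of any relation
  on the set to \<open>B1\<close>, whatever its value at \<open>p\<close>. It must therefore vanish
  before the second summand is considered.\<close>

lemma basis_glued:
  assumes B1: "k1.basis B1" "p \<in> B1" and B2: "k2.basis B2"
  shows "basis ((B1 - {p}) \<union> B2)"
proof -
  define B where "B = (B1 - {p}) \<union> B2"
  have sub: "B1 \<subseteq> E1" "B2 \<subseteq> E2" using B1 B2 by (auto simp: k1.basis_def k2.basis_def)
  have f1: "free K1 B1" and f2: "free K2 B2" using B1 B2 by (auto simp: k1.basis_def k2.basis_def)
  have "free K B"
    unfolding free_def
  proof (intro ballI impI)
    fix z assume z: "z \<in> K" "supp z \<subseteq> B"
    obtain x y where xy: "z = x + y" "x \<in> K1" "y \<in> K2" using z(1) by (rule KE)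
    have "supp x \<subseteq> B1"
    proof
      fix e assume e: "e \<in> supp x"
      show "e \<in> B1"
      proof (cases "e = p")
        case False
        then have "e \<in> B \<inter> E1" using supp1[OF xy(2,3) _ e] z(2) xy(1) by blast
        then show ?thesis using False inter sub by (auto simp: B_def)
      qed (use B1 in simp)
    qed
    then have "x = 0" using f1 xy(2) by (auto simp: free_def)
    then have "supp y \<subseteq> B \<inter> E2" using z(2) xy k2.supp_mem by auto
    also have "B \<inter> E2 \<subseteq> B2" using inter sub by (auto simp: B_def)
    finally have "y = 0" using f2 xy(3) by (auto simp: free_def)
    with \<open>x = 0\<close> xy(1) show "z = 0" by simp
  qed
  moreover have "\<not> free K (insert e B)" if e: "e \<in> E1 \<union> E2 - B" for e
  proof
    assume free: "free K (insert e B)"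
    show False
    proof (cases "e \<in> E2")
      case True
      then have eB: "e \<in> E2 - B2" using e by (auto simp: B_def)
      note f = k2.fund[OF B2 eB]
      have "k2.fund B2 e = 0" using free K2_sub[OF f(1)] f(3) by (auto simp: free_def B_def)
      with k2.fund_nonzero[OF B2 eB] show False by simp
    next
      case False
      then have eB: "e \<in> E1 - B1" and ep: "e \<noteq> p" using e p_in by (auto simp: B_def)
      define x where "x = k1.fund B1 e"
      note f = k1.fund[OF B1(1) eB, folded x_def]
      show False
      proof (cases "p \<in> B2")
        case True
        then have "supp x \<subseteq> insert e B" using f(3) by (auto simp: B_def)
        then have "x = 0" using free K1_sub[OF f(1)] by (auto simp: free_def)
        with f(2) show False by simp
      next
        case pB: False
        then have pB2: "p \<in> E2 - B2" using p_in by auto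
        \<comment> \<open>A fundamental relation of the first space may use \<open>p\<close>, which
          is absent from the set; the fundamental relation of \<open>p\<close> in the second space
          trades it for elements of \<open>B2\<close>.\<close>
        define w where "w = k2.fund B2 p"
        note g = k2.fund[OF B2 pB2, folded w_def]
        define u where "u = x + (- x p) *\<^sub>R w"
        have uK: "u \<in> K" unfolding u_def by (intro KI k2.scale_mem f g)
        have "supp u \<subseteq> insert e B"
        proof
          fix h assume h: "h \<in> supp u"
          have "h \<noteq> p" using h g(2) by (auto simp: u_def supp_def)
          moreover have "h \<in> supp x \<or> h \<in> supp w" using h by (auto simp: u_def supp_def)
          ultimately show "h \<in> insert e B" using f(3) g(3) by (auto simp: B_def)
        qed
        then have "u = 0" using free uK by (auto simp: free_def)
        moreover have "u e = 1" using f(2) off2[OF g(1) False] by (simp add: u_def)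
        ultimately show False by simp
      qed
    qed
  qed
  ultimately show ?thesis
    unfolding basis_def B_def[symmetric] using sub by (auto simp: B_def)
qed

lemma card_basis_glued:
  assumes B1: "k1.basis B1" "p \<in> B1" and B2: "k2.basis B2"
  shows "Suc (card ((B1 - {p}) \<union> B2)) = card B1 + card B2"
proof -
  have sub: "B1 \<subseteq> E1" "B2 \<subseteq> E2" using B1 B2 by (auto simp: k1.basis_def k2.basis_def)
  have fin: "finite B1" "finite B2" using sub k1.finite_E k2.finite_E finite_subset by blast+
  have "card ((B1 - {p}) \<union> B2) = card (B1 - {p}) + card B2"
    using sub inter fin by (intro card_Un_disjoint) auto
  then show ?thesis using card_Suc_Diff1[OF fin(1) B1(2)] by simp
qed

text \<open>A real splitting of an integral relation could be fractional at \<open>p\<close>. With a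
  basis of the first space that contains \<open>p\<close>, the first summand agrees with
  \<open>c\<close> off the basis, and its expansion in fundamental relations makes it integral at
  \<open>p\<close> as well.\<close>

lemma int_relations_glued:
  "int_relations K = {a + b | a b. a \<in> int_relations K1 \<and> b \<in> int_relations K2}"
proof (intro equalityI subsetI)
  fix c assume "c \<in> int_relations K"
  then have "(\<lambda>e. real_of_int (c e)) \<in> K" by (simp add: int_relations_def)
  then obtain x y where xy: "(\<lambda>e. real_of_int (c e)) = x + y" "x \<in> K1" "y \<in> K2" by (rule KE)
  have c: "real_of_int (c e) = x e + y e" for e using fun_cong[OF xy(1), of e] by simp
  obtain B where B: "k1.basis B" "p \<in> B" by (rule basis_with_p)
  have x_off: "x e \<in> \<int>" if "e \<in> E1 - B" for e
  proof -
    have "e \<notin> E2" using that B inter by auto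
    then have "x e = real_of_int (c e)" using c[of e] off2[OF xy(3)] by simp
    then show ?thesis by simp
  qed
  have x_int: "x g \<in> \<int>" for g
  proof -
    have "x g = (\<Sum>e\<in>E1 - B. x e * k1.fund B e g)"
      using fun_cong[OF k1.fund_expansion[OF B(1) xy(2)], of g] by (simp add: sum_fun_apply)
    also have "\<dots> \<in> \<int>"
    proof (intro Ints_sum Ints_mult x_off)
      fix e assume "e \<in> E1 - B"
      from k1.fund_range[OF B(1) this, of g] show "k1.fund B e g \<in> \<int>" by auto
    qed
    finally show ?thesis .
  qed
  define a where "a = (\<lambda>e. \<lfloor>x e\<rfloor>)"
  have ax: "(\<lambda>e. real_of_int (a e)) = x" using x_int by (simp add: a_def fun_eq_iff)
  have "(\<lambda>e. real_of_int ((c - a) e)) = y" using c fun_cong[OF ax] by (simp add: fun_eq_iff)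
  then have "a \<in> int_relations K1" "c - a \<in> int_relations K2"
    using xy ax by (simp_all add: int_relations_def)
  moreover have "c = a + (c - a)" by simp
  ultimately show "c \<in> {a + b | a b. a \<in> int_relations K1 \<and> b \<in> int_relations K2}" by blast
next
  fix c assume "c \<in> {a + b | a b. a \<in> int_relations K1 \<and> b \<in> int_relations K2}"
  then obtain a b where ab: "c = a + b" "a \<in> int_relations K1" "b \<in> int_relations K2" by blast
  have "(\<lambda>e. real_of_int (c e)) = (\<lambda>e. real_of_int (a e)) + (\<lambda>e. real_of_int (b e))"
    by (simp add: ab(1) fun_eq_iff)
  with KI ab(2,3) show "c \<in> int_relations K" by (simp add: int_relations_def)
qed

abbreviation M1 :: "'a matroid" where "M1 \<equiv> relation_matroid E1 K1"
abbreviation M2 :: "'a matroid" where "M2 \<equiv> relation_matroid E2 K2"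

lemma free_parts:
  assumes "free K I"
  shows "free K1 I" "free K2 I"
  using assms K1_sub K2_sub by (auto simp: free_def)

text \<open>All relations of the first space vanish at the coloop \<open>p\<close>, so the two
  summands have disjoint supports and can be treated separately.\<close>

lemma direct_sum_coloop:
  assumes "coloop M1 p"
  shows "direct_sum (delete M1 p) M2 = relation_matroid (E1 \<union> E2) K"
proof -
  have zero: "x p = 0" if "x \<in> K1" for x using k1.coloop_zero[OF assms that] .
  have "{I \<union> J | I J. I \<in> indeps (delete M1 p) \<and> J \<in> indeps M2} = {I. I \<subseteq> E1 \<union> E2 \<and> free K I}"
    (is "?L = ?R")
  proof (intro equalityI subsetI)
    fix I assume "I \<in> ?L"
    then obtain I1 I2 where I: "I = I1 \<union> I2" "I1 \<subseteq> E1" "free K1 I1" "p \<notin> I1" "I2 \<subseteq> E2" "free K2 I2"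
      unfolding delete_def k1.indeps_matroid k2.indeps_matroid by auto
    have "free K I"
      unfolding free_def
    proof (intro ballI impI)
      fix z assume z: "z \<in> K" "supp z \<subseteq> I"
      obtain x y where xy: "z = x + y" "x \<in> K1" "y \<in> K2" using z(1) by (rule KE)
      have "supp x \<subseteq> I1"
      proof
        fix e assume e: "e \<in> supp x"
        then have "e \<noteq> p" using zero[OF xy(2)] by (auto simp: supp_def)
        then have "e \<in> I \<inter> E1" using supp1[OF xy(2,3) _ e] z(2) xy(1) by blast
        with \<open>e \<noteq> p\<close> show "e \<in> I1" using I inter by auto
      qed
      then have "x = 0" using I(3) xy(2) by (auto simp: free_def)
      then have "supp y \<subseteq> I \<inter> E2" using z(2) xy k2.supp_mem by auto
      also have "I \<inter> E2 \<subseteq> I2" using I inter by auto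
      finally have "y = 0" using I(6) xy(3) by (auto simp: free_def)
      with \<open>x = 0\<close> xy(1) show "z = 0" by simp
    qed
    with I show "I \<in> ?R" by auto
  next
    fix I assume I: "I \<in> ?R"
    then have "free K1 (I \<inter> (E1 - {p}))" "free K2 (I \<inter> E2)"
      using free_parts k1.free_subset[of I] k2.free_subset[of I] by auto
    then have "I \<inter> (E1 - {p}) \<in> indeps (delete M1 p)" "I \<inter> E2 \<in> indeps M2"
      unfolding delete_def k1.indeps_matroid k2.indeps_matroid by auto
    moreover have "I = I \<inter> (E1 - {p}) \<union> I \<inter> E2" using I p_in by auto
    ultimately show "I \<in> ?L" by blast
  qed
  moreover have "ground (delete M1 p) \<union> ground M2 = E1 \<union> E2"
    using p_in by (auto simp: delete_def k1.ground_matroid k2.ground_matroid)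
  ultimately show ?thesis by (simp add: direct_sum_def relation_matroid_def)
qed

text \<open>A loop of the second matroid puts a multiple of the unit vector at \<open>p\<close> into
  \<open>K2\<close>. The coordinate at \<open>p\<close> of a relation in \<open>K1\<close> can thus
  be cleared at no cost, which is contraction by \<open>p\<close>.\<close>

lemma direct_sum_loop:
  assumes "loop M2 p"
  shows "direct_sum (contract M1 p) M2 = relation_matroid (E1 \<union> E2) K"
proof -
  obtain w where w: "w \<in> K2" "supp w \<subseteq> {p}" "w \<noteq> 0"
    using assms unfolding k2.loop_iff free_def by blast
  have w_off: "w e = 0" if "e \<noteq> p" for e using w(2) that by (auto simp: supp_def)
  then have wp: "w p \<noteq> 0" using w(3) by (metis ext zero_fun_apply)
  have "\<not> loop M1 p" using nonloop by (simp add: k1.loop_iff)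
  then have con: "contract M1 p = \<lparr>ground = E1 - {p},
      indeps = {I. I \<subseteq> E1 - {p} \<and> insert p I \<subseteq> E1 \<and> free K1 (insert p I)}\<rparr>"
    by (simp add: contract_def k1.ground_matroid k1.indeps_matroid)
  have "{I \<union> J | I J. I \<in> indeps (contract M1 p) \<and> J \<in> indeps M2} = {I. I \<subseteq> E1 \<union> E2 \<and> free K I}"
    (is "?L = ?R")
  proof (intro equalityI subsetI)
    fix I assume "I \<in> ?L"
    then obtain I1 I2 where I: "I = I1 \<union> I2" "I1 \<subseteq> E1 - {p}" "free K1 (insert p I1)" "I2 \<subseteq> E2" "free K2 I2"
      unfolding con k2.indeps_matroid by auto
    have "free K I"
      unfolding free_def
    proof (intro ballI impI)
      fix z assume z: "z \<in> K" "supp z \<subseteq> I"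
      obtain x y where xy: "z = x + y" "x \<in> K1" "y \<in> K2" using z(1) by (rule KE)
      have "supp x \<subseteq> insert p I1"
      proof
        fix e assume e: "e \<in> supp x"
        show "e \<in> insert p I1"
        proof (cases "e = p")
          case False
          then have "e \<in> I \<inter> E1" using supp1[OF xy(2,3) _ e] z(2) xy(1) by blast
          with False show ?thesis using I inter by auto
        qed simp
      qed
      then have "x = 0" using I(3) xy(2) by (auto simp: free_def)
      then have "supp y \<subseteq> I \<inter> E2" using z(2) xy k2.supp_mem by auto
      also have "I \<inter> E2 \<subseteq> I2" using I inter by auto
      finally have "y = 0" using I(5) xy(3) by (auto simp: free_def)
      with \<open>x = 0\<close> xy(1) show "z = 0" by simp
    qed
    with I show "I \<in> ?R" by auto
  next
    fix I assume I: "I \<in> ?R"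
    have "free K1 (insert p (I \<inter> (E1 - {p})))"
      unfolding free_def
    proof (intro ballI impI)
      fix x assume x: "x \<in> K1" "supp x \<subseteq> insert p (I \<inter> (E1 - {p}))"
      define u where "u = x + (- (x p / w p)) *\<^sub>R w"
      have "u \<in> K" unfolding u_def by (intro KI k2.scale_mem x w)
      moreover have "u p = 0" using wp by (simp add: u_def)
      moreover have ue: "u e = x e" if "e \<noteq> p" for e using w_off[OF that] by (simp add: u_def)
      have "supp u \<subseteq> I"
      proof
        fix e assume e: "e \<in> supp u"
        then have "e \<noteq> p" using \<open>u p = 0\<close> by (auto simp: supp_def)
        then show "e \<in> I" using ue[of e] e x(2) by (auto simp: supp_def)
      qed
      ultimately have "u = 0" using I by (auto simp: free_def)
      then have "x e = 0" if "e \<noteq> p" for e using ue[OF that] by simp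
      then have "supp x \<subseteq> {p}" by (auto simp: supp_def)
      with x(1) show "x = 0" by (rule only_p)
    qed
    then have "I \<inter> (E1 - {p}) \<in> indeps (contract M1 p)" using p_in unfolding con by auto
    moreover have "I \<inter> E2 \<in> indeps M2"
      using I free_parts k2.free_subset[of I] unfolding k2.indeps_matroid by auto
    moreover have "I = I \<inter> (E1 - {p}) \<union> I \<inter> E2" using I p_in by auto
    ultimately show "I \<in> ?L" by blast
  qed
  moreover have "ground (contract M1 p) \<union> ground M2 = E1 \<union> E2"
    unfolding con using p_in by (auto simp: k2.ground_matroid)
  ultimately show ?thesis by (simp add: direct_sum_def relation_matroid_def)
qed

text \<open>If a relation \<open>x + y\<close> lives on \<open>I\<close>, either both summands do
  and one yields a circuit of its own matroid, or they cancel at \<open>p\<close> outside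
  \<open>I\<close> and circuits through \<open>p\<close> combine. Conversely, relations on two
  circuits through \<open>p\<close> can be scaled so that \<open>p\<close> cancels.\<close>

lemma matroid_of_circuits_glued:
  "matroid_of_circuits (E1 \<union> E2) (circuits M1 \<union> circuits M2 \<union>
      {(C1 \<union> C2) - {p} | C1 C2. C1 \<in> circuits M1 \<and> C2 \<in> circuits M2 \<and> p \<in> C1 \<and> p \<in> C2})
    = relation_matroid (E1 \<union> E2) K" (is "matroid_of_circuits _ ?C = _")
proof -
  have "(\<forall>C\<in>?C. \<not> C \<subseteq> I) \<longleftrightarrow> free K I" if IE: "I \<subseteq> E1 \<union> E2" for I
  proof
    assume free: "free K I"
    show "\<forall>C\<in>?C. \<not> C \<subseteq> I"
    proof (intro ballI notI)
      fix C assume "C \<in> ?C" "C \<subseteq> I"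
      then consider "C \<in> circuits M1" | "C \<in> circuits M2"
        | C1 C2 where "C = (C1 \<union> C2) - {p}" "C1 \<in> circuits M1" "C2 \<in> circuits M2" "p \<in> C1" "p \<in> C2"
        by blast
      then show False
      proof cases
        case 1
        then obtain x where "x \<in> K1" "supp x = C" "x \<noteq> 0" by (rule k1.circuit_vector)
        with free K1_sub \<open>C \<subseteq> I\<close> show False unfolding free_def by blast
      next
        case 2
        then obtain x where "x \<in> K2" "supp x = C" "x \<noteq> 0" by (rule k2.circuit_vector)
        with free K2_sub \<open>C \<subseteq> I\<close> show False unfolding free_def by blast
      next
        case 3
        obtain x where x: "x \<in> K1" "supp x = C1" "x \<noteq> 0" using 3(2) by (rule k1.circuit_vector)
        obtain y where y: "y \<in> K2" "supp y = C2" "y \<noteq> 0" using 3(3) by (rule k2.circuit_vector)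
        have nz: "x p \<noteq> 0" "y p \<noteq> 0" using 3 x y by (auto simp: supp_def)
        define u where "u = x + (- (x p / y p)) *\<^sub>R y"
        have "u \<in> K" unfolding u_def by (intro KI k2.scale_mem x y)
        moreover have "u p = 0" using nz by (simp add: u_def)
        then have "supp u \<subseteq> C" using x y 3(1) by (auto simp: u_def supp_def)
        ultimately have "u = 0" using free \<open>C \<subseteq> I\<close> unfolding free_def by blast
        have "\<not> supp x \<subseteq> {p}" using only_p x by blast
        then obtain e where e: "x e \<noteq> 0" "e \<noteq> p" by (auto simp: supp_def)
        then have "e \<in> E1" using off1[OF x(1)] by blast
        then have "y e = 0" using off2[OF y(1), of e] inter e by blast
        then have "u e \<noteq> 0" using e by (simp add: u_def)
        with \<open>u = 0\<close> show False by simp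
      qed
    qed
  next
    assume no_circuit: "\<forall>C\<in>?C. \<not> C \<subseteq> I"
    have f1: "free K1 J" if J: "J \<subseteq> I \<inter> E1" for J
    proof (rule ccontr)
      assume "\<not> free K1 J"
      then obtain C where "C \<in> circuits M1" "C \<subseteq> J" using k1.circuit_in_dependent[of J] J by blast
      with no_circuit J show False by blast
    qed
    have f2: "free K2 J" if J: "J \<subseteq> I \<inter> E2" for J
    proof (rule ccontr)
      assume "\<not> free K2 J"
      then obtain C where "C \<in> circuits M2" "C \<subseteq> J" using k2.circuit_in_dependent[of J] J by blast
      with no_circuit J show False by blast
    qed
    show "free K I"
      unfolding free_def
    proof (intro ballI impI, rule ccontr)
      fix z assume z: "z \<in> K" "supp z \<subseteq> I" "z \<noteq> 0"
      obtain x y where xy: "z = x + y" "x \<in> K1" "y \<in> K2" using z(1) by (rule KE)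
      have s1: "supp x \<subseteq> insert p (I \<inter> E1)" and s2: "supp y \<subseteq> insert p (I \<inter> E2)"
        using supp1[OF xy(2,3), of I] supp2[OF xy(2,3), of I] z(2) xy(1) by auto
      show False
      proof (cases "supp x \<subseteq> I \<and> supp y \<subseteq> I")
        case True
        then have "x = 0" "y = 0"
          using f1[of "supp x"] f2[of "supp y"] k1.supp_mem[OF xy(2)] k2.supp_mem[OF xy(3)] xy
          unfolding free_def by auto
        with z(3) xy(1) show False by simp
      next
        case False
        have pI: "p \<notin> I" using False s1 s2 by auto
        then have "(x + y) p = 0" using z(2) xy(1) by (auto simp: supp_def)
        moreover have "x p \<noteq> 0 \<or> y p \<noteq> 0" using False s1 s2 by (auto simp: supp_def)
        ultimately have nz: "x p \<noteq> 0" "y p \<noteq> 0" by auto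
        then have "x \<noteq> 0" "y \<noteq> 0" by auto
        then have "\<not> free K1 (insert p (I \<inter> E1))" "\<not> free K2 (insert p (I \<inter> E2))"
          using s1 s2 xy unfolding free_def by blast+
        moreover have "insert p (I \<inter> E1) \<subseteq> E1" "insert p (I \<inter> E2) \<subseteq> E2" using p_in by auto
        ultimately obtain C1 C2 where C: "C1 \<in> circuits M1" "C1 \<subseteq> insert p (I \<inter> E1)"
          "C2 \<in> circuits M2" "C2 \<subseteq> insert p (I \<inter> E2)"
          using k1.circuit_in_dependent k2.circuit_in_dependent by metis
        \<comment> \<open>A circuit that avoids \<open>p\<close> would lie within \<open>I\<close>,
          which is excluded.\<close>
        have p: "p \<in> C1" "p \<in> C2" using C no_circuit by blast+
        then have "(C1 \<union> C2) - {p} \<in> ?C" using C by blast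
        moreover have "(C1 \<union> C2) - {p} \<subseteq> I" using C by blast
        ultimately show False using no_circuit by blast
      qed
    qed
  qed
  then show ?thesis by (auto simp: matroid_of_circuits_def relation_matroid_def)
qed

theorem parallel_connection_eq:
  "parallel_connection M1 M2 p = relation_matroid (E1 \<union> E2) K"
proof -
  have "\<not> loop M1 p" using nonloop by (simp add: k1.loop_iff)
  then show ?thesis
    using direct_sum_coloop direct_sum_loop matroid_of_circuits_glued
    by (simp add: parallel_connection_def k1.ground_matroid k2.ground_matroid)
qed

theorem hstar_parallel_connection:
  assumes bip: "bipartite_matroid M1"
  shows "hstar (\<Sigma> (parallel_connection M1 M2 p)) = hstar (\<Sigma> M1) * hstar (\<Sigma> M2) / (1 + fps_X)"
proof -
  interpret L: glued_lattices E1 E2 "int_relations K1" "int_relations K2" p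
  proof
    show "E1 \<inter> E2 = {p}" by (rule inter)
  next
    fix c k
    assume "supp c \<subseteq> E1" "\<And>j. wt (int_relations K1) c \<le> wt (int_relations K1) (c + unit_at p j)"
    then show "wt (int_relations K1) (c + unit_at p k) = wt (int_relations K1) c + nat \<bar>k\<bar>"
      by (rule k1.wt_V_shaped[OF bip p_in(1)])
  qed
  obtain B1 where B1: "k1.basis B1" "p \<in> B1" by (rule basis_with_p)
  obtain B2 where B2: "k2.basis B2" using k2.ex_basis[OF k2.free_empty] by blast
  define B where "B = (B1 - {p}) \<union> B2"
  have B: "basis B" unfolding B_def by (rule basis_glued[OF B1 B2])
  have "finite B1" using B1 k1.finite_E finite_subset by (auto simp: k1.basis_def)
  \<comment> \<open>One factor \<open>1 - t\<close> of the first polynomial is used up in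
    \<open>S1 * Y = Q * (1 + t)\<close>. The other \<open>k\<close> factors and those of the second
    polynomial make up the rank of the parallel connection.\<close>
  then obtain k where k: "card B1 = Suc k" using B1(2) by (metis card_Suc_Diff1)
  then have cardB: "card B = k + card B2" using card_basis_glued[OF B1 B2] by (simp add: B_def)
  define S1 S2 Q :: "rat fps" where "S1 = Abs_fps (\<lambda>m. of_nat (card (shell E1 (int_relations K1) m)))"
    and "S2 = Abs_fps (\<lambda>m. of_nat (card (shell E2 (int_relations K2) m)))"
    and "Q = Abs_fps (\<lambda>m. of_nat (card (L.min_shell m)))"
  define Y :: "rat fps" where "Y = 1 - fps_X"
  have ne: "E1 \<noteq> {}" "E2 \<noteq> {}" "E1 \<union> E2 \<noteq> {}" using p_in by auto
  have h1: "hstar (\<Sigma> M1) = S1 * Y ^ Suc k" and h2: "hstar (\<Sigma> M2) = S2 * Y ^ card B2"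
    using k1.hstar_eq[OF ne(1) B1(1)] k2.hstar_eq[OF ne(2) B2] by (simp_all only: S1_def S2_def Y_def k)
  have "hstar (\<Sigma> (parallel_connection M1 M2 p)) = Q * S2 * Y ^ card B"
    using hstar_eq[OF ne(3) B] L.shell_fps_glued
    by (simp only: parallel_connection_eq int_relations_glued Q_def S2_def Y_def)
  moreover have "hstar (\<Sigma> M1) * hstar (\<Sigma> M2) = Q * S2 * Y ^ card B * (1 + fps_X)"
  proof -
    have "hstar (\<Sigma> M1) * hstar (\<Sigma> M2) = (S1 * Y) * (S2 * (Y ^ k * Y ^ card B2))"
      by (simp only: h1 h2 power_Suc mult_ac)
    also have "S1 * Y = Q * (1 + fps_X)" using L.shell_fps by (simp only: S1_def Q_def Y_def)
    finally show ?thesis by (simp only: cardB power_add mult_ac)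
  qed
  moreover have "(1 + fps_X :: rat fps) \<noteq> 0"
  proof
    assume "(1 + fps_X :: rat fps) = 0"
    then have "fps_nth (1 + fps_X :: rat fps) 0 = 0" by simp
    then show False by simp
  qed
  ultimately show ?thesis by (simp only: nonzero_mult_div_cancel_right not_False_eq_True)
qed

end

theorem theorem3p5:
  fixes M\<^sub>1 M\<^sub>2 :: "'a matroid" and p :: 'a
  assumes "regular_matroid M\<^sub>1" and "bipartite_matroid M\<^sub>1"
    and "regular_matroid M\<^sub>2"
    and "ground M\<^sub>1 \<inter> ground M\<^sub>2 = {p}"
  shows "hstar (\<Sigma> (parallel_connection M\<^sub>1 M\<^sub>2 p)) =
    hstar (\<Sigma> M\<^sub>1) * hstar (\<Sigma> M\<^sub>2) / (1 + fps_X)"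
proof -
  have rep: "\<exists>K. unimodular_space (ground M) K \<and> M = relation_matroid (ground M) K"
    if "regular_matroid M" for M :: "'a matroid"
  proof -
    obtain n A where A: "totally_unimodular n (ground M) A" "M = vector_matroid (ground M) A"
      using \<open>regular_matroid M\<close> by (auto simp: regular_matroid_def tu_represents_def)
    have fin: "finite (ground M)" using A(1) by (simp add: totally_unimodular_def is_matrix_def)
    have "unimodular_space (ground M) (relations (ground M) A)"
      using relation_space_relations[OF fin] tu_unimodular[OF A(1)]
      by (simp add: unimodular_space_def unimodular_space_axioms_def)
    moreover have "M = relation_matroid (ground M) (relations (ground M) A)"
      using A(2) by (simp only: vector_matroid_eq[OF fin])
    ultimately show ?thesis by blast
  qed
  obtain K1 where K1: "unimodular_space (ground M\<^sub>1) K1" "M\<^sub>1 = relation_matroid (ground M\<^sub>1) K1"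
    using rep[OF assms(1)] by blast
  obtain K2 where K2: "unimodular_space (ground M\<^sub>2) K2" "M\<^sub>2 = relation_matroid (ground M\<^sub>2) K2"
    using rep[OF assms(3)] by blast
  interpret k1: unimodular_space "ground M\<^sub>1" K1 by (rule K1)
  interpret k2: unimodular_space "ground M\<^sub>2" K2 by (rule K2)
  \<comment> \<open>This excludes the first case in the definition of the parallel connection, where
    the sum of the relation spaces would not represent the contraction of the second
    matroid.\<close>
  have "\<not> loop M\<^sub>1 p"
  proof
    assume "loop M\<^sub>1 p"
    then have "even (card {p})" using assms(2) unfolding loop_def bipartite_matroid_def by blast
    then show False by simp
  qed
  moreover have "p \<in> ground M\<^sub>1" using assms(4) by blast
  ultimately have "free K1 {p}" using k1.loop_iff[of p] unfolding K1(2)[symmetric] by simp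
  then interpret glued_spaces "ground M\<^sub>1" "ground M\<^sub>2" K1 K2 p
    using assms(4) by unfold_locales
  show ?thesis
    using hstar_parallel_connection assms(2) unfolding K1(2)[symmetric] K2(2)[symmetric] by simp
qed

end
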